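(* Let $(X,d,\mu)$ be a space of homogeneous type satisfying the standing assumptions in the context. Let $1<p<\infty$, $0<\lambda<1$, $0<\alpha<(1-\lambda)/p$, and let $q$ be defined by $\frac1p-\frac1q=\frac{\alpha}{1-\lambda}$. Suppose that $\theta_1>0$ and $\theta_2\ge\theta_1\left[1+\frac{\alpha q}{1-\lambda}\right]$. Let $A_1$ and $A_2$ be continuous non-negative non-decreasing functions on $(0,p-1]$ and $(0,q-1]$ respectively, satisfying: (i) $A_2\in C^1((0,\delta])$ for some $\delta>0$; (ii) $\lim_{x\to0+}A_2(x)=0$; (iii) the limit $B:=\lim_{x\to0+}\frac{d}{dx}A_2(x)$ exists and $0\le B<\frac{(1-\lambda)^2}{\alpha q^2}$; (iv) $A_1(\eta)=A_2(\bar\phi^{-1}(\eta))$, where $\bar\phi^{-1}$ is the inverse, on $(0,\delta]$ for some $\delta>0$, of the function $$\bar\phi(x)=p+\frac{(x-q)(1-\lambda+A_2(x))}{1-\lambda+A_2(x)-\alpha(x-q)}.$$ Let $I^\alpha$ be the potential operator and $M$ the Hardy–Littlewood maximal operator on $X$. If $b\in\mathrm{BMO}(X,\mu)$, then the operator $f\mapsto M([b,I^\alpha]f)$, where $[b,I^\alpha]f=b\,I^\alpha(f)-I^\alpha(bf)$, is bounded from $L^{p),\lambda)}_{\theta_1,A_1}(X,\mu)$ to $L^{q),\lambda)}_{\theta_2,A_2}(X,\mu)$; that is, there is a constant $C>0$ such that $$\|M([b,I^\alpha]f)\|_{L^{q),\lambda)}_{\theta_2,A_2}(X,\mu)}\le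 C\,\|f\|_{L^{p),\lambda)}_{\theta_1,A_1}(X,\mu)}\qquad\text{for all } f\in L^{p),\lambda)}_{\theta_1,A_1}(X,\mu).$$
   Context: Standing assumptions on $(X,d,\mu)$. $X$ is a topological space with a complete positive measure $\mu$ such that compactly supported continuous functions are dense in $L^1(X,\mu)$. $d:X\times X\to[0,\infty)$ is a quasimetric: $d(x,y)=0$ iff $x=y$; $d(x,y)\le C_t[d(x,z)+d(z,y)]$; $d(x,y)\le C_s d(y,x)$, for constants $C_t,C_s>0$. Write $B(x,r)=\{y\in X:d(x,y)<r\}$; balls are measurable with $\mu B(x,r)<\infty$, and every neighborhood of $x$ contains some ball $B(x,r)$, $r>0$. Let $d_X$ be the diameter of $X$, assumed finite. $\mu$ is doubling: $\mu B(x,2r)\le C_d\,\mu B(x,r)$ for all $x\in X$, $0<r<d_X$, with $C_d>1$ independent of $x,r$. Moreover $\mu(B(x,R)\setminus B(x,r))>0$ for all $x\in X$, $0<r<R<d_X$. Finally $\mu$ is upper $\gamma$-Ahlfors regular for some $\gamma>0$: $\mu B(x,r)\le c\,r^\gamma$ with $c$ independent of $x,r$. Morrey space. For $1\le q<\infty$, $0\le\nu<1$: $\|f\|_{L^{q,\nu}(X,\mu)}=\sup_{x\in X,\,0<r<d_X}\big(\mu B(x,r)^{-\nu}\int_{B(x,r)}|f|^q\,d\mu\big)^{1/q}$. Generalized grand Morrey space. For $1<p<\infty$, $0\le\lambda<1$, $\theta>0$ and $A$ non-decreasing, non-negative, with $\lim_{x\to0+}A(x)=0$, the space $L^{p),\lambda)}_{\theta,A}(X,\mu)$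 consists of the measurable $f$ with $$\|f\|_{L^{p),\lambda)}_{\theta,A}(X,\mu)}=\sup_{0<\varepsilon<s_{\max}}\varepsilon^{\frac{\theta}{p-\varepsilon}}\|f\|_{L^{p-\varepsilon,\lambda-A(\varepsilon)}(X,\mu)}<\infty,\quad s_{\max}=\min\{p-1,a\},\ a=\sup\{x>0:A(x)\le\lambda\}.$$ BMO. $\mathrm{BMO}(X,\mu)$ is the set of real-valued locally integrable $b$ with $\|b\|_{\mathrm{BMO}}=\sup_{x\in X,\,0<r<d_X}\frac1{\mu B(x,r)}\int_{B(x,r)}|b-b_{B(x,r)}|\,d\mu<\infty$, where $b_B$ is the integral average of $b$ over $B$. Potential operator. For $0<\alpha<1$, $I^\alpha f(x)=\int_X\frac{f(y)}{\mu B(x,d(x,y))^{1-\alpha}}\,d\mu(y)$. Maximal operator. $Mf(x)=\sup_{0<r<d_X}\frac1{\mu B(x,r)}\int_{B(x,r)}|f(y)|\,d\mu(y)$. *)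

theory Defs
  imports "HOL-Analysis.Analysis"
begin

section \<open>Spaces of homogeneous type\<close>

definition qball :: "('a \<Rightarrow> 'a \<Rightarrow> real) \<Rightarrow> 'a \<Rightarrow> real \<Rightarrow> 'a set" where
  "qball d x r = {y. d x y < r}"

definition qdiam :: "('a \<Rightarrow> 'a \<Rightarrow> real) \<Rightarrow> real" where
  "qdiam d = (SUP (x, y)\<in>UNIV. d x y)"

definition compactly_supported_continuous :: "('a::topological_space \<Rightarrow> real) \<Rightarrow> bool" where
  "compactly_supported_continuous g \<longleftrightarrow>
     continuous_on UNIV g \<and> compact (closure {x. g x \<noteq> 0})"

text \<open>
  The underlying set of the space is the whole type. Since balls have finite measure, the real
  valued \<^const>\<open>measure\<close> may be used for them. The measure is not assumed to be Borel;
  measurability of continuous functions enters only through \<open>Cc_integrable\<close>.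
\<close>

locale homogeneous_type_space = complete_measure M
  for M :: "'a::topological_space measure" +
  fixes d :: "'a \<Rightarrow> 'a \<Rightarrow> real" and C\<^sub>t C\<^sub>s C\<^sub>d \<gamma> c :: real
  assumes space_UNIV: "space M = UNIV"
    and Cc_integrable: "\<And>g. compactly_supported_continuous g \<Longrightarrow> integrable M g"
    and Cc_dense: "\<And>(f::'a \<Rightarrow> real) e. integrable M f \<Longrightarrow> 0 < e \<Longrightarrow>
        \<exists>g. compactly_supported_continuous g \<and> (LINT x|M. \<bar>f x - g x\<bar>) < e"
    and Ct_pos: "0 < C\<^sub>t" and Cs_pos: "0 < C\<^sub>s"
    and d_nonneg: "\<And>x y. 0 \<le> d x y"
    and d_eq_0_iff: "\<And>x y. d x y = 0 \<longleftrightarrow> x = y"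
    and d_quasi_triangle: "\<And>x y z. d x y \<le> C\<^sub>t * (d x z + d z y)"
    and d_quasi_symmetric: "\<And>x y. d x y \<le> C\<^sub>s * d y x"
    and ball_sets: "\<And>x r. qball d x r \<in> sets M"
    and ball_finite: "\<And>x r. emeasure M (qball d x r) < \<infinity>"
    and ball_in_nhd: "\<And>U x. open U \<Longrightarrow> x \<in> U \<Longrightarrow> \<exists>r>0. qball d x r \<subseteq> U"
    and diam_finite: "bdd_above (range (\<lambda>(x, y). d x y))"
    and Cd_gt_1: "1 < C\<^sub>d"
    and doubling: "\<And>x r. 0 < r \<Longrightarrow> r < qdiam d \<Longrightarrow>
        measure M (qball d x (2 * r)) \<le> C\<^sub>d * measure M (qball d x r)"
    and annulus_pos: "\<And>x r R. 0 < r \<Longrightarrow> r < R \<Longrightarrow> R < qdiam d \<Longrightarrow>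
        0 < measure M (qball d x R - qball d x r)"
    and \<gamma>_pos: "0 < \<gamma>"
    and upper_Ahlfors: "\<And>x r. 0 < r \<Longrightarrow> measure M (qball d x r) \<le> c * r powr \<gamma>"


section \<open>Morrey and generalized grand Morrey spaces\<close>

text \<open>
  The (quasi-)norms are defined for functions with values in $[0,\infty]$, so that they apply both
  to the modulus of a real function and to a maximal function.
\<close>

text \<open>Only used for exponents \<open>s > 0\<close>.\<close>
definition ennpowr :: "ennreal \<Rightarrow> real \<Rightarrow> ennreal" where
  "ennpowr x s = (if x = \<infinity> then \<infinity> else ennreal (enn2real x powr s))"

definition morrey_norm ::
    "'a measure \<Rightarrow> ('a \<Rightarrow> 'a \<Rightarrow> real) \<Rightarrow> real \<Rightarrow> real \<Rightarrow> ('a \<Rightarrow> ennreal) \<Rightarrow> ennreal" where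
  "morrey_norm M d q \<nu> g =
     (SUP x. SUP r\<in>{0<..<qdiam d}.
        ennpowr ((\<integral>\<^sup>+y\<in>qball d x r. ennpowr (g y) q \<partial>M)
                  / ennreal (measure M (qball d x r) powr \<nu>)) (1 / q))"

text \<open>
  The function \<open>A\<close> is only meaningful on $(0,p-1]$, so the supremum
  $a=\sup\{x>0 : A(x)\le\lambda\}$ is taken inside that interval. For non-decreasing \<open>A\<close> this
  already gives $\min\{p-1,a\}$.
\<close>
definition s_max :: "real \<Rightarrow> real \<Rightarrow> (real \<Rightarrow> real) \<Rightarrow> real" where
  "s_max p lam A = min (p - 1) (Sup {x. 0 < x \<and> x \<le> p - 1 \<and> A x \<le> lam})"

definition grand_morrey_norm ::
    "'a measure \<Rightarrow> ('a \<Rightarrow> 'a \<Rightarrow> real) \<Rightarrow> real \<Rightarrow> real \<Rightarrow> real \<Rightarrow> (real \<Rightarrow> real)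
      \<Rightarrow> ('a \<Rightarrow> ennreal) \<Rightarrow> ennreal" where
  "grand_morrey_norm M d p lam \<theta> A g =
     (SUP \<epsilon>\<in>{0<..<s_max p lam A}.
        ennreal (\<epsilon> powr (\<theta> / (p - \<epsilon>))) * morrey_norm M d (p - \<epsilon>) (lam - A \<epsilon>) g)"

definition grand_morrey ::
    "'a measure \<Rightarrow> ('a \<Rightarrow> 'a \<Rightarrow> real) \<Rightarrow> real \<Rightarrow> real \<Rightarrow> real \<Rightarrow> (real \<Rightarrow> real)
      \<Rightarrow> ('a \<Rightarrow> real) set" where
  "grand_morrey M d p lam \<theta> A =
     {f \<in> borel_measurable M. grand_morrey_norm M d p lam \<theta> A (\<lambda>x. ennreal \<bar>f x\<bar>) < \<infinity>}"


section \<open>Functions of bounded mean oscillation\<close>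

definition ball_average ::
    "'a measure \<Rightarrow> ('a \<Rightarrow> 'a \<Rightarrow> real) \<Rightarrow> ('a \<Rightarrow> real) \<Rightarrow> 'a \<Rightarrow> real \<Rightarrow> real" where
  "ball_average M d b x r = (LINT y:qball d x r|M. b y) / measure M (qball d x r)"

definition bmo_norm ::
    "'a measure \<Rightarrow> ('a \<Rightarrow> 'a \<Rightarrow> real) \<Rightarrow> ('a \<Rightarrow> real) \<Rightarrow> ennreal" where
  "bmo_norm M d b =
     (SUP x. SUP r\<in>{0<..<qdiam d}.
        (\<integral>\<^sup>+y\<in>qball d x r. ennreal \<bar>b y - ball_average M d b x r\<bar> \<partial>M)
          / emeasure M (qball d x r))"

text \<open>Local integrability means integrability on every ball.\<close>
definition BMO :: "'a measure \<Rightarrow> ('a \<Rightarrow> 'a \<Rightarrow> real) \<Rightarrow> ('a \<Rightarrow> real) set" where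
  "BMO M d = {b \<in> borel_measurable M.
     (\<forall>x r. set_integrable M (qball d x r) b) \<and> bmo_norm M d b < \<infinity>}"


section \<open>Potential operator, commutator and maximal operator\<close>

text \<open>
  At \<open>y = x\<close> the ball \<open>qball d x (d x y)\<close> is empty and the kernel has value \<open>0\<close>
  by the convention for division; under \<open>upper_Ahlfors\<close> the point \<open>x\<close> is a null set.
\<close>
definition potential_integrand ::
    "'a measure \<Rightarrow> ('a \<Rightarrow> 'a \<Rightarrow> real) \<Rightarrow> real \<Rightarrow> ('a \<Rightarrow> real) \<Rightarrow> 'a \<Rightarrow> 'a \<Rightarrow> real" where
  "potential_integrand M d \<alpha> f x y = f y / measure M (qball d x (d x y)) powr (1 - \<alpha>)"

definition potential ::
    "'a measure \<Rightarrow> ('a \<Rightarrow> 'a \<Rightarrow> real) \<Rightarrow> real \<Rightarrow> ('a \<Rightarrow> real) \<Rightarrow> 'a \<Rightarrow> real" where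
  "potential M d \<alpha> f x = (LINT y|M. potential_integrand M d \<alpha> f x y)"

definition potential_commutator ::
    "'a measure \<Rightarrow> ('a \<Rightarrow> 'a \<Rightarrow> real) \<Rightarrow> real \<Rightarrow> ('a \<Rightarrow> real) \<Rightarrow> ('a \<Rightarrow> real) \<Rightarrow> 'a \<Rightarrow> real" where
  "potential_commutator M d \<alpha> b f x =
     b x * potential M d \<alpha> f x - potential M d \<alpha> (\<lambda>y. b y * f y) x"

text \<open>
  The Bochner integral is \<open>0\<close> for non-integrable functions, so the following has to be
  stated separately: both integrals in \<^const>\<open>potential_commutator\<close> converge absolutely
  at almost every point.
\<close>
definition commutator_well_defined ::
    "'a measure \<Rightarrow> ('a \<Rightarrow> 'a \<Rightarrow> real) \<Rightarrow> real \<Rightarrow> ('a \<Rightarrow> real) \<Rightarrow> ('a \<Rightarrow> real) \<Rightarrow> bool" where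
  "commutator_well_defined M d \<alpha> b f \<longleftrightarrow>
     (AE x in M. integrable M (potential_integrand M d \<alpha> f x) \<and>
                 integrable M (potential_integrand M d \<alpha> (\<lambda>y. b y * f y) x))"

definition maximal_operator ::
    "'a measure \<Rightarrow> ('a \<Rightarrow> 'a \<Rightarrow> real) \<Rightarrow> ('a \<Rightarrow> real) \<Rightarrow> 'a \<Rightarrow> ennreal" where
  "maximal_operator M d f x =
     (SUP r\<in>{0<..<qdiam d}.
        (\<integral>\<^sup>+y\<in>qball d x r. ennreal \<bar>f y\<bar> \<partial>M) / emeasure M (qball d x r))"


definition phi_bar ::
    "real \<Rightarrow> real \<Rightarrow> real \<Rightarrow> real \<Rightarrow> (real \<Rightarrow> real) \<Rightarrow> real \<Rightarrow> real" where
  "phi_bar p q lam \<alpha> A x =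
     p + (x - q) * (1 - lam + A x) / (1 - lam + A x - \<alpha> * (x - q))"

end

theory Submission
  imports Defs
begin

text \<open>
  Since no joint measurability of \<open>d\<close> is available, neither maximal functions nor potentials are known
  to be measurable; every estimate is therefore an estimate for a measurable majorant, chosen ball by
  ball, and Fubini's theorem is never applied.

  For small \<open>\<kappa> > 0\<close> one has \<open>1 + |b x - b y| \<le> \<kappa>\<^sup>-\<^sup>2 exp (\<kappa> |b x - b\<^sub>B|) exp (\<kappa> |b y - b\<^sub>B|)\<close>, so the commutator is
  dominated by a sum over dyadic balls \<open>B\<close> around \<open>x\<close> of exponentially weighted averages of \<open>|f|\<close>. By the
  John--Nirenberg inequality \<open>exp (\<sigma> b)\<close> is the density of a doubling measure, for which the maximal theorem holds;
  this bounds the weighted maximal function on Morrey spaces. Hedberg's splitting of the sum then gives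
  the Sobolev gain \<open>1/s - 1/t = \<alpha>/(1 - \<nu>)\<close>, with constants uniform in the exponents.

  In the grand Morrey norm, \<open>\<eta> = phi_bar \<epsilon>\<close> is exactly the parameter for which \<open>p - \<eta>\<close> and \<open>q - \<epsilon>\<close> are related in
  this way with \<open>\<nu> = lam - A\<^sub>2 \<epsilon>\<close>. The bound on \<open>B\<close> makes \<open>\<eta>\<close> at least a multiple of \<open>\<epsilon>\<close>, whence \<open>\<epsilon>\<^bsup>\<theta>\<^sub>2/(q-\<epsilon>)\<^esup>\<close> is at
  most a multiple of \<open>\<eta>\<^bsup>\<theta>\<^sub>1/(p-\<eta>)\<^esup>\<close>; large \<open>\<epsilon>\<close> reduce to small ones by Hoelder's inequality.
\<close>

section \<open>Balls, coverings and doubling\<close>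

text \<open>The grand norm is a supremum over exponents, so one constant has to serve all of them at
  once. Estimates are therefore made for whole ranges of exponents, bounded away from 1 and from
  above, with \<open>\<nu> \<le> lam\<close>, and all auxiliary parameters are fixed before the
  exponents.

  The factor |b x - b y| of the commutator is unbounded, and exponential weights tame it for the
  following reason. Jensen's inequality and exponential integrability show that averages of b over
  nested balls differ by at most a multiple of the logarithm of the ratio of their measures, up to a
  constant. A weight exp (\<kappa> |b x - b_B|) thus changes between scales by at most a small power
  of that ratio, up to a constant factor. For small \<kappa> this is less than what Morrey functions
  gain: their averages decay like the power -(1 - \<nu>) / s of the measure of the ball. Reverse
  doubling, drawn from the annulus condition, turns decay in measure into geometric decay in the
  index of the scale, which makes the sum over scales converge.\<close>

context homogeneous_type_space
begin

abbreviation ball :: "'a \<Rightarrow> real \<Rightarrow> 'a set" where "ball \<equiv> qball d"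
abbreviation m :: "'a set \<Rightarrow> real" where "m \<equiv> measure M"

text \<open>Both quasimetric constants are folded into one number; the lower bound 1 makes its
  powers increase, so dilation factors can be compared term by term.\<close>

definition qK :: real where "qK = max 1 (max C\<^sub>t C\<^sub>s)"

lemma qK_ge_1: "1 \<le> qK" by (simp add: qK_def)

lemma qd_triangle: "d x y \<le> qK * (d x z + d z y)"
proof -
  have "C\<^sub>t * (d x z + d z y) \<le> qK * (d x z + d z y)"
    by (rule mult_right_mono) (auto simp: qK_def d_nonneg)
  then show ?thesis using d_quasi_triangle[of x y z] by linarith
qed

lemma qd_sym: "d x y \<le> qK * d y x"
proof -
  have "C\<^sub>s * d y x \<le> qK * d y x"
    by (rule mult_right_mono) (auto simp: qK_def d_nonneg)
  then show ?thesis using d_quasi_symmetric[of x y] by linarith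
qed

lemma d_self [simp]: "d x x = 0" using d_eq_0_iff by blast

lemma mem_ball: "y \<in> ball x r \<longleftrightarrow> d x y < r" by (simp add: qball_def)

lemma ball_mono: "r \<le> s \<Longrightarrow> ball x r \<subseteq> ball x s" by (auto simp: mem_ball)

lemma d_le_diam: "d x y \<le> qdiam d"
  unfolding qdiam_def using diam_finite by (intro cSUP_upper2[where x="(x,y)"]) auto

lemma ball_UNIV: "qdiam d < r \<Longrightarrow> ball x r = UNIV"
  by (auto simp: mem_ball intro: le_less_trans[OF d_le_diam])

lemma ball_measurable [measurable]: "ball x r \<in> sets M" by (rule ball_sets)

lemma UNIV_in_sets [measurable, simp]: "UNIV \<in> sets M" using sets.top[of M] by (simp add: space_UNIV)

text \<open>The whole space is a ball of radius beyond the finite diameter. Finite total measure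
  makes local integrability global and limits the size of disjoint families.\<close>

sublocale finite_measure M
proof
  have "ball undefined (qdiam d + 1) = space M" by (simp add: ball_UNIV space_UNIV)
  then show "emeasure M (space M) \<noteq> \<infinity>" using ball_finite by (metis less_irrefl)
qed

text \<open>The factor arises along the path from y through a common point z and the centre x to u:
  \<open>d z u\<close> costs at most \<open>4 * qK^2 * s\<close>, to which the leg from y adds s
  before the last triangle inequality multiplies by \<open>qK\<close>.\<close>

lemma ball_engulf:
  assumes "ball x r \<inter> ball y s \<noteq> {}" "r \<le> 2 * s"
  shows "ball x r \<subseteq> ball y (5 * qK ^ 3 * s)"
proof
  fix u assume u: "u \<in> ball x r"
  obtain z where z: "d x z < r" "d y z < s" using assms by (auto simp: mem_ball)
  have K: "1 \<le> qK" by (rule qK_ge_1)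
  have s: "0 < s" using z d_nonneg[of y z] by linarith
  have "d z x \<le> qK * r" using qd_sym[of z x] mult_left_mono[of "d x z" r qK] z K by linarith
  moreover have "r \<le> qK * r" using z d_nonneg[of x z] K mult_right_mono[of 1 qK r] by linarith
  ultimately have "d z x + d x u \<le> 2 * (qK * r)" using u by (simp add: mem_ball)
  then have "d z u \<le> qK * (2 * (qK * r))"
    using qd_triangle[of z u x] mult_left_mono[of "d z x + d x u" "2 * (qK * r)" qK] K by linarith
  also have "\<dots> \<le> qK * (2 * (qK * (2 * s)))" using assms(2) K by (intro mult_left_mono) auto
  finally have "d z u \<le> 4 * qK^2 * s" by (simp add: power2_eq_square algebra_simps)
  moreover have "s \<le> qK^2 * s" using s K mult_right_mono[of 1 "qK^2" s] by (simp add: one_le_power)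
  ultimately have "d y z + d z u < 5 * qK^2 * s" using z by linarith
  then have "qK * (d y z + d z u) < qK * (5 * qK^2 * s)" using K by (intro mult_strict_left_mono) auto
  then show "u \<in> ball y (5 * qK ^ 3 * s)" using qd_triangle[of y u z]
    by (simp add: mem_ball power3_eq_cube power2_eq_square algebra_simps)
qed

text \<open>In the second inclusion the path starts by going from x back to y, against the given
  direction, so quasi-symmetry costs an extra factor \<open>qK\<close>.\<close>

lemma ball_subset_center_in:
  assumes "x \<in> ball y r"
  shows "ball x r \<subseteq> ball y (2 * qK * r)" and "ball y r \<subseteq> ball x (2 * qK\<^sup>2 * r)"
proof -
  have K: "1 \<le> qK" by (rule qK_ge_1)
  have yx: "d y x < r" using assms by (simp add: mem_ball)
  have r: "0 < r" using yx d_nonneg[of y x] by linarith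
  show "ball x r \<subseteq> ball y (2 * qK * r)"
  proof
    fix u assume "u \<in> ball x r"
    then have "qK * (d y x + d x u) < qK * (2 * r)" using yx K
      by (intro mult_strict_left_mono) (auto simp: mem_ball)
    then show "u \<in> ball y (2 * qK * r)" using qd_triangle[of y u x] by (simp add: mem_ball algebra_simps)
  qed
  show "ball y r \<subseteq> ball x (2 * qK\<^sup>2 * r)"
  proof
    fix u assume u: "u \<in> ball y r"
    have "d x y \<le> qK * r" using qd_sym[of x y] mult_left_mono[of "d y x" r qK] yx K by linarith
    moreover have "r \<le> qK * r" using r K mult_right_mono[of 1 qK r] by linarith
    ultimately have "d x y + d y u < 2 * (qK * r)" using u by (simp add: mem_ball)
    then have "qK * (d x y + d y u) < qK * (2 * (qK * r))" using K by (intro mult_strict_left_mono) auto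
    then show "u \<in> ball x (2 * qK\<^sup>2 * r)" using qd_triangle[of x u y]
      by (simp add: mem_ball algebra_simps power2_eq_square)
  qed
qed

text \<open>The supremum of the radii need not be attained, so instead of a largest ball one takes a
  ball of more than half the supremal radius; this is the origin of the factor 2. Zorn's lemma
  handles arbitrarily many balls.\<close>

lemma vitali_covering:
  fixes A :: "'a set" and r :: "'a \<Rightarrow> real"
  assumes r: "\<And>x. x \<in> A \<Longrightarrow> 0 < r x" "\<And>x. x \<in> A \<Longrightarrow> r x \<le> R"
  obtains G where "G \<subseteq> A" "disjoint_family_on (\<lambda>x. ball x (r x)) G"
    "\<And>x. x \<in> A \<Longrightarrow> \<exists>y\<in>G. ball x (r x) \<inter> ball y (r y) \<noteq> {} \<and> r x \<le> 2 * r y"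
proof -
  define B where "B = (\<lambda>x. ball x (r x))"
  \<comment> \<open>The last condition says that G has never skipped a large ball: a ball meeting G
    already meets a member at least half as large. It passes to unions of chains, and for a family
    that meets every ball it is the conclusion.\<close>
  define \<Omega> where "\<Omega> = {G. G \<subseteq> A \<and> disjoint_family_on B G \<and>
      (\<forall>x\<in>A. (\<exists>y\<in>G. B x \<inter> B y \<noteq> {}) \<longrightarrow> (\<exists>y\<in>G. B x \<inter> B y \<noteq> {} \<and> r x \<le> 2 * r y))}"
  have "\<exists>G\<in>\<Omega>. \<forall>G'\<in>\<Omega>. G \<subseteq> G' \<longrightarrow> G' = G"
  proof (rule subset_Zorn')
    fix \<C> assume ch: "subset.chain \<Omega> \<C>"
    then have sub: "\<C> \<subseteq> \<Omega>" and lin: "\<And>X Y. X \<in> \<C> \<Longrightarrow> Y \<in> \<C> \<Longrightarrow> X \<subseteq> Y \<or> Y \<subseteq> X"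
      by (auto simp: subset_chain_def)
    have "disjoint_family_on B (\<Union>\<C>)"
      unfolding disjoint_family_on_def
    proof (intro ballI impI)
      fix x y assume "x \<in> \<Union>\<C>" "y \<in> \<Union>\<C>" and ne: "x \<noteq> y"
      then obtain X Y where XY: "X \<in> \<C>" "Y \<in> \<C>" "x \<in> X" "y \<in> Y" by blast
      then obtain Z where "Z \<in> \<C>" "x \<in> Z" "y \<in> Z" using lin[of X Y] by blast
      then show "B x \<inter> B y = {}" using sub ne by (auto simp: \<Omega>_def disjoint_family_on_def)
    qed
    moreover have "\<exists>y\<in>\<Union>\<C>. B x \<inter> B y \<noteq> {} \<and> r x \<le> 2 * r y"
      if x: "x \<in> A" and "\<exists>y\<in>\<Union>\<C>. B x \<inter> B y \<noteq> {}" for x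
    proof -
      obtain X y where X: "X \<in> \<C>" "y \<in> X" "B x \<inter> B y \<noteq> {}" using \<open>\<exists>y\<in>\<Union>\<C>. B x \<inter> B y \<noteq> {}\<close> by blast
      then have "X \<in> \<Omega>" using sub by blast
      then have "\<exists>y\<in>X. B x \<inter> B y \<noteq> {} \<and> r x \<le> 2 * r y" using x X unfolding \<Omega>_def by blast
      then show ?thesis using X by blast
    qed
    moreover have "\<Union>\<C> \<subseteq> A" using sub by (auto simp: \<Omega>_def)
    ultimately show "\<Union>\<C> \<in> \<Omega>" unfolding \<Omega>_def by blast
  qed
  then obtain G where G: "G \<in> \<Omega>" and max: "\<And>G'. G' \<in> \<Omega> \<Longrightarrow> G \<subseteq> G' \<Longrightarrow> G' = G" by blast
  have meets: "\<exists>y\<in>G. B x \<inter> B y \<noteq> {}" if "x \<in> A" for x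
  proof (rule ccontr)
    assume non: "\<not> (\<exists>y\<in>G. B x \<inter> B y \<noteq> {})"
    \<comment> \<open>S collects the centres of the balls missed by G. One of nearly maximal radius
      in S can be added without violating the condition, because every newly met ball has its centre
      in S.\<close>
    define S where "S = {x\<in>A. \<forall>y\<in>G. B x \<inter> B y = {}}"
    have xS: "x \<in> S" using non that by (auto simp: S_def)
    have bdd: "bdd_above (r ` S)" by (rule bdd_aboveI[of _ R]) (auto simp: S_def r)
    define s where "s = Sup (r ` S)"
    have le: "r z \<le> s" if "z \<in> S" for z unfolding s_def using that bdd by (intro cSup_upper) auto
    have "0 < s" using le[OF xS] r(1)[OF that] by linarith
    then have "s / 2 < Sup (r ` S)" unfolding s_def[symmetric] by simp
    then obtain x0 where x0: "x0 \<in> S" "s / 2 < r x0"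
      using less_cSup_iff[OF _ bdd] xS by blast
    have "insert x0 G \<in> \<Omega>"
      unfolding \<Omega>_def
    proof (intro CollectI conjI ballI impI)
      show "insert x0 G \<subseteq> A" using G x0 by (auto simp: \<Omega>_def S_def)
      show "disjoint_family_on B (insert x0 G)"
        using G x0 unfolding \<Omega>_def S_def disjoint_family_on_def by blast
      fix z assume z: "z \<in> A" "\<exists>y\<in>insert x0 G. B z \<inter> B y \<noteq> {}"
      show "\<exists>y\<in>insert x0 G. B z \<inter> B y \<noteq> {} \<and> r z \<le> 2 * r y"
      proof (cases "\<exists>y\<in>G. B z \<inter> B y \<noteq> {}")
        case True then show ?thesis using G z(1) unfolding \<Omega>_def by blast
      next
        case False
        then have "z \<in> S" "B z \<inter> B x0 \<noteq> {}" using z by (auto simp: S_def)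
        then show ?thesis using le[of z] x0 by (intro bexI[of _ x0]) auto
      qed
    qed
    then have "x0 \<in> G" using max[of "insert x0 G"] by auto
    moreover have "x0 \<in> B x0" using x0 r(1) by (auto simp: B_def mem_ball S_def)
    ultimately show False using x0 unfolding S_def by blast
  qed
  show thesis
  proof
    show "G \<subseteq> A" using G by (auto simp: \<Omega>_def)
    show "disjoint_family_on (\<lambda>x. ball x (r x)) G" using G by (auto simp: \<Omega>_def B_def)
    show "\<exists>y\<in>G. ball x (r x) \<inter> ball y (r y) \<noteq> {} \<and> r x \<le> 2 * r y" if "x \<in> A" for x
      using G meets[OF that] that unfolding \<Omega>_def B_def by blast
  qed
qed

end

lemma (in finite_measure) finite_disjoint_family_measure_ge:
  assumes "disjoint_family_on B G" "\<And>x. x \<in> G \<Longrightarrow> B x \<in> sets M"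
    and "0 < e" "\<And>x. x \<in> G \<Longrightarrow> e \<le> measure M (B x)"
  shows "finite G"
proof (rule ccontr)
  assume "infinite G"
  obtain n :: nat where n: "measure M (space M) / e < n" using reals_Archimedean2 by blast
  obtain T where T: "finite T" "card T = n" "T \<subseteq> G"
    using infinite_arbitrarily_large[OF \<open>infinite G\<close>] by blast
  have "n * e \<le> (\<Sum>x\<in>T. measure M (B x))"
    using sum_mono[of T "\<lambda>_. e" "\<lambda>x. measure M (B x)"] T assms by auto
  also have "\<dots> = measure M (\<Union>x\<in>T. B x)"
    using T assms disjoint_family_on_mono[OF T(3) assms(1)]
    by (intro finite_measure_finite_Union[symmetric]) auto
  also have "\<dots> \<le> measure M (space M)" by (rule bounded_measure)
  finally show False using n \<open>0 < e\<close> by (simp add: field_simps)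
qed

text \<open>The space need not be separable, so countability of a Vitali family has to come from
  disjointness in finite measure: for each n only finitely many members have measure at least
  1/(n+1).\<close>

lemma (in finite_measure) countable_disjoint_family_measure_pos:
  assumes "disjoint_family_on B G" "\<And>x. x \<in> G \<Longrightarrow> B x \<in> sets M"
    and "\<And>x. x \<in> G \<Longrightarrow> 0 < measure M (B x)"
  shows "countable G"
proof -
  have "finite {x\<in>G. 1 / real (Suc n) \<le> measure M (B x)}" for n
    by (rule finite_disjoint_family_measure_ge[of B _ "1 / real (Suc n)"])
       (auto intro: disjoint_family_on_mono[OF _ assms(1)] assms(2))
  then have "countable (\<Union>n. {x\<in>G. 1 / real (Suc n) \<le> measure M (B x)})"
    by (intro countable_UN) (auto intro: countable_finite)
  moreover have "G \<subseteq> (\<Union>n. {x\<in>G. 1 / real (Suc n) \<le> measure M (B x)})"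
  proof
    fix x assume "x \<in> G"
    then obtain n where "inverse (real (Suc n)) < measure M (B x)"
      using reals_Archimedean[OF assms(3)] by blast
    then show "x \<in> (\<Union>n. {x\<in>G. 1 / real (Suc n) \<le> measure M (B x)})"
      using \<open>x \<in> G\<close> by (auto simp: inverse_eq_divide intro!: exI[of _ n])
  qed
  ultimately show ?thesis by (rule countable_subset[rotated])
qed

text \<open>For diameter 0 no radius lies strictly between 0 and the diameter, and the annulus
  condition is vacuous; the upper Ahlfors bound then even makes the single point a null set.
  Positive measure of balls requires this case to be split off.\<close>

locale nondegenerate_homogeneous_space = homogeneous_type_space +
  assumes diam_pos: "0 < qdiam d"
begin

section \<open>Positivity, doubling and reverse doubling at all radii\<close>

lemma measure_ball_pos: "0 < r \<Longrightarrow> 0 < m (ball x r)"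
proof -
  assume r: "0 < r"
  define R where "R = min r (qdiam d) / 2"
  have R: "0 < R" "R < qdiam d" "R \<le> r" using r diam_pos by (auto simp: R_def min_def)
  have "0 < m (ball x R - ball x (R / 2))" using R by (intro annulus_pos) auto
  also have "\<dots> \<le> m (ball x r)" using ball_mono[OF R(3)] by (intro finite_measure_mono) auto
  finally show ?thesis .
qed

lemma doubling_all: "0 < r \<Longrightarrow> m (ball x (2 * r)) \<le> C\<^sub>d * m (ball x r)"
proof (cases "r < qdiam d")
  case False
  \<comment> \<open>\<open>doubling\<close> covers only radii below the diameter. This s is
    admissible, and the ball of radius \<open>2 * s\<close> is already the whole space.\<close>
  define s where "s = 3 / 4 * qdiam d"
  have s: "0 < s" "s < qdiam d" "qdiam d < 2 * s" "s \<le> r" using diam_pos False by (auto simp: s_def)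
  have "m (ball x (2 * r)) \<le> m (ball x (2 * s))" using s by (intro finite_measure_mono) (auto simp: ball_UNIV)
  also have "\<dots> \<le> C\<^sub>d * m (ball x s)" by (rule doubling[OF s(1,2)])
  also have "\<dots> \<le> C\<^sub>d * m (ball x r)" using Cd_gt_1 ball_mono[OF s(4)]
    by (intro mult_left_mono finite_measure_mono) auto
  finally show ?thesis .
qed (auto intro: doubling)

lemma doubling_power: "0 < r \<Longrightarrow> m (ball x (2 ^ n * r)) \<le> C\<^sub>d ^ n * m (ball x r)"
proof (induction n)
  case (Suc n)
  have "m (ball x (2 ^ Suc n * r)) \<le> C\<^sub>d * m (ball x (2 ^ n * r))"
    using doubling_all[of "2 ^ n * r" x] Suc.prems by (simp add: mult.assoc)
  also have "\<dots> \<le> C\<^sub>d * (C\<^sub>d ^ n * m (ball x r))" using Suc Cd_gt_1 by (intro mult_left_mono) auto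
  finally show ?case by (simp add: mult.assoc)
qed simp

lemma dilation_bound:
  obtains C where "1 \<le> C" "\<And>x r. 0 < r \<Longrightarrow> m (ball x (L * r)) \<le> C * m (ball x r)"
proof -
  obtain n where n: "L < 2 ^ n" using real_arch_pow[of 2 L] by auto
  show thesis
  proof
    show "1 \<le> C\<^sub>d ^ n" using Cd_gt_1 by (simp add: one_le_power)
    fix x and r :: real assume "0 < r"
    then have "m (ball x (L * r)) \<le> m (ball x (2 ^ n * r))" using n
      by (intro finite_measure_mono ball_mono mult_right_mono) auto
    also have "\<dots> \<le> C\<^sub>d ^ n * m (ball x r)" by (rule doubling_power[OF \<open>0 < r\<close>])
    finally show "m (ball x (L * r)) \<le> C\<^sub>d ^ n * m (ball x r)" .
  qed
qed

lemma ball_measure_le_center_in: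
  obtains C where "1 \<le> C" "\<And>x y r. x \<in> ball y r \<Longrightarrow> m (ball y r) \<le> C * m (ball x r)"
proof -
  obtain C where C: "1 \<le> C" "\<And>x r. 0 < r \<Longrightarrow> m (ball x (2 * qK\<^sup>2 * r)) \<le> C * m (ball x r)"
    using dilation_bound[of "2 * qK\<^sup>2"] by blast
  show thesis
  proof
    show "1 \<le> C" by (rule C)
    fix x y r assume x: "x \<in> ball y r"
    then have r: "0 < r" using d_nonneg[of y x] by (auto simp: mem_ball)
    have "m (ball y r) \<le> m (ball x (2 * qK\<^sup>2 * r))"
      using ball_subset_center_in(2)[OF x] by (intro finite_measure_mono) auto
    also have "\<dots> \<le> C * m (ball x r)" by (rule C(2)[OF r])
    finally show "m (ball y r) \<le> C * m (ball x r)" .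
  qed
qed

text \<open>The annulus condition yields a point y away from x. A small ball around y lies in
  \<open>ball x r\<close>, misses the concentric ball of radius \<open>r / \<Lambda>\<close>, and by
  doubling carries a fixed share of the measure. Decreasing radii thus become geometrically
  decreasing measures.\<close>

lemma reverse_doubling:
  obtains \<Lambda> \<eta> where "1 < \<Lambda>" "0 < \<eta>" "\<eta> < 1"
    "\<And>x r. 0 < r \<Longrightarrow> r \<le> 2 * qdiam d \<Longrightarrow> m (ball x (r / \<Lambda>)) \<le> (1 - \<eta>) * m (ball x r)"
proof -
  have K: "1 \<le> qK" by (rule qK_ge_1)
  \<comment> \<open>a keeps the annulus radius \<open>2 * a * r\<close> below the diameter although
    r may reach twice the diameter, and keeps the ball around y inside \<open>ball x r\<close>. e is
    so small that two quasimetric steps of size \<open>e * r\<close> cannot bridge the distance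
    \<open>a * r\<close>.\<close>
  define a where "a = 1 / (8 * qK)"
  define e where "e = a / (4 * qK\<^sup>2)"
  have K2: "1 \<le> qK\<^sup>2" using K by (simp add: one_le_power)
  have a: "0 < a" "a \<le> 1 / 8" "qK * a = 1 / 8" using K by (auto simp: a_def field_simps)
  have e: "0 < e" "e \<le> a" "qK * (qK * e) = a / 4" using a K2
    by (auto simp: e_def field_simps power2_eq_square mult_le_cancel_left1)
  obtain C where C: "1 \<le> C" "\<And>x r. 0 < r \<Longrightarrow> m (ball x ((2 * qK\<^sup>2 / e) * r)) \<le> C * m (ball x r)"
    using dilation_bound[of "2 * qK\<^sup>2 / e"] by blast
  define \<Lambda> where "\<Lambda> = 1 / e"
  show thesis
  proof
    show "1 < \<Lambda>" using e a by (simp add: \<Lambda>_def)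
    \<comment> \<open>Half of the share \<open>1 / C\<close> keeps the witness for
      \<open>\<eta>\<close> strictly below 1 even if C = 1.\<close>
    show "0 < 1 / (2 * C)" "1 / (2 * C) < 1" using C by auto
    fix x and r :: real assume r: "0 < r" "r \<le> 2 * qdiam d"
    have ar: "0 < a * r" "a * r < 2 * a * r" "2 * a * r < qdiam d"
    proof -
      show "0 < a * r" "a * r < 2 * a * r" using a r by auto
      have "2 * a * r \<le> 2 * (1/8) * r" using a r by (intro mult_right_mono) auto
      then show "2 * a * r < qdiam d" using r diam_pos by linarith
    qed
    then have "ball x (2 * a * r) - ball x (a * r) \<noteq> {}" using annulus_pos[OF ar, of x] by force
    then obtain y where y: "d x y < 2 * a * r" "a * r \<le> d x y" unfolding qball_def by fastforce
    have er: "0 < e * r" using e r by simp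
    have disj: "ball y (e * r) \<inter> ball x (r / \<Lambda>) = {}"
    proof (rule ccontr)
      assume "\<not> ?thesis"
      then obtain z where z: "d y z < e * r" "d x z < e * r" by (auto simp: mem_ball \<Lambda>_def mult.commute)
      have "d z y \<le> qK * (e * r)" using qd_sym[of z y] mult_left_mono[of "d y z" "e*r" qK] z K by linarith
      moreover have "e * r \<le> qK * (e * r)" using er K by (simp add: mult_le_cancel_right1)
      ultimately have "d x z + d z y \<le> 2 * (qK * (e * r))" using z by linarith
      then have "d x y \<le> qK * (2 * (qK * (e * r)))"
        using qd_triangle[of x y z] mult_left_mono[of "d x z + d z y" "2 * (qK * (e * r))" qK] K by linarith
      also have "\<dots> = a / 2 * r" using e(3) by (simp add: algebra_simps)
      finally show False using y ar by (simp add: algebra_simps)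
    qed
    have sub: "ball y (e * r) \<subseteq> ball x r"
    proof
      fix u assume u: "u \<in> ball y (e * r)"
      have "e * r \<le> a * r" using e r by (intro mult_right_mono) auto
      then have "d x y + d y u < 3 * (a * r)" using u y by (simp add: mem_ball)
      then have "qK * (d x y + d y u) < qK * (3 * (a * r))" using K by (intro mult_strict_left_mono) auto
      also have "\<dots> = 3 / 8 * r" using a(3) by (simp add: algebra_simps)
      finally show "u \<in> ball x r" using qd_triangle[of x u y] r by (simp add: mem_ball)
    qed
    have "y \<in> ball y (e * r)" using er by (simp add: mem_ball)
    then have "y \<in> ball x r" using sub by blast
    then have "ball x r \<subseteq> ball y (2 * qK\<^sup>2 * r)" by (rule ball_subset_center_in)
    moreover have "(2 * qK\<^sup>2 / e) * (e * r) = 2 * qK\<^sup>2 * r" using e(1) by simp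
    ultimately have "m (ball x r) \<le> m (ball y ((2 * qK\<^sup>2 / e) * (e * r)))"
      by (intro finite_measure_mono) auto
    also have "\<dots> \<le> C * m (ball y (e * r))" by (rule C(2)[OF er])
    finally have "m (ball x r) / C \<le> m (ball y (e * r))" using C by (simp add: field_simps)
    moreover have "m (ball x (r / \<Lambda>)) + m (ball y (e * r)) \<le> m (ball x r)"
    proof -
      have "r / \<Lambda> \<le> r" using r e a by (simp add: \<Lambda>_def mult_le_cancel_left1)
      then have "ball x (r / \<Lambda>) \<union> ball y (e * r) \<subseteq> ball x r" using sub ball_mono by blast
      then have "m (ball x (r / \<Lambda>) \<union> ball y (e * r)) \<le> m (ball x r)"
        by (intro finite_measure_mono) auto
      then show ?thesis using disj by (subst (asm) finite_measure_Union) auto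
    qed
    moreover have "m (ball x r) / (2 * C) \<le> m (ball x r) / C"
      using C by (intro divide_left_mono) auto
    ultimately show "m (ball x (r / \<Lambda>)) \<le> (1 - 1 / (2 * C)) * m (ball x r)"
      by (simp add: algebra_simps)
  qed
qed

end

section \<open>Maximal functions of doubling measures\<close>

lemma nn_integral_Holder:
  fixes X Y :: "'a \<Rightarrow> real"
  assumes [measurable]: "X \<in> borel_measurable N" "Y \<in> borel_measurable N"
    and nn: "\<And>x. 0 \<le> X x" "\<And>x. 0 \<le> Y x"
    and uv: "1 < u" "1 < v" "1 / u + 1 / v = 1" and PQ: "0 \<le> P" "0 \<le> Q"
    and X: "(\<integral>\<^sup>+x. ennreal (X x powr u) \<partial>N) \<le> ennreal P"
    and Y: "(\<integral>\<^sup>+x. ennreal (Y x powr v) \<partial>N) \<le> ennreal Q"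
  shows "(\<integral>\<^sup>+x. ennreal (X x * Y x) \<partial>N) \<le> ennreal (P powr (1 / u) * Q powr (1 / v))"
proof -
  have zero: "AE x in N. Z x = 0"
    if [measurable]: "Z \<in> borel_measurable N" and Z: "(\<integral>\<^sup>+x. ennreal (Z x powr w) \<partial>N) \<le> ennreal 0"
    for Z :: "'a \<Rightarrow> real" and w
  proof -
    have "(\<integral>\<^sup>+x. ennreal (Z x powr w) \<partial>N) = 0" using Z by simp
    then have "AE x in N. ennreal (Z x powr w) = 0" by (subst (asm) nn_integral_0_iff_AE) auto
    then show ?thesis by eventually_elim (simp add: ennreal_eq_0_iff)
  qed
  show ?thesis
  \<comment> \<open>Normalisation divides by P and Q. If one of them is 0, the corresponding
    function vanishes almost everywhere.\<close>
  proof (cases "P = 0 \<or> Q = 0")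
    case True
    then have "AE x in N. X x * Y x = 0" using zero[of X u] zero[of Y v] X Y by auto
    then have "(\<integral>\<^sup>+x. ennreal (X x * Y x) \<partial>N) = (\<integral>\<^sup>+x. 0 \<partial>N)"
      by (intro nn_integral_cong_AE) auto
    then show ?thesis by simp
  next
    case False
    then have PQ: "0 < P" "0 < Q" using PQ by auto
    define p where "p = P powr (1 / u)"
    define q where "q = Q powr (1 / v)"
    have pq: "0 < p" "0 < q" "p powr u = P" "q powr v = Q"
      using PQ uv by (auto simp: p_def q_def powr_powr)
    have "X x * Y x \<le> p * q * (X x powr u / P / u + Y x powr v / Q / v)" for x
    proof -
      have "X x / p * (Y x / q) \<le> (X x / p) powr u / u + (Y x / q) powr v / v"
        using nn pq uv by (intro Youngs_inequality) auto
      then have "X x / p * (Y x / q) \<le> X x powr u / P / u + Y x powr v / Q / v"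
        using pq by (simp add: powr_divide)
      then have "p * q * (X x / p * (Y x / q)) \<le> p * q * (X x powr u / P / u + Y x powr v / Q / v)"
        using pq by (intro mult_left_mono) auto
      then show ?thesis using pq by simp
    qed
    then have "(\<integral>\<^sup>+x. ennreal (X x * Y x) \<partial>N)
        \<le> (\<integral>\<^sup>+x. ennreal (p * q / P / u) * ennreal (X x powr u)
              + ennreal (p * q / Q / v) * ennreal (Y x powr v) \<partial>N)"
      using pq PQ uv by (intro nn_integral_mono)
        (auto simp flip: ennreal_mult ennreal_plus simp: ennreal_leI algebra_simps)
    also have "\<dots> = ennreal (p * q / P / u) * (\<integral>\<^sup>+x. ennreal (X x powr u) \<partial>N)
        + ennreal (p * q / Q / v) * (\<integral>\<^sup>+x. ennreal (Y x powr v) \<partial>N)"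
      by (simp add: nn_integral_add nn_integral_cmult)
    also have "\<dots> \<le> ennreal (p * q / P / u) * ennreal P + ennreal (p * q / Q / v) * ennreal Q"
      by (intro add_mono mult_left_mono X Y) auto
    also have "\<dots> = ennreal (p * q * (1 / u + 1 / v))"
      using pq PQ uv(1,2) by (simp flip: ennreal_mult ennreal_plus add: distrib_left)
    finally show ?thesis by (simp only: uv p_def q_def mult_1_right)
  qed
qed

lemma set_nn_integral_Holder:
  fixes X Y :: "'a \<Rightarrow> real"
  assumes [measurable]: "X \<in> borel_measurable N" "Y \<in> borel_measurable N" "S \<in> sets N"
    and nn: "\<And>x. 0 \<le> X x" "\<And>x. 0 \<le> Y x"
    and uv: "1 < u" "1 < v" "1 / u + 1 / v = 1" and PQ: "0 \<le> P" "0 \<le> Q"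
    and X: "(\<integral>\<^sup>+x\<in>S. ennreal (X x powr u) \<partial>N) \<le> ennreal P"
    and Y: "(\<integral>\<^sup>+x\<in>S. ennreal (Y x powr v) \<partial>N) \<le> ennreal Q"
  shows "(\<integral>\<^sup>+x\<in>S. ennreal (X x * Y x) \<partial>N) \<le> ennreal (P powr (1 / u) * Q powr (1 / v))"
proof -
  let ?i = "indicator S :: 'a \<Rightarrow> real"
  have ind: "ennreal ((Z x * ?i x) powr w) = ennreal (Z x powr w) * indicator S x" if "w \<noteq> 0"
    for Z :: "'a \<Rightarrow> real" and w x
    by (auto simp: indicator_def)
  have "(\<integral>\<^sup>+x. ennreal ((X x * ?i x) * (Y x * ?i x)) \<partial>N) \<le> ennreal (P powr (1 / u) * Q powr (1 / v))"
    using uv PQ X Y by (intro nn_integral_Holder) (auto simp: nn ind)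
  also have "(\<integral>\<^sup>+x. ennreal ((X x * ?i x) * (Y x * ?i x)) \<partial>N) = (\<integral>\<^sup>+x\<in>S. ennreal (X x * Y x) \<partial>N)"
    by (intro nn_integral_cong) (auto simp: indicator_def)
  finally show ?thesis .
qed

text \<open>Geometric growth makes the terms before index N sum to at most
  \<open>z N / (c - 1)\<close>, so the largest term not exceeding y carries the sum, whatever the
  number of terms.\<close>

lemma sum_geometric_growth_le:
  fixes z :: "nat \<Rightarrow> real"
  assumes "1 < c" "\<And>n. 0 < z n" "\<And>n. c * z n \<le> z (Suc n)" "0 \<le> y"
  shows "(\<Sum>n<N. if z n \<le> y then z n else 0) \<le> c / (c - 1) * y"
proof (induction N)
  case (Suc N)
  have all: "(\<Sum>n<N. z n) \<le> z N / (c - 1)" for N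
  proof (induction N)
    case (Suc N)
    have "(\<Sum>n<Suc N. z n) \<le> z N / (c - 1) + z N" using Suc by simp
    also have "\<dots> = c * z N / (c - 1)" using assms(1) by (simp add: field_simps)
    also have "\<dots> \<le> z (Suc N) / (c - 1)" using assms by (intro divide_right_mono) auto
    finally show ?case .
  qed (use assms(1) less_imp_le[OF assms(2)] in auto)
  show ?case
  proof (cases "z N \<le> y")
    case True
    have "(\<Sum>n<Suc N. if z n \<le> y then z n else 0) \<le> (\<Sum>n<Suc N. z n)"
      by (intro sum_mono) (auto simp: assms less_imp_le)
    also have "\<dots> \<le> z N / (c - 1) + z N" using all[of N] by simp
    also have "\<dots> = c / (c - 1) * z N" using assms(1) by (simp add: field_simps)
    also have "\<dots> \<le> c / (c - 1) * y" using True assms(1) by (intro mult_left_mono) auto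
    finally show ?thesis .
  qed (use Suc in simp)
qed (use assms in auto)

lemma sum_geometric_decay_le:
  fixes z :: "nat \<Rightarrow> real"
  assumes c: "1 < c" and z: "\<And>n. 0 < z n" "\<And>n. c * z n \<le> z (Suc n)" and y: "0 < y"
  shows "(\<Sum>n<N. if y \<le> z n then 1 / z n else 0) \<le> c / (c - 1) / y"
proof -
  \<comment> \<open>Because of the truncation by y the differences of g are non-negative and
    telescope to at most \<open>1 / y\<close>; each term with \<open>y \<le> z n\<close> is at most
    \<open>c / (c - 1)\<close> times its difference.\<close>
  define g where "g n = 1 / max y (z n)" for n
  have "(if y \<le> z n then 1 / z n else 0) \<le> c / (c - 1) * (g n - g (Suc n))" for n
  proof -
    have zz: "z n \<le> z (Suc n)" using z(2)[of n] z(1)[of n] c mult_right_mono[of 1 c "z n"] by linarith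
    show ?thesis
    proof (cases "y \<le> z n")
      case True
      have "1 / z (Suc n) \<le> 1 / (c * z n)" using z c by (intro divide_left_mono) auto
      then have "1 / z n - 1 / z (Suc n) \<ge> (c - 1) / c / z n"
        using c z(1)[of n] by (simp add: diff_divide_distrib)
      then have "c / (c - 1) * ((c - 1) / c / z n) \<le> c / (c - 1) * (1 / z n - 1 / z (Suc n))"
        using c by (intro mult_left_mono) auto
      then show ?thesis using True zz c z by (simp add: g_def max_def)
    next
      case False
      have "g (Suc n) \<le> g n" unfolding g_def using y zz by (intro divide_left_mono) auto
      then show ?thesis using False c by simp
    qed
  qed
  then have "(\<Sum>n<N. if y \<le> z n then 1 / z n else 0) \<le> (\<Sum>n<N. c / (c - 1) * (g n - g (Suc n)))"
    by (rule sum_mono)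
  also have "\<dots> = c / (c - 1) * (g 0 - g N)"
    by (subst sum_distrib_left[symmetric]) (simp add: sum_lessThan_telescope')
  also have "\<dots> \<le> c / (c - 1) * (1 / y)"
  proof (rule mult_left_mono)
    have "g 0 \<le> 1 / y" unfolding g_def using y by (intro divide_left_mono) auto
    moreover have "0 \<le> g N" using y by (simp add: g_def)
    ultimately show "g 0 - g N \<le> 1 / y" by linarith
  qed (use c in auto)
  finally show ?thesis by simp
qed

text \<open>The summation behind Hedberg's inequality: the two competing bounds balance at
  \<open>D n = (a/k)\<^bsup>1/(1+\<omega>)\<^esup>\<close>, and the sum is geometric on both sides of that index.\<close>

lemma Hedberg_sum:
  fixes D T :: "nat \<Rightarrow> real"
  assumes c: "1 < c" and D: "\<And>n. 0 < D n" "\<And>n. c * D n \<le> D (Suc n)"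
    and w: "0 < \<omega>\<^sub>0" "\<omega>\<^sub>0 \<le> \<omega>" and a: "0 \<le> a" and k: "0 < k"
    and T: "\<And>n. T n \<le> D n powr - \<omega> * a" "\<And>n. T n \<le> D n * k"
  shows "(\<Sum>n<N. T n) \<le> (1 / (1 - 1 / c) + 1 / (1 - c powr - \<omega>\<^sub>0)) * (a powr (1 / (1 + \<omega>)) * k powr (\<omega> / (1 + \<omega>)))"
proof (cases "a = 0")
  case True
  have "(\<Sum>n<N. T n) \<le> (\<Sum>n<N. 0)" using T(1) True by (intro sum_mono) auto
  then show ?thesis using True by simp
next
  case False
  then have a: "0 < a" using a by simp
  define y where "y = (a / k) powr (1 / (1 + \<omega>))"
  have y: "0 < y" using a k by (simp add: y_def)
  have w': "0 < \<omega>" using w by linarith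
  define z where "z n = D n powr \<omega>" for n
  have cw: "1 < c powr \<omega>" using c w' by (simp add: gr_one_powr)
  have "(\<Sum>n<N. T n) \<le> (\<Sum>n<N. k * (if D n \<le> y then D n else 0) + a * (if y powr \<omega> \<le> z n then 1 / z n else 0))"
  proof (rule sum_mono)
    fix n
    show "T n \<le> k * (if D n \<le> y then D n else 0) + a * (if y powr \<omega> \<le> z n then 1 / z n else 0)"
    proof (cases "D n \<le> y")
      case True
      have "0 \<le> a * (if y powr \<omega> \<le> z n then 1 / z n else 0)" using a by (simp add: z_def)
      then show ?thesis using T(2)[of n] True by (simp add: mult.commute)
    next
      case False
      then have "y powr \<omega> \<le> z n" unfolding z_def using y w' by (intro powr_mono2) auto
      then show ?thesis using False T(1)[of n] by (simp add: z_def powr_minus_divide)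
    qed
  qed
  also have "\<dots> = k * (\<Sum>n<N. if D n \<le> y then D n else 0) + a * (\<Sum>n<N. if y powr \<omega> \<le> z n then 1 / z n else 0)"
    by (simp add: sum.distrib sum_distrib_left)
  also have "\<dots> \<le> k * (c / (c - 1) * y) + a * (c powr \<omega> / (c powr \<omega> - 1) / y powr \<omega>)"
  proof (intro add_mono mult_left_mono sum_geometric_growth_le sum_geometric_decay_le)
    fix n
    have "(c * D n) powr \<omega> \<le> D (Suc n) powr \<omega>" using D c w' less_imp_le[OF D(1)] by (intro powr_mono2) auto
    then show "c powr \<omega> * z n \<le> z (Suc n)" by (simp add: z_def powr_mult)
    show "0 < z n" using D(1)[of n] by (simp add: z_def)
  qed (use c D a k y cw in auto)
  also have "\<dots> = (1 / (1 - 1 / c) + 1 / (1 - c powr - \<omega>)) * (a powr (1 / (1 + \<omega>)) * k powr (\<omega> / (1 + \<omega>)))"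
  proof -
    have e: "1 - 1 / (1 + \<omega>) = \<omega> / (1 + \<omega>)" using w' by (simp add: field_simps)
    have "k * y = a powr (1 / (1 + \<omega>)) * (k powr 1 / k powr (1 / (1 + \<omega>)))"
      using a k by (simp add: y_def powr_divide)
    also have "k powr 1 / k powr (1 / (1 + \<omega>)) = k powr (\<omega> / (1 + \<omega>))"
      by (simp only: powr_diff[symmetric] e)
    finally have 1: "k * y = a powr (1 / (1 + \<omega>)) * k powr (\<omega> / (1 + \<omega>))" .
    have e2: "1 - \<omega> / (1 + \<omega>) = 1 / (1 + \<omega>)" using w' by (simp add: field_simps)
    have "a / y powr \<omega> = (a powr 1 / a powr (\<omega> / (1 + \<omega>))) * k powr (\<omega> / (1 + \<omega>))"
      using a k by (simp add: y_def powr_divide powr_powr)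
    also have "a powr 1 / a powr (\<omega> / (1 + \<omega>)) = a powr (1 / (1 + \<omega>))"
      by (simp only: powr_diff[symmetric] e2)
    finally have 2: "a / y powr \<omega> = a powr (1 / (1 + \<omega>)) * k powr (\<omega> / (1 + \<omega>))" .
    have 3: "c / (c - 1) = 1 / (1 - 1 / c)" using c by (simp add: field_simps)
    have 4: "c powr \<omega> / (c powr \<omega> - 1) = 1 / (1 - c powr - \<omega>)" using cw c
      by (simp add: powr_minus_divide field_simps)
    have "k * (c / (c - 1) * y) + a * (c powr \<omega> / (c powr \<omega> - 1) / y powr \<omega>)
        = c / (c - 1) * (k * y) + c powr \<omega> / (c powr \<omega> - 1) * (a / y powr \<omega>)"
      by (simp add: mult_ac)
    then show ?thesis unfolding 1 2 3 4 by (simp only: distrib_right)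
  qed
  \<comment> \<open>Replacing \<open>\<omega>\<close> by its lower bound frees the constant from the
    exponents, as a supremum over them requires.\<close>
  also have "\<dots> \<le> (1 / (1 - 1 / c) + 1 / (1 - c powr - \<omega>\<^sub>0)) * (a powr (1 / (1 + \<omega>)) * k powr (\<omega> / (1 + \<omega>)))"
  proof (intro mult_right_mono add_mono divide_left_mono)
    have le: "c powr - \<omega> \<le> c powr - \<omega>\<^sub>0" using c w by (intro powr_mono) auto
    then show "1 - c powr - \<omega>\<^sub>0 \<le> 1 - c powr - \<omega>" by simp
    have "c powr - \<omega>\<^sub>0 < c powr 0" using c w by (intro powr_less_mono) auto
    also have "\<dots> = 1" using c by simp
    finally have lt: "c powr - \<omega>\<^sub>0 < 1" .
    show "0 < (1 - c powr - \<omega>) * (1 - c powr - \<omega>\<^sub>0)"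
      using lt le_less_trans[OF le lt] by (intro mult_pos_pos) linarith+
  qed (use c in auto)
  finally show ?thesis .
qed

text \<open>Sums over G are integrals against \<open>count_space G\<close>, so the interchange with
  W rests on countability of G; disjointness leaves at most one non-zero term at each point.\<close>

lemma nn_integral_disjoint_family_le:
  assumes G: "countable G" "disjoint_family_on B G" and B: "\<And>y. y \<in> G \<Longrightarrow> B y \<subseteq> S"
    and [measurable]: "\<And>y. B y \<in> sets W" "h \<in> borel_measurable W"
  shows "(\<integral>\<^sup>+y. (\<integral>\<^sup>+x\<in>B y. h x \<partial>W) \<partial>count_space G) \<le> (\<integral>\<^sup>+x. h x * indicator S x \<partial>W)"
proof -
  have "(\<integral>\<^sup>+y. (\<integral>\<^sup>+x\<in>B y. h x \<partial>W) \<partial>count_space G)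
      = (\<integral>\<^sup>+x. (\<integral>\<^sup>+y. h x * indicator (B y) x \<partial>count_space G) \<partial>W)"
    using G(1) by (intro nn_integral_count_space_nn_integral[symmetric]) auto
  also have "\<dots> \<le> (\<integral>\<^sup>+x. h x * indicator S x \<partial>W)"
  proof (rule nn_integral_mono)
    fix x
    show "(\<integral>\<^sup>+y. h x * indicator (B y) x \<partial>count_space G) \<le> h x * indicator S x"
    proof (cases "\<exists>y\<in>G. x \<in> B y")
      case True
      then obtain y where y: "y \<in> G" "x \<in> B y" by blast
      have "(\<integral>\<^sup>+y. h x * indicator (B y) x \<partial>count_space G) = (\<integral>\<^sup>+y'. h x * indicator {y} y' \<partial>count_space G)"
        using y G(2) by (intro nn_integral_cong) (auto simp: indicator_def disjoint_family_on_def)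
      also have "\<dots> = h x" using y by (subst nn_integral_cmult_indicator) (auto simp: emeasure_count_space_finite)
      finally show ?thesis using B[OF y(1)] y(2) by (auto simp: indicator_def)
    next
      case False
      then have "(\<integral>\<^sup>+y. h x * indicator (B y) x \<partial>count_space G) = (\<integral>\<^sup>+y'. 0 \<partial>count_space G)"
        by (intro nn_integral_cong) (auto simp: indicator_def)
      then show ?thesis by simp
    qed
  qed
  finally show ?thesis .
qed

section \<open>Weak and strong type bounds for doubling measures\<close>

context nondegenerate_homogeneous_space
begin

text \<open>The dilation factor is the one of \<open>ball_engulf\<close>. Stating the condition for
  a general W lets the maximal theorem serve both M and the exponentially weighted measures.\<close>

definition ball_doubling :: "'a measure \<Rightarrow> real \<Rightarrow> bool" where
  "ball_doubling W C \<longleftrightarrow> finite_measure W \<and> sets W = sets M \<and>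
     (\<forall>x r. 0 < r \<longrightarrow> 0 < measure W (ball x r) \<and> measure W (ball x (5 * qK ^ 3 * r)) \<le> C * measure W (ball x r))"

lemma ball_doublingD:
  assumes "ball_doubling W C" "0 < r"
  shows "0 < measure W (ball x r)" "measure W (ball x (5 * qK ^ 3 * r)) \<le> C * measure W (ball x r)" "0 \<le> C"
proof -
  show 1: "0 < measure W (ball x r)" and 2: "measure W (ball x (5 * qK ^ 3 * r)) \<le> C * measure W (ball x r)"
    using assms unfolding ball_doubling_def by blast+
  have "0 \<le> C * measure W (ball x r)" using measure_nonneg order_trans 2 by blast
  then show "0 \<le> C" using 1 by (simp add: zero_le_mult_iff)
qed

text \<open>Vitali balls chosen in the superlevel set are disjoint and carry large integrals, and
  their dilates cover the set. The union E of the dilates is measurable, which the superlevel set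
  itself need not be; R bounds the radii for the selection.\<close>

lemma maximal_weak_type:
  assumes W: "ball_doubling W C" and h[measurable]: "h \<in> borel_measurable W" and t: "0 < t"
  obtains E where "E \<in> sets W"
    "{x. \<exists>r. 0 < r \<and> r \<le> R \<and> ennreal t * emeasure W (ball x r) < (\<integral>\<^sup>+y\<in>ball x r. h y \<partial>W)} \<subseteq> E"
    "ennreal t * emeasure W E \<le> ennreal C * (\<integral>\<^sup>+y. h y \<partial>W)"
proof -
  interpret W: finite_measure W using W by (simp add: ball_doubling_def)
  have sW: "sets W = sets M" using W by (simp add: ball_doubling_def)
  have bW[measurable]: "ball x r \<in> sets W" for x r by (simp add: sW)
  define A where "A = {x. \<exists>r. 0 < r \<and> r \<le> R \<and> ennreal t * emeasure W (ball x r) < (\<integral>\<^sup>+y\<in>ball x r. h y \<partial>W)}"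
  have "\<forall>x\<in>A. \<exists>r. 0 < r \<and> r \<le> R \<and> ennreal t * emeasure W (ball x r) < (\<integral>\<^sup>+y\<in>ball x r. h y \<partial>W)"
    by (simp add: A_def)
  then obtain r where r: "\<And>x. x \<in> A \<Longrightarrow> 0 < r x" "\<And>x. x \<in> A \<Longrightarrow> r x \<le> R"
    "\<And>x. x \<in> A \<Longrightarrow> ennreal t * emeasure W (ball x (r x)) < (\<integral>\<^sup>+y\<in>ball x (r x). h y \<partial>W)"
    by metis
  obtain G where G: "G \<subseteq> A" "disjoint_family_on (\<lambda>x. ball x (r x)) G"
    "\<And>x. x \<in> A \<Longrightarrow> \<exists>y\<in>G. ball x (r x) \<inter> ball y (r y) \<noteq> {} \<and> r x \<le> 2 * r y"
    by (rule vitali_covering[of A r R, OF r(1,2)]) blast+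
  have pos: "0 < measure W (ball x (r x))" if "x \<in> A" for x
    by (rule ball_doublingD[OF W r(1)[OF that]])
  have cG: "countable G"
    by (rule W.countable_disjoint_family_measure_pos[OF G(2)]) (use G(1) pos in auto)
  define E where "E = (\<Union>y\<in>G. ball y (5 * qK ^ 3 * r y))"
  have E[measurable]: "E \<in> sets W" unfolding E_def using cG by (intro sets.countable_UN') auto
  have AE: "A \<subseteq> E"
  proof
    fix x assume x: "x \<in> A"
    then obtain y where y: "y \<in> G" "ball x (r x) \<inter> ball y (r y) \<noteq> {}" "r x \<le> 2 * r y" using G(3) by blast
    have "x \<in> ball x (r x)" using r(1)[OF x] by (simp add: mem_ball)
    then show "x \<in> E" using ball_engulf[OF y(2,3)] y(1) by (auto simp: E_def)
  qed
  have "ennreal t * emeasure W E \<le> ennreal t * (\<integral>\<^sup>+y. emeasure W (ball y (5 * qK ^ 3 * r y)) \<partial>count_space G)"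
  proof (rule mult_left_mono)
    have "emeasure W E = (\<integral>\<^sup>+x. indicator E x \<partial>W)" by simp
    also have "\<dots> \<le> (\<integral>\<^sup>+x. (\<integral>\<^sup>+y. indicator (ball y (5 * qK ^ 3 * r y)) x \<partial>count_space G) \<partial>W)"
    proof (rule nn_integral_mono)
      fix x
      show "indicator E x \<le> (\<integral>\<^sup>+y. indicator (ball y (5 * qK ^ 3 * r y)) x \<partial>count_space G)"
      proof (cases "x \<in> E")
        case True
        then obtain y where y: "y \<in> G" "x \<in> ball y (5 * qK ^ 3 * r y)" by (auto simp: E_def)
        have "indicator E x = (1 :: ennreal)" using True by simp
        also have "\<dots> = (\<integral>\<^sup>+y'. indicator {y} y' \<partial>count_space G)" using y
          by (subst nn_integral_indicator) (auto simp: emeasure_count_space_finite)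
        also have "\<dots> \<le> (\<integral>\<^sup>+y. indicator (ball y (5 * qK ^ 3 * r y)) x \<partial>count_space G)"
          using y by (intro nn_integral_mono) (auto simp: indicator_def)
        finally show ?thesis .
      qed simp
    qed
    also have "\<dots> = (\<integral>\<^sup>+y. (\<integral>\<^sup>+x. indicator (ball y (5 * qK ^ 3 * r y)) x \<partial>W) \<partial>count_space G)"
      using cG by (intro nn_integral_count_space_nn_integral) auto
    finally show "emeasure W E \<le> (\<integral>\<^sup>+y. emeasure W (ball y (5 * qK ^ 3 * r y)) \<partial>count_space G)" by simp
  qed simp
  also have "\<dots> = (\<integral>\<^sup>+y. ennreal t * emeasure W (ball y (5 * qK ^ 3 * r y)) \<partial>count_space G)"
    by (simp add: nn_integral_cmult)
  also have "\<dots> \<le> (\<integral>\<^sup>+y. ennreal C * (\<integral>\<^sup>+x\<in>ball y (r y). h x \<partial>W) \<partial>count_space G)"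
  proof (rule nn_integral_mono)
    fix y assume "y \<in> space (count_space G)"
    then have y: "y \<in> A" using G by auto
    note le = ball_doublingD(2)[OF W r(1)[OF y], of y] and C0 = ball_doublingD(3)[OF W r(1)[OF y]]
    have "ennreal t * emeasure W (ball y (5 * qK ^ 3 * r y)) \<le> ennreal t * (ennreal C * emeasure W (ball y (r y)))"
      using le C0 by (intro mult_left_mono) (auto simp: W.emeasure_eq_measure simp flip: ennreal_mult intro: ennreal_leI)
    also have "\<dots> = ennreal C * (ennreal t * emeasure W (ball y (r y)))" by (simp add: ac_simps)
    also have "\<dots> \<le> ennreal C * (\<integral>\<^sup>+x\<in>ball y (r y). h x \<partial>W)" using r(3)[OF y]
      by (intro mult_left_mono) auto
    finally show "ennreal t * emeasure W (ball y (5 * qK ^ 3 * r y)) \<le> ennreal C * (\<integral>\<^sup>+x\<in>ball y (r y). h x \<partial>W)" .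
  qed
  also have "\<dots> = ennreal C * (\<integral>\<^sup>+y. (\<integral>\<^sup>+x\<in>ball y (r y). h x \<partial>W) \<partial>count_space G)"
    by (simp add: nn_integral_cmult)
  also have "(\<integral>\<^sup>+y. (\<integral>\<^sup>+x\<in>ball y (r y). h x \<partial>W) \<partial>count_space G) \<le> (\<integral>\<^sup>+x. h x * indicator UNIV x \<partial>W)"
    by (rule nn_integral_disjoint_family_le[OF cG G(2)]) auto
  finally have "ennreal t * emeasure W E \<le> ennreal C * (\<integral>\<^sup>+y. h y \<partial>W)"
    by (simp add: mult_left_mono)
  with E AE show thesis using that unfolding A_def by blast
qed

text \<open>Marcinkiewicz interpolation between the weak type bound and the trivial supremum bound,
  carried out on dyadic levels: instead of a distribution function of the maximal function, the sets
  E of the weak type bound add up to a measurable G. The constant blows up as a tends to 1, hence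
  the lower bounds on exponents later on.\<close>

lemma maximal_strong_type:
  fixes h :: "'a \<Rightarrow> real"
  assumes W: "ball_doubling W C" and h[measurable]: "h \<in> borel_measurable W" and h0: "\<And>x. 0 \<le> h x"
    and a: "1 < a" and fin: "(\<integral>\<^sup>+x. ennreal (h x powr a) \<partial>W) < \<infinity>"
  obtains G :: "'a \<Rightarrow> real" where "G \<in> borel_measurable W" "\<And>x. 0 \<le> G x"
    "AE x in W. \<forall>r. 0 < r \<and> r \<le> R \<longrightarrow> (\<integral>\<^sup>+y\<in>ball x r. ennreal (h y) \<partial>W) \<le> ennreal (G x) * emeasure W (ball x r)"
    "(\<integral>\<^sup>+x. ennreal (G x powr a) \<partial>W)
       \<le> ennreal (1 + C * 2 powr (2 * a) / (1 - 2 powr (1 - a))) * (\<integral>\<^sup>+x. ennreal (h x powr a) \<partial>W)"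
proof -
  interpret W: finite_measure W using W by (simp add: ball_doubling_def)
  have sW: "sets W = sets M" using W by (simp add: ball_doubling_def)
  have spW: "space W = UNIV" using sets_eq_imp_space_eq[OF sW] space_UNIV by simp
  have bW[measurable]: "ball x r \<in> sets W" for x r by (simp add: sW)
  define V where "V = measure W UNIV"
  have "0 < measure W (ball undefined 1)" by (rule ball_doublingD[OF W]) simp
  also have "\<dots> \<le> V" unfolding V_def using W.bounded_measure spW by metis
  finally have V: "0 < V" .
  have C: "0 \<le> C" by (rule ball_doublingD(3)[OF W, of 1]) simp
  define I where "I = enn2real (\<integral>\<^sup>+x. ennreal (h x powr a) \<partial>W)"
  have I: "(\<integral>\<^sup>+x. ennreal (h x powr a) \<partial>W) = ennreal I" "0 \<le> I" using fin by (auto simp: I_def less_top)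
  show thesis
  proof (cases "I = 0")
    case True
    then have "(\<integral>\<^sup>+x. ennreal (h x powr a) \<partial>W) = 0" using I(1) by simp
    then have "AE x in W. ennreal (h x powr a) = 0" by (subst (asm) nn_integral_0_iff_AE) auto
    then have z: "AE x in W. h x = 0" by eventually_elim (simp add: ennreal_eq_0_iff)
    have "(\<integral>\<^sup>+y\<in>ball x r. ennreal (h y) \<partial>W) = (\<integral>\<^sup>+y. 0 \<partial>W)" for x r
      using z by (intro nn_integral_cong_AE) (auto elim: eventually_mono)
    then show ?thesis by (intro that[of "\<lambda>_. 0"]) auto
  next
    case False
    then have Ipos: "0 < I" using I by simp
    \<comment> \<open>The bottom level is chosen so that the constant function \<open>c0\<close> has
      exactly the a-th moment I; it accounts for the summand 1 in the constant.\<close>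
    define c0 where "c0 = (I / V) powr (1 / a)"
    have c0: "0 < c0" "c0 powr a * V = I" using Ipos V a by (auto simp: c0_def powr_powr)
    define \<tau> where "\<tau> n = 2 ^ n * c0" for n :: nat
    have \<tau>: "0 < \<tau> n" "\<tau> (Suc n) = 2 * \<tau> n" for n using c0 by (auto simp: \<tau>_def)
    \<comment> \<open>Values up to \<open>\<tau> n / 2\<close> contribute at most
      \<open>\<tau> n / 2\<close> to any average, so an average above \<open>\<tau> n\<close> forces
      an average of \<open>h1 n\<close> above \<open>\<tau> n / 2\<close>.\<close>
    define h1 where "h1 n y = (if \<tau> n / 2 < h y then h y else 0)" for n y
    have h1[measurable]: "h1 n \<in> borel_measurable W" for n unfolding h1_def by measurable
    define P where "P n E \<longleftrightarrow> E \<in> sets W \<and>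
        {x. \<exists>r. 0 < r \<and> r \<le> R \<and> ennreal (\<tau> n / 2) * emeasure W (ball x r) < (\<integral>\<^sup>+y\<in>ball x r. ennreal (h1 n y) \<partial>W)} \<subseteq> E \<and>
        ennreal (\<tau> n / 2) * emeasure W E \<le> ennreal C * (\<integral>\<^sup>+y. ennreal (h1 n y) \<partial>W)" for n E
    have "\<exists>E. P n E" for n
    proof -
      have t: "0 < \<tau> n / 2" using \<tau>(1)[of n] by simp
      have hm: "(\<lambda>y. ennreal (h1 n y)) \<in> borel_measurable W" by measurable
      show ?thesis by (rule maximal_weak_type[OF W hm t, of R]) (auto simp: P_def)
    qed
    then obtain E where PE: "\<And>n. P n (E n)" by metis
    have E[measurable]: "E n \<in> sets W" for n using PE[of n] by (simp add: P_def)
    have Esub: "x \<in> E n" if "0 < r" "r \<le> R"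
      "ennreal (\<tau> n / 2) * emeasure W (ball x r) < (\<integral>\<^sup>+y\<in>ball x r. ennreal (h1 n y) \<partial>W)" for n x r
      using PE[of n] that unfolding P_def by blast
    have Ele: "ennreal (\<tau> n / 2) * emeasure W (E n) \<le> ennreal C * (\<integral>\<^sup>+y. ennreal (h1 n y) \<partial>W)" for n
      using PE[of n] by (simp add: P_def)
    \<comment> \<open>H is the a-th power of the future G. On \<open>E n\<close> averages may exceed
      \<open>\<tau> n\<close>; the value \<open>2 * \<tau> n\<close> assigned there reaches the next
      level \<open>\<tau> (Suc n)\<close>.\<close>
    define H where "H x = ennreal (c0 powr a) + (\<Sum>n. ennreal ((2 * \<tau> n) powr a) * indicator (E n) x)" for x
    have H[measurable]: "H \<in> borel_measurable W" unfolding H_def by measurable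
    define k where "k = C * 2 powr (a + 1)"
    have k: "0 \<le> k" using C by (simp add: k_def)
    have level: "ennreal ((2 * \<tau> n) powr a) * emeasure W (E n) \<le> (\<integral>\<^sup>+y. ennreal (k * \<tau> n powr (a - 1) * h1 n y) \<partial>W)" for n
    proof -
      have t: "0 < \<tau> n" by (rule \<tau>)
      have e: "(2 * \<tau> n) powr a = 2 powr (a + 1) * \<tau> n powr (a - 1) * (\<tau> n / 2)"
        using t by (simp add: powr_mult powr_add powr_diff)
      have "ennreal ((2 * \<tau> n) powr a) * emeasure W (E n)
          = ennreal (2 powr (a + 1) * \<tau> n powr (a - 1)) * (ennreal (\<tau> n / 2) * emeasure W (E n))"
        unfolding e using t by (subst ennreal_mult) (auto simp: mult.assoc)
      also have "\<dots> \<le> ennreal (2 powr (a + 1) * \<tau> n powr (a - 1)) * (ennreal C * (\<integral>\<^sup>+y. ennreal (h1 n y) \<partial>W))"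
        by (intro mult_left_mono Ele) auto
      also have "\<dots> = ennreal (k * \<tau> n powr (a - 1)) * (\<integral>\<^sup>+y. ennreal (h1 n y) \<partial>W)"
        using C by (simp add: k_def ennreal_mult ac_simps)
      also have "\<dots> = (\<integral>\<^sup>+y. ennreal (k * \<tau> n powr (a - 1)) * ennreal (h1 n y) \<partial>W)"
        by (simp add: nn_integral_cmult)
      also have "\<dots> = (\<integral>\<^sup>+y. ennreal (k * \<tau> n powr (a - 1) * h1 n y) \<partial>W)"
        using k h0 by (intro nn_integral_cong) (simp add: ennreal_mult h1_def)
      finally show ?thesis .
    qed
    define c where "c = (2::real) powr (a - 1)"
    have c: "1 < c" using a by (simp add: c_def gr_one_powr)
    have k2: "k * (c / (c - 1)) * 2 powr (a - 1) = C * 2 powr (2 * a) / (1 - 2 powr (1 - a))"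
    proof -
      have "c / (c - 1) = 1 / (1 - 1 / c)" using c by (simp add: field_simps)
      moreover have "1 / c = 2 powr (1 - a)" by (simp add: c_def flip: powr_minus_divide)
      moreover have "(2::real) powr (2 * a) = 2 powr (a + 1) * 2 powr (a - 1)" by (simp flip: powr_add)
      ultimately show ?thesis by (simp add: k_def)
    qed
    have pt: "(\<Sum>n. ennreal (k * \<tau> n powr (a - 1) * h1 n y))
        \<le> ennreal (C * 2 powr (2 * a) / (1 - 2 powr (1 - a))) * ennreal (h y powr a)" for y
    proof -
      have nn: "0 \<le> k * \<tau> n powr (a - 1) * h1 n y" for n using k h0 by (simp add: h1_def)
      have fin: "(\<Sum>n<N. k * \<tau> n powr (a - 1) * h1 n y) \<le> C * 2 powr (2 * a) / (1 - 2 powr (1 - a)) * h y powr a" for N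
      proof -
        have "(\<Sum>n<N. k * \<tau> n powr (a - 1) * h1 n y)
            \<le> (\<Sum>n<N. (k * h y) * (if \<tau> n powr (a - 1) \<le> (2 * h y) powr (a - 1) then \<tau> n powr (a - 1) else 0))"
        proof (rule sum_mono)
          fix n
          show "k * \<tau> n powr (a - 1) * h1 n y
            \<le> (k * h y) * (if \<tau> n powr (a - 1) \<le> (2 * h y) powr (a - 1) then \<tau> n powr (a - 1) else 0)"
          proof (cases "\<tau> n / 2 < h y")
            case True
            then have "\<tau> n powr (a - 1) \<le> (2 * h y) powr (a - 1)" using a \<tau>(1)[of n] by (intro powr_mono2) auto
            then show ?thesis using True by (simp add: h1_def)
          qed (use k h0 in \<open>simp add: h1_def\<close>)
        qed
        also have "\<dots> = (k * h y) * (\<Sum>n<N. if \<tau> n powr (a - 1) \<le> (2 * h y) powr (a - 1) then \<tau> n powr (a - 1) else 0)"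
          by (simp add: sum_distrib_left)
        also have "\<dots> \<le> (k * h y) * (c / (c - 1) * (2 * h y) powr (a - 1))"
        proof (intro mult_left_mono sum_geometric_growth_le)
          show "c * \<tau> n powr (a - 1) \<le> \<tau> (Suc n) powr (a - 1)" for n by (simp add: c_def \<tau>(2) powr_mult)
          show "0 < \<tau> n powr (a - 1)" for n using \<tau>(1)[of n] by simp
        qed (use c k h0 in auto)
        also have "\<dots> = k * (c / (c - 1)) * 2 powr (a - 1) * h y powr a"
          using h0[of y] powr_mult_base[of "h y" "a - 1"] by (simp add: powr_mult)
        finally show ?thesis unfolding k2 .
      qed
      have "0 \<le> k * (c / (c - 1)) * 2 powr (a - 1)" using k c by auto
      then have "0 \<le> C * 2 powr (2 * a) / (1 - 2 powr (1 - a))" by (simp only: k2)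
      then have "(\<Sum>n<N. ennreal (k * \<tau> n powr (a - 1) * h1 n y))
          \<le> ennreal (C * 2 powr (2 * a) / (1 - 2 powr (1 - a))) * ennreal (h y powr a)" for N
        using fin[of N] nn by (simp add: sum_ennreal ennreal_leI flip: ennreal_mult)
      then show ?thesis by (simp add: suminf_eq_SUP SUP_least)
    qed
    have kk: "0 \<le> C * 2 powr (2 * a) / (1 - 2 powr (1 - a))" using k c by (auto simp flip: k2)
    have HI: "(\<integral>\<^sup>+x. H x \<partial>W) \<le> ennreal (1 + C * 2 powr (2 * a) / (1 - 2 powr (1 - a))) * ennreal I"
    proof -
      have "(\<integral>\<^sup>+x. H x \<partial>W) = ennreal (c0 powr a) * emeasure W (space W)
          + (\<Sum>n. ennreal ((2 * \<tau> n) powr a) * emeasure W (E n))"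
        unfolding H_def by (simp add: nn_integral_add nn_integral_suminf nn_integral_cmult_indicator)
      also have "ennreal (c0 powr a) * emeasure W (space W) = ennreal I"
        using c0(2) by (simp add: spW W.emeasure_eq_measure V_def flip: ennreal_mult)
      also have "(\<Sum>n. ennreal ((2 * \<tau> n) powr a) * emeasure W (E n))
          \<le> (\<Sum>n. \<integral>\<^sup>+y. ennreal (k * \<tau> n powr (a - 1) * h1 n y) \<partial>W)"
        by (intro suminf_le level) auto
      also have "\<dots> = (\<integral>\<^sup>+y. (\<Sum>n. ennreal (k * \<tau> n powr (a - 1) * h1 n y)) \<partial>W)"
        by (intro nn_integral_suminf[symmetric]) measurable
      also have "\<dots> \<le> (\<integral>\<^sup>+y. ennreal (C * 2 powr (2 * a) / (1 - 2 powr (1 - a))) * ennreal (h y powr a) \<partial>W)"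
        by (intro nn_integral_mono pt)
      also have "\<dots> = ennreal (C * 2 powr (2 * a) / (1 - 2 powr (1 - a))) * ennreal I"
        by (subst nn_integral_cmult) (auto simp: I)
      finally show ?thesis using kk I(2) by (simp add: distrib_right add_left_mono)
    qed
    have "(\<integral>\<^sup>+x. H x \<partial>W) < \<infinity>" by (rule le_less_trans[OF HI]) (simp add: ennreal_mult_less_top)
    then have Hfin: "AE x in W. H x \<noteq> \<infinity>" by (intro nn_integral_PInf_AE) auto
    define G where "G x = enn2real (H x) powr (1 / a)" for x
    show ?thesis
    proof
      show "G \<in> borel_measurable W" unfolding G_def by measurable
      show "0 \<le> G x" for x by (simp add: G_def)
      have "(\<integral>\<^sup>+x. ennreal (G x powr a) \<partial>W) \<le> (\<integral>\<^sup>+x. H x \<partial>W)"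
        using a by (intro nn_integral_mono) (auto simp: G_def powr_powr ennreal_enn2real_if)
      also note HI
      finally show "(\<integral>\<^sup>+x. ennreal (G x powr a) \<partial>W)
        \<le> ennreal (1 + C * 2 powr (2 * a) / (1 - 2 powr (1 - a))) * (\<integral>\<^sup>+x. ennreal (h x powr a) \<partial>W)"
        by (simp only: I)
      show "AE x in W. \<forall>r. 0 < r \<and> r \<le> R \<longrightarrow> (\<integral>\<^sup>+y\<in>ball x r. ennreal (h y) \<partial>W) \<le> ennreal (G x) * emeasure W (ball x r)"
        using Hfin
      proof eventually_elim
        case (elim x)
        have Gge: "u \<le> G x" if "0 \<le> u" "ennreal (u powr a) \<le> H x" for u
        proof -
          have "u powr a \<le> enn2real (H x)"
            using that elim by (metis ennreal_enn2real_if infinity_ennreal_def ennreal_le_iff enn2real_nonneg)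
          then have "(u powr a) powr (1 / a) \<le> G x" unfolding G_def using a by (intro powr_mono2) auto
          then show ?thesis using that a by (simp add: powr_powr)
        qed
        show ?case
        proof (intro allI impI, rule ccontr)
          fix r assume r: "0 < r \<and> r \<le> R"
            and "\<not> (\<integral>\<^sup>+y\<in>ball x r. ennreal (h y) \<partial>W) \<le> ennreal (G x) * emeasure W (ball x r)"
          then have gt: "ennreal (G x) * emeasure W (ball x r) < (\<integral>\<^sup>+y\<in>ball x r. ennreal (h y) \<partial>W)" by simp
          have step: "2 * \<tau> n \<le> G x" if "ennreal (\<tau> n) * emeasure W (ball x r) < (\<integral>\<^sup>+y\<in>ball x r. ennreal (h y) \<partial>W)" for n
          proof -
            have "x \<in> E n"
            proof (rule Esub[of r], rule_tac [3] ccontr)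
              assume "\<not> ennreal (\<tau> n / 2) * emeasure W (ball x r) < (\<integral>\<^sup>+y\<in>ball x r. ennreal (h1 n y) \<partial>W)"
              then have le: "(\<integral>\<^sup>+y\<in>ball x r. ennreal (h1 n y) \<partial>W) \<le> ennreal (\<tau> n / 2) * emeasure W (ball x r)" by simp
              have "(\<integral>\<^sup>+y\<in>ball x r. ennreal (h y) \<partial>W)
                  \<le> (\<integral>\<^sup>+y. ennreal (h1 n y) * indicator (ball x r) y + ennreal (\<tau> n / 2) * indicator (ball x r) y \<partial>W)"
                using \<tau>(1)[of n] h0
                by (intro nn_integral_mono) (auto simp: h1_def indicator_def ennreal_leI simp flip: ennreal_plus)
              also have "\<dots> = (\<integral>\<^sup>+y\<in>ball x r. ennreal (h1 n y) \<partial>W) + ennreal (\<tau> n / 2) * emeasure W (ball x r)"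
                by (simp add: nn_integral_add nn_integral_cmult_indicator)
              also have "\<dots> \<le> ennreal (\<tau> n / 2) * emeasure W (ball x r) + ennreal (\<tau> n / 2) * emeasure W (ball x r)"
                by (intro add_mono le order_refl)
              also have "\<dots> = ennreal (\<tau> n) * emeasure W (ball x r)"
                using \<tau>(1)[of n] by (simp flip: distrib_right ennreal_plus)
              finally show False using that by simp
            qed (use r in auto)
            have "ennreal ((2 * \<tau> n) powr a) = (\<Sum>i\<in>{n}. ennreal ((2 * \<tau> i) powr a) * indicator (E i) x)"
              using \<open>x \<in> E n\<close> by simp
            also have "\<dots> \<le> (\<Sum>i. ennreal ((2 * \<tau> i) powr a) * indicator (E i) x)"
              by (intro sum_le_suminf) auto
            also have "\<dots> \<le> H x" by (simp add: H_def)
            finally show ?thesis using \<tau>(1)[of n] by (intro Gge) auto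
          qed
          \<comment> \<open>If some average exceeded \<open>G x\<close>, then it would exceed each
            level already reached by \<open>G x\<close>, put x into the next \<open>E n\<close> and
            lift \<open>G x\<close> by another level; \<open>G x\<close> would lie above all
            levels.\<close>
          have all: "\<tau> n \<le> G x" for n
          proof (induction n)
            case 0
            have "c0 \<le> G x" using c0 by (intro Gge) (auto simp: H_def)
            then show ?case by (simp add: \<tau>_def)
          next
            case (Suc n)
            then have "ennreal (\<tau> n) * emeasure W (ball x r) \<le> ennreal (G x) * emeasure W (ball x r)"
              by (intro mult_right_mono ennreal_leI) auto
            then show ?case using step[of n] gt by (simp add: \<tau>(2))
          qed
          obtain n where "G x / c0 < 2 ^ n" using real_arch_pow[of 2 "G x / c0"] by auto
          then show False using all[of n] c0 by (simp add: \<tau>_def field_simps)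
        qed
      qed
    qed
  qed
qed

end

section \<open>The John--Nirenberg inequality\<close>

lemma ennreal_le_times_if_divide_le:
  fixes a b c :: ennreal
  assumes "a / c \<le> b" "c \<noteq> 0" "c \<noteq> top"
  shows "a \<le> b * c"
proof -
  have "a = c * (a / c)" using assms(2,3) by (metis ennreal_times_divide mult.commute mult_divide_eq_ennreal)
  also have "\<dots> \<le> c * b" by (rule mult_left_mono[OF assms(1)]) simp
  finally show ?thesis by (simp add: mult.commute)
qed

section \<open>Lebesgue points and mean oscillation\<close>

context nondegenerate_homogeneous_space
begin

abbreviation avg :: "('a \<Rightarrow> real) \<Rightarrow> 'a \<Rightarrow> real \<Rightarrow> real" where "avg \<equiv> ball_average M d"

lemma ball_doubling_M:
  obtains C where "1 \<le> C" "ball_doubling M C"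
proof -
  obtain C where C: "1 \<le> C" "\<And>x r. 0 < r \<Longrightarrow> m (ball x (5 * qK ^ 3 * r)) \<le> C * m (ball x r)"
    using dilation_bound[of "5 * qK ^ 3"] by blast
  then have "ball_doubling M C"
    using measure_ball_pos finite_measure_axioms by (auto simp: ball_doubling_def)
  then show thesis using that C by blast
qed

text \<open>The exceptional sets below are described by conditions on all small radii and are not
  known to be measurable, so nullity is obtained from measurable covers of arbitrarily small
  measure.\<close>

lemma null_set_cover:
  assumes "\<And>\<delta>::real. 0 < \<delta> \<Longrightarrow> \<exists>F\<in>sets M. A \<subseteq> F \<and> emeasure M F \<le> ennreal \<delta>"
  obtains N where "N \<in> null_sets M" "A \<subseteq> N"
proof -
  have "\<exists>F. F \<in> sets M \<and> A \<subseteq> F \<and> emeasure M F \<le> ennreal (1 / real (Suc n))" for n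
    using assms[of "1 / real (Suc n)"] by auto
  then obtain F where F: "\<And>n. F n \<in> sets M" "\<And>n. A \<subseteq> F n" "\<And>n. emeasure M (F n) \<le> ennreal (1 / real (Suc n))"
    by metis
  have "emeasure M (\<Inter>n. F n) \<le> ennreal 0 + ennreal e" if e: "0 < e" for e :: real
  proof -
    obtain n where n: "inverse (real (Suc n)) < e" using reals_Archimedean[OF e] by blast
    have "emeasure M (\<Inter>n. F n) \<le> emeasure M (F n)" using F by (intro emeasure_mono) auto
    also have "\<dots> \<le> ennreal (1 / real (Suc n))" by (rule F)
    also have "\<dots> \<le> ennreal e" using n by (intro ennreal_leI) (simp add: inverse_eq_divide)
    finally show ?thesis by simp
  qed
  then have "emeasure M (\<Inter>n. F n) \<le> ennreal 0" by (rule ennreal_le_epsilon)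
  moreover have "(\<Inter>n. F n) \<in> sets M" using F by (intro sets.countable_INT) auto
  ultimately have "(\<Inter>n. F n) \<in> null_sets M" by (auto simp: null_sets_def)
  then show thesis using that F(2) by blast
qed

text \<open>Density of continuous functions combined with the weak type bound. The result lets a
  large value of \<open>\<bar>b z - k\<bar>\<close> be detected from averages over small balls
  around z.\<close>

lemma Lebesgue_points:
  assumes b: "integrable M b"
  shows "AE x in M. \<forall>e>0. \<exists>R>0. \<forall>r. 0 < r \<and> r \<le> R \<longrightarrow>
    (\<integral>\<^sup>+y\<in>ball x r. ennreal \<bar>b y - b x\<bar> \<partial>M) \<le> ennreal (e * m (ball x r))"
proof -
  have [measurable]: "b \<in> borel_measurable M" using b by simp
  obtain C where C: "1 \<le> C" "ball_doubling M C" by (rule ball_doubling_M)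
  define Bad where "Bad e = {x. \<not> (\<exists>R>0. \<forall>r. 0 < r \<and> r \<le> R \<longrightarrow>
    (\<integral>\<^sup>+y\<in>ball x r. ennreal \<bar>b y - b x\<bar> \<partial>M) \<le> ennreal (e * m (ball x r)))}" for e
  have cover: "\<exists>F\<in>sets M. Bad e \<subseteq> F \<and> emeasure M F \<le> ennreal \<delta>" if e: "0 < e" and \<delta>: "0 < \<delta>" for e \<delta> :: real
  proof -
    define t where "t = e / 4"
    have t: "0 < t" using e by (simp add: t_def)
    \<comment> \<open>E has measure at most \<open>C * \<delta>' / t\<close> and D, by Chebyshev's
      inequality, at most \<open>\<delta>' / t\<close>; together this is
      \<open>\<delta>\<close>.\<close>
    define \<delta>' where "\<delta>' = \<delta> * t / (C + 1)"
    have "0 < \<delta>'" using \<delta> t C by (simp add: \<delta>'_def)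
    then obtain g where g: "compactly_supported_continuous g" "(LINT x|M. \<bar>b x - g x\<bar>) < \<delta>'"
      using Cc_dense[OF b] by blast
    have gi: "integrable M g" by (rule Cc_integrable[OF g(1)])
    have [measurable]: "g \<in> borel_measurable M" using gi by simp
    have Ibg: "(\<integral>\<^sup>+y. ennreal \<bar>b y - g y\<bar> \<partial>M) \<le> ennreal \<delta>'"
      using g(2) b gi by (subst nn_integral_eq_integral) (auto intro!: ennreal_leI)
    have hm: "(\<lambda>y. ennreal \<bar>b y - g y\<bar>) \<in> borel_measurable M" by measurable
    obtain E where E: "E \<in> sets M"
      "{x. \<exists>r. 0 < r \<and> r \<le> 1 \<and> ennreal t * emeasure M (ball x r) < (\<integral>\<^sup>+y\<in>ball x r. ennreal \<bar>b y - g y\<bar> \<partial>M)} \<subseteq> E"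
      "ennreal t * emeasure M E \<le> ennreal C * (\<integral>\<^sup>+y. ennreal \<bar>b y - g y\<bar> \<partial>M)"
      by (rule maximal_weak_type[OF C(2) hm t, of 1])
    \<comment> \<open>E controls the averages of \<open>\<bar>b - g\<bar>\<close> around x, D the
      value of that difference at x itself.\<close>
    define D where "D = {x\<in>space M. t \<le> \<bar>b x - g x\<bar>}"
    have D[measurable]: "D \<in> sets M" unfolding D_def by measurable
    have "ennreal t * emeasure M D = (\<integral>\<^sup>+x. ennreal t * indicator D x \<partial>M)"
      by (simp add: nn_integral_cmult_indicator)
    also have "\<dots> \<le> (\<integral>\<^sup>+y. ennreal \<bar>b y - g y\<bar> \<partial>M)"
      by (intro nn_integral_mono) (auto simp: indicator_def D_def intro: ennreal_leI)
    finally have Dle: "ennreal t * emeasure M D \<le> ennreal \<delta>'" using Ibg by (rule order_trans)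
    have "ennreal t * emeasure M E \<le> ennreal C * ennreal \<delta>'"
      by (rule order_trans[OF E(3)]) (intro mult_left_mono Ibg, simp)
    then have "t * m E \<le> C * \<delta>'" "t * m D \<le> \<delta>'"
      using Dle C t \<open>0 < \<delta>'\<close> by (auto simp: emeasure_eq_measure simp flip: ennreal_mult)
    then have "t * (m E + m D) \<le> (C + 1) * \<delta>'" by (simp add: algebra_simps)
    also have "\<dots> = t * \<delta>" using C by (simp add: \<delta>'_def)
    finally have "m E + m D \<le> \<delta>" using t by simp
    moreover have "m (E \<union> D) \<le> m E + m D" using E(1) D by (rule measure_Un_le)
    ultimately have "emeasure M (E \<union> D) \<le> ennreal \<delta>"
      by (simp add: emeasure_eq_measure ennreal_leI)
    moreover have "Bad e \<subseteq> E \<union> D"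
    proof (rule subsetI, rule ccontr)
      fix x assume x: "x \<in> Bad e" "x \<notin> E \<union> D"
      \<comment> \<open>Here the topology meets the quasimetric: on a ball inside U the continuous g
        is nearly constant.\<close>
      define U where "U = {y. \<bar>g y - g x\<bar> < t}"
      have "open U" unfolding U_def using g(1)
        by (intro open_Collect_less continuous_intros) (auto simp: compactly_supported_continuous_def)
      moreover have "x \<in> U" using t by (simp add: U_def)
      ultimately obtain \<rho> where \<rho>: "0 < \<rho>" "ball x \<rho> \<subseteq> U" using ball_in_nhd by blast
      have "(\<integral>\<^sup>+y\<in>ball x r. ennreal \<bar>b y - b x\<bar> \<partial>M) \<le> ennreal (e * m (ball x r))"
        if r: "0 < r" "r \<le> min \<rho> 1" for r
      proof -
        have *: "(\<integral>\<^sup>+y\<in>ball x r. ennreal \<bar>b y - g y\<bar> \<partial>M) \<le> ennreal t * emeasure M (ball x r)"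
        proof (rule ccontr)
          assume "\<not> ?thesis"
          then have "x \<in> E" using r E(2) by (auto simp: not_le)
          then show False using x by simp
        qed
        have "(\<integral>\<^sup>+y\<in>ball x r. ennreal \<bar>b y - b x\<bar> \<partial>M)
          \<le> (\<integral>\<^sup>+y. ennreal \<bar>b y - g y\<bar> * indicator (ball x r) y + ennreal (2 * t) * indicator (ball x r) y \<partial>M)"
        proof (rule nn_integral_mono)
          fix y
          show "ennreal \<bar>b y - b x\<bar> * indicator (ball x r) y
            \<le> ennreal \<bar>b y - g y\<bar> * indicator (ball x r) y + ennreal (2 * t) * indicator (ball x r) y"
          proof (cases "y \<in> ball x r")
            case True
            then have "\<bar>g y - g x\<bar> < t" using \<rho> ball_mono[of r \<rho> x] r by (auto simp: U_def)
            moreover have "\<bar>b x - g x\<bar> < t" using x by (auto simp: D_def space_UNIV)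
            ultimately have "\<bar>b y - b x\<bar> \<le> \<bar>b y - g y\<bar> + 2 * t" by linarith
            then show ?thesis using True t by (auto simp flip: ennreal_plus intro: ennreal_leI)
          qed simp
        qed
        also have "\<dots> = (\<integral>\<^sup>+y\<in>ball x r. ennreal \<bar>b y - g y\<bar> \<partial>M) + ennreal (2 * t) * emeasure M (ball x r)"
          by (simp add: nn_integral_add nn_integral_cmult_indicator)
        also have "\<dots> \<le> ennreal t * emeasure M (ball x r) + ennreal (2 * t) * emeasure M (ball x r)"
          by (intro add_mono * order_refl)
        also have "\<dots> = ennreal (3 * t * m (ball x r))"
          using t by (simp add: emeasure_eq_measure flip: ennreal_mult ennreal_plus distrib_right)
        also have "\<dots> \<le> ennreal (e * m (ball x r))" using e
          by (intro ennreal_leI mult_right_mono) (auto simp: t_def)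
        finally show ?thesis .
      qed
      then have "\<exists>R>0. \<forall>r. 0 < r \<and> r \<le> R \<longrightarrow>
        (\<integral>\<^sup>+y\<in>ball x r. ennreal \<bar>b y - b x\<bar> \<partial>M) \<le> ennreal (e * m (ball x r))"
        using \<rho> by (intro exI[of _ "min \<rho> 1"]) auto
      then show False using x(1) unfolding Bad_def by blast
    qed
    ultimately show ?thesis using E(1) D by blast
  qed
  have AE1: "AE x in M. x \<notin> Bad (1 / real (Suc n))" for n
  proof -
    obtain N where "N \<in> null_sets M" "Bad (1 / real (Suc n)) \<subseteq> N"
      using null_set_cover[of "Bad (1 / real (Suc n))"] cover[of "1 / real (Suc n)"] by (metis of_nat_0_less_iff zero_less_Suc zero_less_divide_1_iff)
    then show ?thesis by (intro AE_I[of _ _ N]) (auto simp: null_sets_def)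
  qed
  have "AE x in M. \<forall>n. x \<notin> Bad (1 / real (Suc n))" by (rule AE_all_countable[THEN iffD2, OF allI, OF AE1])
  then show ?thesis
  proof eventually_elim
    case (elim x)
    show ?case
    proof (intro allI impI)
      fix e :: real assume "0 < e"
      then obtain n where n: "inverse (real (Suc n)) < e" using reals_Archimedean by blast
      obtain R where R: "R > 0" "\<And>r. 0 < r \<Longrightarrow> r \<le> R \<Longrightarrow>
        (\<integral>\<^sup>+y\<in>ball x r. ennreal \<bar>b y - b x\<bar> \<partial>M) \<le> ennreal (1 / real (Suc n) * m (ball x r))"
        using elim[rule_format, of n] unfolding Bad_def by blast
      have "ennreal (1 / real (Suc n) * m (ball x r)) \<le> ennreal (e * m (ball x r))" for r
        using n by (intro ennreal_leI mult_right_mono) (auto simp: inverse_eq_divide)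
      then show "\<exists>R>0. \<forall>r. 0 < r \<and> r \<le> R \<longrightarrow>
        (\<integral>\<^sup>+y\<in>ball x r. ennreal \<bar>b y - b x\<bar> \<partial>M) \<le> ennreal (e * m (ball x r))"
        using R order_trans by blast
    qed
  qed
qed

text \<open>An average deviates from k by at most the mean deviation, and the domain of integration
  may be enlarged to S. With S a larger ball and k its average, this compares averages over nested
  balls.\<close>

lemma avg_deviation_le:
  assumes b: "integrable M b" and r: "0 < r" and S: "ball x r \<subseteq> S" "S \<in> sets M"
    and le: "(\<integral>\<^sup>+y\<in>S. ennreal \<bar>b y - k\<bar> \<partial>M) \<le> ennreal v" and v: "0 \<le> v"
  shows "\<bar>avg b x r - k\<bar> * m (ball x r) \<le> v"
proof -
  have bB: "set_integrable M (ball x r) b"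
    using integrable_mult_indicator[OF ball_sets b] by (simp add: set_integrable_def)
  have kB: "set_integrable M (ball x r) (\<lambda>_. k)"
    using integrable_mult_indicator[OF ball_sets, of "\<lambda>_. k" x r] by (simp add: set_integrable_def)
  have pos: "0 < m (ball x r)" by (rule measure_ball_pos[OF r])
  have "avg b x r * m (ball x r) = (LINT y:ball x r|M. b y)" using pos by (simp add: ball_average_def)
  then have "(avg b x r - k) * m (ball x r) = (LINT y:ball x r|M. b y) - (LINT y:ball x r|M. k)"
    using kB by (simp add: algebra_simps set_lebesgue_integral_def)
  also have "\<dots> = (LINT y:ball x r|M. b y - k)" using bB kB by (simp add: set_integral_diff)
  finally have "\<bar>avg b x r - k\<bar> * m (ball x r) = \<bar>LINT y:ball x r|M. b y - k\<bar>"
    using pos by (metis abs_mult abs_of_pos)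
  also have "ennreal \<dots> \<le> (\<integral>\<^sup>+y. ennreal (norm (indicator (ball x r) y *\<^sub>R (b y - k))) \<partial>M)"
    unfolding set_lebesgue_integral_def using set_integral_diff(1)[OF bB kB]
    by (subst real_norm_def[symmetric]) (intro integral_norm_bound_ennreal, simp add: set_integrable_def)
  also have "\<dots> \<le> (\<integral>\<^sup>+y\<in>S. ennreal \<bar>b y - k\<bar> \<partial>M)"
    using S by (intro nn_integral_mono) (auto simp: indicator_def)
  also have "\<dots> \<le> ennreal v" by (rule le)
  finally show ?thesis using v by simp
qed

lemma BMO_oscillation:
  assumes "b \<in> BMO M d"
  obtains \<beta> where "0 < \<beta>" "integrable M b"
    "\<And>x r. 0 < r \<Longrightarrow> (\<integral>\<^sup>+y\<in>ball x r. ennreal \<bar>b y - avg b x r\<bar> \<partial>M) \<le> ennreal (\<beta> * m (ball x r))"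
proof -
  have bm[measurable]: "b \<in> borel_measurable M" and bS: "\<And>x r. set_integrable M (ball x r) b" and bfin: "bmo_norm M d b < \<infinity>"
    using assms by (auto simp: BMO_def)
  have bi: "integrable M b"
    using bS[of undefined "qdiam d + 1"] ball_UNIV[of "qdiam d + 1"] by (simp add: set_integrable_def)
  define J where "J = (LINT y|M. \<bar>b y\<bar>)"
  have J: "0 \<le> J" "(\<integral>\<^sup>+y. ennreal \<bar>b y\<bar> \<partial>M) = ennreal J"
    using bi by (auto simp: J_def intro!: nn_integral_eq_integral)
  define v where "v = m UNIV"
  have v: "0 < v" unfolding v_def using measure_ball_pos[of "qdiam d + 1" undefined] diam_pos ball_UNIV[of "qdiam d + 1"] by simp
  define \<beta>1 where "\<beta>1 = enn2real (bmo_norm M d b)"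
  \<comment> \<open>The second summand covers radii from the diameter on, which
    \<open>bmo_norm\<close> does not see: such balls have measure at least
    \<open>v / C\<^sub>d\<close>, so the trivial bound \<open>2 * J\<close> suffices. The 1 makes
    \<open>\<beta>\<close> positive.\<close>
  define \<beta> where "\<beta> = \<beta>1 + 2 * J * C\<^sub>d / v + 1"
  have \<beta>1: "bmo_norm M d b = ennreal \<beta>1" "0 \<le> \<beta>1" using bfin by (auto simp: \<beta>1_def less_top)
  have nn: "0 \<le> 2 * J * C\<^sub>d / v" using J v Cd_gt_1 by auto
  show thesis
  proof
    show "0 < \<beta>" using \<beta>1 nn by (simp add: \<beta>_def)
    show "integrable M b" by (rule bi)
    fix x and r :: real assume r: "0 < r"
    have pos: "0 < m (ball x r)" by (rule measure_ball_pos[OF r])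
    show "(\<integral>\<^sup>+y\<in>ball x r. ennreal \<bar>b y - avg b x r\<bar> \<partial>M) \<le> ennreal (\<beta> * m (ball x r))"
    proof (cases "r < qdiam d")
      case True
      have "(\<integral>\<^sup>+y\<in>ball x r. ennreal \<bar>b y - avg b x r\<bar> \<partial>M) / emeasure M (ball x r) \<le> bmo_norm M d b"
        unfolding bmo_norm_def using True r by (intro SUP_upper2[of x] SUP_upper2[of r]) auto
      then have "(\<integral>\<^sup>+y\<in>ball x r. ennreal \<bar>b y - avg b x r\<bar> \<partial>M) / ennreal (m (ball x r)) \<le> ennreal \<beta>1"
        by (simp add: \<beta>1 emeasure_eq_measure)
      then have "(\<integral>\<^sup>+y\<in>ball x r. ennreal \<bar>b y - avg b x r\<bar> \<partial>M) \<le> ennreal \<beta>1 * ennreal (m (ball x r))"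
        using pos by (intro ennreal_le_times_if_divide_le) auto
      also have "\<dots> \<le> ennreal (\<beta> * m (ball x r))" using \<beta>1 nn
        by (auto simp flip: ennreal_mult simp: \<beta>_def intro!: ennreal_leI mult_right_mono)
      finally show ?thesis .
    next
      case False
      have "v \<le> m (ball x (2 * qdiam d))" using diam_pos by (simp add: v_def ball_UNIV)
      also have "\<dots> \<le> C\<^sub>d * m (ball x (qdiam d))" by (rule doubling_all[OF diam_pos])
      also have "\<dots> \<le> C\<^sub>d * m (ball x r)" using False Cd_gt_1
        by (intro mult_left_mono finite_measure_mono ball_mono) auto
      finally have vle: "v \<le> C\<^sub>d * m (ball x r)" .
      have JB: "(\<integral>\<^sup>+y\<in>ball x r. ennreal \<bar>b y\<bar> \<partial>M) \<le> ennreal J"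
        unfolding J(2)[symmetric] by (intro nn_integral_mono) (auto simp: indicator_def)
      have dev: "\<bar>avg b x r\<bar> * m (ball x r) \<le> J"
        using avg_deviation_le[OF bi r order_refl _ _ J(1), of x 0] JB by simp
      have "(\<integral>\<^sup>+y\<in>ball x r. ennreal \<bar>b y - avg b x r\<bar> \<partial>M)
        \<le> (\<integral>\<^sup>+y. ennreal \<bar>b y\<bar> * indicator (ball x r) y + ennreal \<bar>avg b x r\<bar> * indicator (ball x r) y \<partial>M)"
        by (intro nn_integral_mono) (auto simp: indicator_def simp flip: ennreal_plus intro!: ennreal_leI)
      also have "\<dots> = (\<integral>\<^sup>+y\<in>ball x r. ennreal \<bar>b y\<bar> \<partial>M) + ennreal \<bar>avg b x r\<bar> * emeasure M (ball x r)"
        by (simp add: nn_integral_add nn_integral_cmult_indicator)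
      also have "\<dots> \<le> ennreal J + ennreal J"
        using dev by (intro add_mono JB) (auto simp: emeasure_eq_measure simp flip: ennreal_mult intro: ennreal_leI)
      also have "\<dots> = ennreal (2 * J / v * v)" using J v by (simp flip: ennreal_plus)
      also have "\<dots> \<le> ennreal (2 * J / v * (C\<^sub>d * m (ball x r)))"
        using J v vle by (intro ennreal_leI mult_left_mono) auto
      also have "\<dots> = ennreal (2 * J * C\<^sub>d / v * m (ball x r))" by (simp add: mult.assoc)
      also have "\<dots> \<le> ennreal (\<beta> * m (ball x r))" unfolding \<beta>_def
        using \<beta>1 by (intro ennreal_leI mult_right_mono) auto
      finally show ?thesis .
    qed
  qed
qed

section \<open>Stopping balls and exponential integrability\<close>

lemma avg_nested_ball:
  assumes b: "integrable M b"
    and osc: "\<And>x r. 0 < r \<Longrightarrow> (\<integral>\<^sup>+y\<in>ball x r. ennreal \<bar>b y - avg b x r\<bar> \<partial>M) \<le> ennreal (\<beta> * m (ball x r))"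
    and \<beta>: "0 \<le> \<beta>" and r: "0 < r" "0 < s" and sub: "ball x r \<subseteq> ball y s" and C: "m (ball y s) \<le> C * m (ball x r)"
  shows "\<bar>avg b x r - avg b y s\<bar> \<le> \<beta> * C"
proof -
  have "\<bar>avg b x r - avg b y s\<bar> * m (ball x r) \<le> \<beta> * m (ball y s)"
    using \<beta> by (intro avg_deviation_le[OF b r(1) sub _ osc[OF r(2)]]) auto
  also have "\<dots> \<le> \<beta> * (C * m (ball x r))" using C \<beta> by (intro mult_left_mono) auto
  finally have "\<bar>avg b x r - avg b y s\<bar> * m (ball x r) \<le> (\<beta> * C) * m (ball x r)" by (simp add: mult.assoc)
  then show ?thesis using measure_ball_pos[OF r(1), of x] by simp
qed

text \<open>Once this is established, the estimates use b only through this condition; the absolute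
  value controls both signs of the deviation at once.\<close>

definition exp_oscillation_bound :: "('a \<Rightarrow> real) \<Rightarrow> real \<Rightarrow> real \<Rightarrow> bool" where
  "exp_oscillation_bound b \<kappa> C \<longleftrightarrow> integrable M b \<and>
     (\<forall>x r. 0 < r \<longrightarrow> (\<integral>\<^sup>+y\<in>ball x r. ennreal (exp (\<kappa> * \<bar>b y - avg b x r\<bar>)) \<partial>M) \<le> ennreal (C * m (ball x r)))"

text \<open>One generation of the Calderon--Zygmund argument. The bound on the averages makes the
  step repeatable inside each ball, the factor 1/2 makes the repetition converge, and overlapping
  balls are counted separately in the sum.\<close>

definition bad_set_cover :: "('a \<Rightarrow> real) \<Rightarrow> real \<Rightarrow> 'a \<Rightarrow> real \<Rightarrow> 'a set \<Rightarrow> ('a \<Rightarrow> real) \<Rightarrow> bool" where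
  "bad_set_cover b L x r G \<rho> \<longleftrightarrow> countable G \<and> (\<forall>y\<in>G. 0 < \<rho> y \<and> \<bar>avg b y (\<rho> y) - avg b x r\<bar> \<le> L) \<and>
     (AE z in M. z \<in> ball x r \<longrightarrow> L < \<bar>b z - avg b x r\<bar> \<longrightarrow> (\<exists>y\<in>G. z \<in> ball y (\<rho> y))) \<and>
     (\<integral>\<^sup>+y. emeasure M (ball y (\<rho> y)) \<partial>count_space G) \<le> ennreal (m (ball x r) / 2)"

text \<open>Stopping near the largest radius at which the average of
  \<open>\<bar>b - avg b x r\<bar>\<close> exceeds L gives disjoint balls with large integrals,
  hence of small total measure, while their dilates are beyond the stopping radius and have
  controlled averages.\<close>

lemma Calderon_Zygmund_cover:
  assumes b: "integrable M b" and \<beta>: "0 < \<beta>"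
    and osc: "\<And>x r. 0 < r \<Longrightarrow> (\<integral>\<^sup>+y\<in>ball x r. ennreal \<bar>b y - avg b x r\<bar> \<partial>M) \<le> ennreal (\<beta> * m (ball x r))"
  obtains L where "0 < L" "\<And>x r. 0 < r \<Longrightarrow> \<exists>G \<rho>. bad_set_cover b L x r G \<rho>"
proof -
  have bm[measurable]: "b \<in> borel_measurable M" using b by simp
  define k where "k = 5 * qK ^ 3"
  have K: "1 \<le> qK" by (rule qK_ge_1)
  have k: "5 \<le> k" using K by (simp add: k_def one_le_power)
  \<comment> \<open>With this factor \<open>ball x (k1 * r)\<close> contains every ball of radius up
    to \<open>k * r\<close> centred in \<open>ball x r\<close>, in particular all dilated stopping
    balls.\<close>
  define k1 where "k1 = qK * (1 + k)"
  have k1: "k \<le> k1" "1 + k \<le> k1" "1 \<le> k1"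
  proof -
    have "1 * (1 + k) \<le> qK * (1 + k)" using K k by (intro mult_right_mono) auto
    then have "1 + k \<le> k1" by (simp only: k1_def mult_1_left)
    then show "k \<le> k1" "1 + k \<le> k1" "1 \<le> k1" using k by auto
  qed
  obtain C0 where C0: "1 \<le> C0" "\<And>x y r. x \<in> ball y r \<Longrightarrow> m (ball y r) \<le> C0 * m (ball x r)"
    by (rule ball_measure_le_center_in) blast
  obtain C1 where C1: "1 \<le> C1" "\<And>x r. 0 < r \<Longrightarrow> m (ball x (k1 * r)) \<le> C1 * m (ball x r)"
    using dilation_bound[of k1] by blast
  obtain CM where CM: "1 \<le> CM" "\<And>x r. 0 < r \<Longrightarrow> m (ball x (k * r)) \<le> CM * m (ball x r)"
    using dilation_bound[of k] by blast
  \<comment> \<open>The first entry bounds the averages over balls with radii between r and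
    \<open>k * r\<close>; the second makes the total measure of the dilated stopping balls at most
    half that of \<open>ball x r\<close>.\<close>
  define L where "L = max (\<beta> * (C1 * C0) + \<beta> * C1) (2 * CM * (\<beta> * C1 + \<beta> * C1 * C1))"
  have C10: "1 \<le> C1 * C0" using C0 C1 mult_mono[of 1 C1 1 C0] by auto
  have "0 < \<beta> * (C1 * C0) + \<beta> * C1"
    using mult_pos_pos[OF \<beta>, of "C1 * C0"] mult_pos_pos[OF \<beta>, of C1] C10 C1(1) by linarith
  then have L: "0 < L" by (simp add: L_def)
  show thesis
  proof
    show "0 < L" by (rule L)
    fix x and r :: real assume r: "0 < r"
    define a where "a = avg b x r"
    define B1 where "B1 = ball x (k1 * r)"
    have rk: "0 < k1 * r" "r \<le> k1 * r" using k1 r by (auto simp: mult_le_cancel_right1)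
    have sub1: "ball z \<rho> \<subseteq> B1" if z: "z \<in> ball x r" "\<rho> \<le> k * r" for z \<rho>
    proof
      fix u assume "u \<in> ball z \<rho>"
      then have "d x z + d z u < r + k * r" using z by (auto simp: mem_ball)
      then have "qK * (d x z + d z u) < qK * (r + k * r)" using K by (intro mult_strict_left_mono) auto
      then show "u \<in> B1" using qd_triangle[of x u z] by (simp add: B1_def mem_ball k1_def algebra_simps)
    qed
    have a1: "\<bar>a - avg b x (k1 * r)\<bar> \<le> \<beta> * C1"
      unfolding a_def using \<beta> rk r C1(2)[OF r] ball_mono[OF rk(2), of x]
      by (intro avg_nested_ball[OF b osc]) auto
    have large: "\<bar>avg b z \<rho> - a\<bar> \<le> L" if z: "z \<in> ball x r" "r \<le> \<rho>" "\<rho> \<le> k * r" for z \<rho>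
    proof -
      have "m B1 \<le> C1 * m (ball x r)" unfolding B1_def by (rule C1(2)[OF r])
      also have "\<dots> \<le> C1 * (C0 * m (ball z r))" using C0(2)[OF z(1)] C1 by (intro mult_left_mono) auto
      also have "\<dots> \<le> C1 * (C0 * m (ball z \<rho>))" using C0 C1 z
        by (intro mult_left_mono finite_measure_mono ball_mono) auto
      finally have "m (ball x (k1 * r)) \<le> (C1 * C0) * m (ball z \<rho>)" by (simp add: B1_def)
      then have "\<bar>avg b z \<rho> - avg b x (k1 * r)\<bar> \<le> \<beta> * (C1 * C0)"
        using \<beta> rk r z sub1[OF z(1,3)] by (intro avg_nested_ball[OF b osc]) (auto simp: B1_def)
      then show ?thesis using a1 by (simp add: L_def)
    qed
    have IB1: "(\<integral>\<^sup>+y\<in>B1. ennreal \<bar>b y - a\<bar> \<partial>M) \<le> ennreal ((\<beta> * C1 + \<beta> * C1 * C1) * m (ball x r))"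
    proof -
      have "(\<integral>\<^sup>+y\<in>B1. ennreal \<bar>b y - a\<bar> \<partial>M)
        \<le> (\<integral>\<^sup>+y. ennreal \<bar>b y - avg b x (k1 * r)\<bar> * indicator B1 y + ennreal (\<beta> * C1) * indicator B1 y \<partial>M)"
        using a1 \<beta> C1 by (intro nn_integral_mono) (auto simp: indicator_def simp flip: ennreal_plus intro!: ennreal_leI)
      also have "\<dots> = (\<integral>\<^sup>+y\<in>B1. ennreal \<bar>b y - avg b x (k1 * r)\<bar> \<partial>M) + ennreal (\<beta> * C1) * emeasure M B1"
        unfolding B1_def by (simp add: nn_integral_add nn_integral_cmult_indicator)
      also have "\<dots> \<le> ennreal (\<beta> * m B1) + ennreal (\<beta> * C1) * emeasure M B1"
        unfolding B1_def by (intro add_mono osc rk order_refl)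
      also have "\<dots> = ennreal ((\<beta> + \<beta> * C1) * m B1)" using \<beta> C1
        by (simp add: emeasure_eq_measure distrib_right flip: ennreal_mult ennreal_plus)
      also have "\<dots> \<le> ennreal ((\<beta> + \<beta> * C1) * (C1 * m (ball x r)))" unfolding B1_def
        using \<beta> C1 r by (intro ennreal_leI mult_left_mono) auto
      finally show ?thesis by (simp add: algebra_simps)
    qed
    define high where "high z s \<longleftrightarrow> ennreal (L * m (ball z s)) < (\<integral>\<^sup>+y\<in>ball z s. ennreal \<bar>b y - a\<bar> \<partial>M)" for z s
    define A where "A = {z\<in>ball x r. \<exists>s. 0 < s \<and> s \<le> r \<and> high z s}"
    \<comment> \<open>A largest stopping radius need not exist. A radius above half the supremum
      serves: from twice its size up to r no radius is high.\<close>
    have "\<exists>s. 0 < s \<and> s \<le> r \<and> high z s \<and> (\<forall>s'. 2 * s \<le> s' \<longrightarrow> s' \<le> r \<longrightarrow> \<not> high z s')" if z: "z \<in> A" for z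
    proof -
      define S where "S = {s. 0 < s \<and> s \<le> r \<and> high z s}"
      have S: "S \<noteq> {}" "bdd_above S" using z by (auto simp: S_def A_def intro!: bdd_aboveI[of _ r])
      obtain s0 where s0: "s0 \<in> S" using S by blast
      then have "s0 \<le> Sup S" using S by (intro cSup_upper) auto
      then have "0 < Sup S" using s0 by (auto simp: S_def)
      then have "Sup S / 2 < Sup S" by simp
      then obtain s where s: "s \<in> S" "Sup S / 2 < s" using less_cSup_iff[OF S] by blast
      have "\<not> high z s'" if "2 * s \<le> s'" "s' \<le> r" for s'
      proof
        assume "high z s'"
        moreover have "0 < s'" using that s by (auto simp: S_def)
        ultimately have "s' \<le> Sup S" using that S by (intro cSup_upper) (auto simp: S_def)
        then show False using s that by simp
      qed
      then show ?thesis using s by (auto simp: S_def)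
    qed
    then obtain s where s: "\<And>z. z \<in> A \<Longrightarrow> 0 < s z" "\<And>z. z \<in> A \<Longrightarrow> s z \<le> r" "\<And>z. z \<in> A \<Longrightarrow> high z (s z)"
      "\<And>z s'. z \<in> A \<Longrightarrow> 2 * s z \<le> s' \<Longrightarrow> s' \<le> r \<Longrightarrow> \<not> high z s'"
      by metis
    obtain G where G: "G \<subseteq> A" "disjoint_family_on (\<lambda>x. ball x (s x)) G"
      "\<And>x. x \<in> A \<Longrightarrow> \<exists>y\<in>G. ball x (s x) \<inter> ball y (s y) \<noteq> {} \<and> s x \<le> 2 * s y"
      by (rule vitali_covering[of A s r, OF s(1,2)]) blast+
    have cG: "countable G"
      by (rule countable_disjoint_family_measure_pos[OF G(2)]) (use G(1) s(1) measure_ball_pos in auto)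
    define \<rho> where "\<rho> y = k * s y" for y
    show "\<exists>G \<rho>. bad_set_cover b L x r G \<rho>"
      unfolding bad_set_cover_def
    proof (intro exI[of _ G] exI[of _ \<rho>] conjI ballI)
      show "countable G" by (rule cG)
    next
      fix y assume "y \<in> G"
      then have y: "y \<in> A" "y \<in> ball x r" using G(1) by (auto simp: A_def)
      show \<rho>0: "0 < \<rho> y" using s(1)[OF y(1)] k by (simp add: \<rho>_def)
      have le: "\<rho> y \<le> k * r" using s(2)[OF y(1)] k by (simp add: \<rho>_def)
      have "2 * s y \<le> \<rho> y" using s(1)[OF y(1)] k by (simp add: \<rho>_def mult_right_mono)
      \<comment> \<open>The dilated radius either is at most r, and then lies beyond the stopping
        radius, or is between r and \<open>k * r\<close>, where \<open>large\<close>
        applies.\<close>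
      show "\<bar>avg b y (\<rho> y) - avg b x r\<bar> \<le> L"
      proof (cases "\<rho> y \<le> r")
        case True
        have "\<not> high y (\<rho> y)" by (rule s(4)[OF y(1) \<open>2 * s y \<le> \<rho> y\<close> True])
        then have "\<bar>avg b y (\<rho> y) - a\<bar> * m (ball y (\<rho> y)) \<le> L * m (ball y (\<rho> y))"
          using L by (intro avg_deviation_le[OF b \<rho>0 order_refl]) (auto simp: high_def not_less)
        then show ?thesis using measure_ball_pos[OF \<rho>0, of y] by (simp add: a_def)
      next
        case False
        then show ?thesis using large[OF y(2) _ le] by (simp add: a_def)
      qed
    next
      show "AE z in M. z \<in> ball x r \<longrightarrow> L < \<bar>b z - avg b x r\<bar> \<longrightarrow> (\<exists>y\<in>G. z \<in> ball y (\<rho> y))"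
        using Lebesgue_points[OF b]
      proof eventually_elim
        case (elim z)
        show ?case
        proof (intro impI)
          assume z: "z \<in> ball x r" "L < \<bar>b z - avg b x r\<bar>"
          have "z \<in> A"
          proof (rule ccontr)
            assume "z \<notin> A"
            then have low: "\<not> high z s" if "0 < s" "s \<le> r" for s using that z by (auto simp: A_def)
            \<comment> \<open>If no small ball around z were high, the Lebesgue point property would
              force \<open>\<bar>b z - a\<bar> \<le> e + L\<close>, but e is only half the excess of
              \<open>\<bar>b z - a\<bar>\<close> over L.\<close>
            define e where "e = (\<bar>b z - a\<bar> - L) / 2"
            have e: "0 < e" using z by (simp add: e_def a_def)
            then obtain R where R: "0 < R" "\<And>r. 0 < r \<Longrightarrow> r \<le> R \<Longrightarrow>
                (\<integral>\<^sup>+y\<in>ball z r. ennreal \<bar>b y - b z\<bar> \<partial>M) \<le> ennreal (e * m (ball z r))" using elim by blast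
            define t where "t = min R r"
            have t: "0 < t" "t \<le> R" "t \<le> r" using R r by (auto simp: t_def)
            have pos: "0 < m (ball z t)" by (rule measure_ball_pos[OF t(1)])
            have "ennreal (\<bar>b z - a\<bar> * m (ball z t)) = (\<integral>\<^sup>+y. ennreal \<bar>b z - a\<bar> * indicator (ball z t) y \<partial>M)"
              by (simp add: nn_integral_cmult_indicator emeasure_eq_measure ennreal_mult)
            also have "\<dots> \<le> (\<integral>\<^sup>+y. ennreal \<bar>b y - b z\<bar> * indicator (ball z t) y + ennreal \<bar>b y - a\<bar> * indicator (ball z t) y \<partial>M)"
              by (intro nn_integral_mono) (auto simp: indicator_def simp flip: ennreal_plus intro!: ennreal_leI)
            also have "\<dots> = (\<integral>\<^sup>+y\<in>ball z t. ennreal \<bar>b y - b z\<bar> \<partial>M) + (\<integral>\<^sup>+y\<in>ball z t. ennreal \<bar>b y - a\<bar> \<partial>M)"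
              by (simp add: nn_integral_add)
            also have "\<dots> \<le> ennreal (e * m (ball z t)) + ennreal (L * m (ball z t))"
              using low[OF t(1,3)] by (intro add_mono R(2) t) (auto simp: high_def not_less)
            also have "\<dots> = ennreal ((e + L) * m (ball z t))" using e L by (simp add: distrib_right flip: ennreal_plus)
            finally have "\<bar>b z - a\<bar> * m (ball z t) \<le> (e + L) * m (ball z t)" using e L by (simp add: ennreal_le_iff)
            then have "\<bar>b z - a\<bar> \<le> e + L" using pos by simp
            then show False using e by (simp add: e_def field_simps)
          qed
          then obtain y where y: "y \<in> G" "ball z (s z) \<inter> ball y (s y) \<noteq> {}" "s z \<le> 2 * s y" using G(3) by blast
          have "z \<in> ball z (s z)" using s(1)[OF \<open>z \<in> A\<close>] by (simp add: mem_ball)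
          then show "\<exists>y\<in>G. z \<in> ball y (\<rho> y)" using ball_engulf[OF y(2,3)] y(1) by (auto simp: \<rho>_def k_def)
        qed
      qed
    next
      have "(\<integral>\<^sup>+y. ennreal L * emeasure M (ball y (\<rho> y)) \<partial>count_space G)
          \<le> (\<integral>\<^sup>+y. ennreal CM * (\<integral>\<^sup>+z\<in>ball y (s y). ennreal \<bar>b z - a\<bar> \<partial>M) \<partial>count_space G)"
      proof (rule nn_integral_mono)
        fix y assume "y \<in> space (count_space G)"
        then have y: "y \<in> A" using G(1) by auto
        have "ennreal L * emeasure M (ball y (\<rho> y)) \<le> ennreal (CM * (L * m (ball y (s y))))"
          using CM(2)[OF s(1)[OF y], of y] L by (auto simp: emeasure_eq_measure \<rho>_def simp flip: ennreal_mult intro!: ennreal_leI)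
        also have "\<dots> \<le> ennreal CM * (\<integral>\<^sup>+z\<in>ball y (s y). ennreal \<bar>b z - a\<bar> \<partial>M)"
          using s(3)[OF y] CM L by (subst ennreal_mult) (auto simp: high_def intro!: mult_left_mono)
        finally show "ennreal L * emeasure M (ball y (\<rho> y)) \<le> ennreal CM * (\<integral>\<^sup>+z\<in>ball y (s y). ennreal \<bar>b z - a\<bar> \<partial>M)" .
      qed
      also have "\<dots> = ennreal CM * (\<integral>\<^sup>+y. (\<integral>\<^sup>+z\<in>ball y (s y). ennreal \<bar>b z - a\<bar> \<partial>M) \<partial>count_space G)"
        by (simp add: nn_integral_cmult)
      also have "(\<integral>\<^sup>+y. (\<integral>\<^sup>+z\<in>ball y (s y). ennreal \<bar>b z - a\<bar> \<partial>M) \<partial>count_space G)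
          \<le> (\<integral>\<^sup>+z. ennreal \<bar>b z - a\<bar> * indicator B1 z \<partial>M)"
      proof (rule nn_integral_disjoint_family_le[OF cG G(2)])
        fix y assume y: "y \<in> G"
        have "s y \<le> r" using s(2)[of y] G(1) y by auto
        also have "r \<le> k * r" using k r by (simp add: mult_le_cancel_right1)
        finally have "s y \<le> k * r" .
        then show "ball y (s y) \<subseteq> B1" using y G(1) by (intro sub1) (auto simp: A_def)
      qed auto
      also note IB1
      finally have "ennreal L * (\<integral>\<^sup>+y. emeasure M (ball y (\<rho> y)) \<partial>count_space G)
          \<le> ennreal CM * ennreal ((\<beta> * C1 + \<beta> * C1 * C1) * m (ball x r))"
        by (simp add: nn_integral_cmult mult_left_mono)
      also have "\<dots> = ennreal (CM * (\<beta> * C1 + \<beta> * C1 * C1) * m (ball x r))"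
        using CM C1 \<beta> by (simp add: mult.assoc flip: ennreal_mult)
      also have "\<dots> \<le> ennreal (L * (m (ball x r) / 2))"
      proof (rule ennreal_leI)
        have "2 * CM * (\<beta> * C1 + \<beta> * C1 * C1) * (m (ball x r) / 2) \<le> L * (m (ball x r) / 2)"
          by (rule mult_right_mono) (auto simp: L_def)
        then show "CM * (\<beta> * C1 + \<beta> * C1 * C1) * m (ball x r) \<le> L * (m (ball x r) / 2)" by simp
      qed
      also have "\<dots> = ennreal L * ennreal (m (ball x r) / 2)" by (rule ennreal_mult') (use L in simp)
      finally show "(\<integral>\<^sup>+y. emeasure M (ball y (\<rho> y)) \<partial>count_space G) \<le> ennreal (m (ball x r) / 2)"
        by (rule ennreal_mult_le_mult_iff[THEN iffD1, rotated 2]) (use L in auto)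
    qed
  qed
qed

text \<open>Each generation of stopping balls halves the measure and shifts the reference average by
  at most L, so the set of deviation beyond \<open>n * L\<close> decays like 2^-n; a small
  exponential rate is summable against this.\<close>

lemma John_Nirenberg:
  assumes "b \<in> BMO M d"
  obtains \<kappa> C where "0 < \<kappa>" "1 \<le> C" "exp_oscillation_bound b \<kappa> C"
proof -
  obtain \<beta> where \<beta>: "0 < \<beta>" and b: "integrable M b"
    and osc: "\<And>x r. 0 < r \<Longrightarrow> (\<integral>\<^sup>+y\<in>ball x r. ennreal \<bar>b y - avg b x r\<bar> \<partial>M) \<le> ennreal (\<beta> * m (ball x r))"
    by (rule BMO_oscillation[OF assms]) blast
  obtain L where L: "0 < L" and cover: "\<And>x r. 0 < r \<Longrightarrow> \<exists>G \<rho>. bad_set_cover b L x r G \<rho>"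
    by (rule Calderon_Zygmund_cover[OF b \<beta> osc]) blast+
  have bm[measurable]: "b \<in> borel_measurable M" using b by simp
  define F where "F n x r = {z\<in>space M. z \<in> ball x r \<and> real n * L < \<bar>b z - avg b x r\<bar>}" for n x r
  have F[measurable]: "F n x r \<in> sets M" for n x r unfolding F_def by measurable
  have decay: "emeasure M (F n x r) \<le> ennreal ((1 / 2) ^ n * m (ball x r))" if "0 < r" for n x r
    using that
  proof (induction n arbitrary: x r)
    case 0
    have "emeasure M (F 0 x r) \<le> emeasure M (ball x r)" by (intro emeasure_mono) (auto simp: F_def)
    then show ?case by (simp add: emeasure_eq_measure)
  next
    case (Suc n)
    obtain G \<rho> where G: "countable G" "\<And>y. y \<in> G \<Longrightarrow> 0 < \<rho> y" "\<And>y. y \<in> G \<Longrightarrow> \<bar>avg b y (\<rho> y) - avg b x r\<bar> \<le> L"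
      "AE z in M. z \<in> ball x r \<longrightarrow> L < \<bar>b z - avg b x r\<bar> \<longrightarrow> (\<exists>y\<in>G. z \<in> ball y (\<rho> y))"
      "(\<integral>\<^sup>+y. emeasure M (ball y (\<rho> y)) \<partial>count_space G) \<le> ennreal (m (ball x r) / 2)"
      using cover[OF Suc.prems, of x] unfolding bad_set_cover_def by blast
    have "emeasure M (F (Suc n) x r) = (\<integral>\<^sup>+z. indicator (F (Suc n) x r) z \<partial>M)" by simp
    also have "\<dots> \<le> (\<integral>\<^sup>+z. (\<integral>\<^sup>+y. indicator (F n y (\<rho> y)) z \<partial>count_space G) \<partial>M)"
      using G(4)
    proof (intro nn_integral_mono_AE, eventually_elim)
      case (elim z)
      show ?case
      proof (cases "z \<in> F (Suc n) x r")
        case True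
        then have z: "z \<in> ball x r" "real (Suc n) * L < \<bar>b z - avg b x r\<bar>" by (auto simp: F_def)
        have "L \<le> real (Suc n) * L" using L by (simp add: distrib_right)
        then obtain y where y: "y \<in> G" "z \<in> ball y (\<rho> y)" using elim z by force
        \<comment> \<open>Replacing the average over \<open>ball x r\<close> by the one over a
          stopping ball uses up one L and leaves \<open>real n * L\<close> for the induction
          hypothesis.\<close>
        have "real n * L < \<bar>b z - avg b y (\<rho> y)\<bar>" using z(2) G(3)[OF y(1)] by (simp add: distrib_right)
        then have zF: "z \<in> F n y (\<rho> y)" using y by (simp add: F_def space_UNIV)
        have "(1 :: ennreal) = (\<integral>\<^sup>+y'. indicator {y} y' \<partial>count_space G)" using y
          by (subst nn_integral_indicator) (auto simp: emeasure_count_space_finite)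
        also have "\<dots> \<le> (\<integral>\<^sup>+y. indicator (F n y (\<rho> y)) z \<partial>count_space G)"
          using zF by (intro nn_integral_mono) (auto simp: indicator_def)
        finally show ?thesis using True by simp
      qed simp
    qed
    also have "\<dots> = (\<integral>\<^sup>+y. (\<integral>\<^sup>+z. indicator (F n y (\<rho> y)) z \<partial>M) \<partial>count_space G)"
      by (rule nn_integral_count_space_nn_integral[OF G(1)]) measurable
    also have "\<dots> \<le> (\<integral>\<^sup>+y. ennreal ((1 / 2) ^ n) * emeasure M (ball y (\<rho> y)) \<partial>count_space G)"
    proof (rule nn_integral_mono)
      fix y assume "y \<in> space (count_space G)"
      then have "0 < \<rho> y" using G(2) by simp
      from Suc.IH[OF this, of y] show "(\<integral>\<^sup>+z. indicator (F n y (\<rho> y)) z \<partial>M) \<le> ennreal ((1 / 2) ^ n) * emeasure M (ball y (\<rho> y))"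
        by (simp add: emeasure_eq_measure ennreal_mult)
    qed
    also have "\<dots> = ennreal ((1 / 2) ^ n) * (\<integral>\<^sup>+y. emeasure M (ball y (\<rho> y)) \<partial>count_space G)"
      by (simp add: nn_integral_cmult)
    also have "\<dots> \<le> ennreal ((1 / 2) ^ n) * ennreal (m (ball x r) / 2)" by (intro mult_left_mono G(5)) simp
    also have "\<dots> = ennreal ((1 / 2) ^ Suc n * m (ball x r))" by (simp flip: ennreal_mult)
    finally show ?case .
  qed
  \<comment> \<open>With \<open>exp (\<kappa> * L) = 3 / 2\<close> the series below has ratio 3/2 *
    1/2 = 3/4.\<close>
  define \<kappa> where "\<kappa> = ln (3 / 2) / L"
  have \<kappa>: "0 < \<kappa>" "exp (\<kappa> * L) = 3 / 2" using L by (auto simp: \<kappa>_def)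
  have "(\<integral>\<^sup>+y\<in>ball x r. ennreal (exp (\<kappa> * \<bar>b y - avg b x r\<bar>)) \<partial>M) \<le> ennreal (8 * m (ball x r))" if r: "0 < r" for x r
  proof -
    have "(\<integral>\<^sup>+y\<in>ball x r. ennreal (exp (\<kappa> * \<bar>b y - avg b x r\<bar>)) \<partial>M)
      \<le> (\<integral>\<^sup>+y. ennreal 1 * indicator (ball x r) y + (\<Sum>n. ennreal ((3 / 2) ^ Suc n) * indicator (F n x r) y) \<partial>M)"
    proof (rule nn_integral_mono)
      fix y
      show "ennreal (exp (\<kappa> * \<bar>b y - avg b x r\<bar>)) * indicator (ball x r) y
         \<le> ennreal 1 * indicator (ball x r) y + (\<Sum>n. ennreal ((3 / 2) ^ Suc n) * indicator (F n x r) y)"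
      proof (cases "y \<in> ball x r \<and> b y \<noteq> avg b x r")
        case True
        define u where "u = \<bar>b y - avg b x r\<bar> / L"
        have u: "0 < u" using True L by (simp add: u_def)
        \<comment> \<open>n is the index with \<open>n < u \<le> n + 1\<close>, strict on the left
          because \<open>F n\<close> is defined by a strict inequality. Points with u = 0 have no
          such n and are covered by the separate summand 1.\<close>
        define n where "n = nat (\<lceil>u\<rceil> - 1)"
        have n: "real n < u" "u \<le> real (Suc n)" using u by (auto simp: n_def) linarith+
        have "y \<in> F n x r" using True n(1) L by (simp add: F_def space_UNIV u_def field_simps)
        have "\<kappa> * \<bar>b y - avg b x r\<bar> = \<kappa> * L * u" using L by (simp add: u_def)
        also have "\<dots> \<le> \<kappa> * L * real (Suc n)" using n(2) \<kappa> L by (intro mult_left_mono) auto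
        finally have "exp (\<kappa> * \<bar>b y - avg b x r\<bar>) \<le> exp (real (Suc n) * (\<kappa> * L))" by (simp add: mult.commute)
        also have "\<dots> = (3 / 2) ^ Suc n" by (simp only: exp_of_nat_mult \<kappa>(2))
        finally have "ennreal (exp (\<kappa> * \<bar>b y - avg b x r\<bar>)) \<le> ennreal ((3 / 2) ^ Suc n)" by (rule ennreal_leI)
        also have "\<dots> = (\<Sum>i\<in>{n}. ennreal ((3 / 2) ^ Suc i) * indicator (F i x r) y)" using \<open>y \<in> F n x r\<close> by simp
        also have "\<dots> \<le> (\<Sum>n. ennreal ((3 / 2) ^ Suc n) * indicator (F n x r) y)" by (intro sum_le_suminf) auto
        finally show ?thesis using True by (simp add: add_increasing)
      qed (auto simp: indicator_def)
    qed
    also have "\<dots> = ennreal 1 * emeasure M (ball x r) + (\<Sum>n. ennreal ((3 / 2) ^ Suc n) * emeasure M (F n x r))"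
      by (subst nn_integral_add) (auto simp: nn_integral_suminf nn_integral_cmult_indicator)
    also have "\<dots> \<le> ennreal 1 * emeasure M (ball x r) + (\<Sum>n. ennreal ((3 / 2) ^ Suc n * ((1 / 2) ^ n * m (ball x r))))"
    proof (intro add_left_mono suminf_le)
      fix n
      have "ennreal ((3 / 2) ^ Suc n) * emeasure M (F n x r)
          \<le> ennreal ((3 / 2) ^ Suc n) * ennreal ((1 / 2) ^ n * m (ball x r))"
        by (intro mult_left_mono decay[OF r]) simp
      then show "ennreal ((3 / 2) ^ Suc n) * emeasure M (F n x r)
          \<le> ennreal ((3 / 2) ^ Suc n * ((1 / 2) ^ n * m (ball x r)))"
        by (subst ennreal_mult) auto
    qed auto
    also have "(\<Sum>n. ennreal ((3 / 2) ^ Suc n * ((1 / 2) ^ n * m (ball x r)))) = ennreal (6 * m (ball x r))"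
    proof -
      have "(\<lambda>n. (3 / 2 * m (ball x r)) * (3 / 4) ^ n) sums ((3 / 2 * m (ball x r)) * (1 / (1 - 3 / 4)))"
        by (intro sums_mult geometric_sums) simp
      then have "(\<lambda>n. (3 / 2) ^ Suc n * ((1 / 2) ^ n * m (ball x r))) sums (6 * m (ball x r))"
        by (simp add: power_divide mult.commute mult.left_commute flip: power_mult_distrib)
      then show ?thesis by (subst suminf_ennreal2) (auto simp: sums_iff)
    qed
    also have "ennreal 1 * emeasure M (ball x r) + ennreal (6 * m (ball x r)) = ennreal (7 * m (ball x r))"
      by (simp add: emeasure_eq_measure flip: ennreal_plus)
    also have "\<dots> \<le> ennreal (8 * m (ball x r))" by (intro ennreal_leI) simp
    finally show ?thesis .
  qed
  then have "exp_oscillation_bound b \<kappa> 8" using b by (simp add: exp_oscillation_bound_def)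
  then show thesis using that[OF \<kappa>(1), of 8] by simp
qed

end

section \<open>Weighted maximal functions on Morrey spaces\<close>

context nondegenerate_homogeneous_space
begin

text \<open>H may depend on the ball because the majorants constructed below split a function at the
  ball in question. K enters as \<open>K powr s\<close> so that it plays the part of the Morrey norm
  itself.\<close>

definition ball_majorized :: "('a \<Rightarrow> ennreal) \<Rightarrow> real \<Rightarrow> real \<Rightarrow> real \<Rightarrow> 'a \<Rightarrow> real \<Rightarrow> bool" where
  "ball_majorized g s \<nu> K x r \<longleftrightarrow> (\<exists>H \<in> borel_measurable M. (\<forall>y. 0 \<le> H y) \<and>
     (AE y in M. y \<in> ball x r \<longrightarrow> g y \<le> ennreal (H y)) \<and>
     (\<integral>\<^sup>+y\<in>ball x r. ennreal (H y powr s) \<partial>M) \<le> ennreal (K powr s * m (ball x r) powr \<nu>))"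

definition morrey_majorized :: "('a \<Rightarrow> ennreal) \<Rightarrow> real \<Rightarrow> real \<Rightarrow> real \<Rightarrow> bool" where
  "morrey_majorized g s \<nu> K \<longleftrightarrow> (\<forall>x r. 0 < r \<longrightarrow> ball_majorized g s \<nu> K x r)"

lemma ball_majorizedE:
  assumes "ball_majorized g s \<nu> K x r"
  obtains H where "H \<in> borel_measurable M" "\<And>y. 0 \<le> H y" "AE y in M. y \<in> ball x r \<longrightarrow> g y \<le> ennreal (H y)"
    "(\<integral>\<^sup>+y\<in>ball x r. ennreal (H y powr s) \<partial>M) \<le> ennreal (K powr s * m (ball x r) powr \<nu>)"
  using assms unfolding ball_majorized_def by blast

lemma morrey_majorizedE:
  assumes "morrey_majorized g s \<nu> K" "0 < r"
  obtains H where "H \<in> borel_measurable M" "\<And>y. 0 \<le> H y" "AE y in M. y \<in> ball x r \<longrightarrow> g y \<le> ennreal (H y)"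
    "(\<integral>\<^sup>+y\<in>ball x r. ennreal (H y powr s) \<partial>M) \<le> ennreal (K powr s * m (ball x r) powr \<nu>)"
proof -
  have "ball_majorized g s \<nu> K x r" using assms by (simp add: morrey_majorized_def)
  then show thesis by (rule ball_majorizedE) (rule that)
qed

lemma ball_majorized_mono:
  assumes "ball_majorized g s \<nu> K x r" "\<And>y. h y \<le> g y"
  shows "ball_majorized h s \<nu> K x r"
  using assms(1)
proof (rule ball_majorizedE)
  fix H
  assume H: "H \<in> borel_measurable M" "\<And>y. 0 \<le> H y" "AE y in M. y \<in> ball x r \<longrightarrow> g y \<le> ennreal (H y)"
    "(\<integral>\<^sup>+y\<in>ball x r. ennreal (H y powr s) \<partial>M) \<le> ennreal (K powr s * m (ball x r) powr \<nu>)"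
  have "AE y in M. y \<in> ball x r \<longrightarrow> h y \<le> ennreal (H y)"
    using H(3) by eventually_elim (use assms(2) order_trans in blast)
  then show ?thesis using H unfolding ball_majorized_def by blast
qed

abbreviation exp_integral :: "('a \<Rightarrow> real) \<Rightarrow> real \<Rightarrow> ('a \<Rightarrow> ennreal) \<Rightarrow> 'a \<Rightarrow> real \<Rightarrow> ennreal" where
  "exp_integral b \<kappa> g x r \<equiv> \<integral>\<^sup>+y\<in>ball x r. ennreal (exp (\<kappa> * \<bar>b y - avg b x r\<bar>)) * g y \<partial>M"

text \<open>The outer exponent is signed: \<open>exp (\<sigma> * b x)\<close> is a weight
  independent of the ball, whereas \<open>exp (\<sigma> * \<bar>b x - avg b x r\<bar>)\<close> does
  not factor in this way. The absolute value is recovered later from the two signs of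
  \<open>\<sigma>\<close>.\<close>

definition weighted_maximal :: "('a \<Rightarrow> real) \<Rightarrow> real \<Rightarrow> real \<Rightarrow> real \<Rightarrow> ('a \<Rightarrow> ennreal) \<Rightarrow> 'a \<Rightarrow> ennreal" where
  "weighted_maximal b \<sigma> \<kappa> R g x =
     (SUP r\<in>{0<..R}. ennreal (exp (\<sigma> * (b x - avg b x r))) * exp_integral b \<kappa> g x r / ennreal (m (ball x r)))"

lemma weighted_maximal_le_iff:
  assumes "0 \<le> H"
  shows "weighted_maximal b \<sigma> \<kappa> R g x \<le> ennreal H \<longleftrightarrow>
    (\<forall>r. 0 < r \<and> r \<le> R \<longrightarrow> ennreal (exp (\<sigma> * (b x - avg b x r))) * exp_integral b \<kappa> g x r \<le> ennreal (H * m (ball x r)))"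
proof -
  have "X / ennreal (m (ball x r)) \<le> ennreal H \<longleftrightarrow> X \<le> ennreal (H * m (ball x r))" if r: "0 < r" for X r
  proof
    have pos: "0 < m (ball x r)" by (rule measure_ball_pos[OF r])
    have e: "ennreal (H * m (ball x r)) = ennreal H * ennreal (m (ball x r))" by (rule ennreal_mult) (use assms in auto)
    show "X / ennreal (m (ball x r)) \<le> ennreal H" if "X \<le> ennreal (H * m (ball x r))"
      using that pos unfolding e by (intro divide_le_posI_ennreal) (auto simp: mult.commute)
    show "X \<le> ennreal (H * m (ball x r))" if "X / ennreal (m (ball x r)) \<le> ennreal H"
      unfolding e using that pos by (intro ennreal_le_times_if_divide_le) auto
  qed
  then show ?thesis unfolding weighted_maximal_def SUP_le_iff by auto
qed

lemma avg_affine: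
  assumes b: "integrable M b" and r: "0 < r"
  shows "avg (\<lambda>y. k * (b y - l)) x r = k * (avg b x r - l)"
proof -
  have bB: "set_integrable M (ball x r) b"
    using integrable_mult_indicator[OF ball_sets b] by (simp add: set_integrable_def)
  have lB: "set_integrable M (ball x r) (\<lambda>_. l)"
    using integrable_mult_indicator[OF ball_sets, of "\<lambda>_. l" x r] by (simp add: set_integrable_def)
  have "(LINT y:ball x r|M. k * (b y - l)) = k * ((LINT y:ball x r|M. b y) - l * m (ball x r))"
    using bB lB by (simp add: set_integral_diff set_lebesgue_integral_def[of _ _ "\<lambda>_. l"])
  then show ?thesis using measure_ball_pos[OF r, of x] by (simp add: ball_average_def field_simps)
qed

lemma Jensen_exp:
  assumes f: "integrable M f" and r: "0 < r"
  shows "ennreal (exp (avg f x r) * m (ball x r)) \<le> (\<integral>\<^sup>+y\<in>ball x r. ennreal (exp (f y)) \<partial>M)"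
proof -
  have [measurable]: "f \<in> borel_measurable M" using f by simp
  define A where "A = avg f x r"
  \<comment> \<open>g is the tangent of exp at the average A, evaluated at f and cut off to the
    ball. Its positive part passes to the non-negative integral and still lies below
    \<open>exp (f y)\<close>.\<close>
  define g where "g y = indicator (ball x r) y * (exp A * (f y - (A - 1)))" for y
  have gi: "integrable M g" unfolding g_def
    using integrable_mult_indicator[OF ball_sets, of "\<lambda>y. exp A * (f y - (A - 1))" x r] f by simp
  have "exp A * m (ball x r) = avg (\<lambda>y. exp A * (f y - (A - 1))) x r * m (ball x r)"
    by (simp add: avg_affine[OF f r] A_def[symmetric])
  also have "\<dots> = (LINT y:ball x r|M. exp A * (f y - (A - 1)))"
    using measure_ball_pos[OF r, of x] unfolding ball_average_def by (metis less_irrefl nonzero_eq_divide_eq)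
  also have "\<dots> = (\<integral>y. g y \<partial>M)" unfolding set_lebesgue_integral_def g_def real_scaleR_def ..
  also have "\<dots> \<le> (\<integral>y. max 0 (g y) \<partial>M)" using gi by (intro integral_mono) auto
  finally have "ennreal (exp A * m (ball x r)) \<le> ennreal (\<integral>y. max 0 (g y) \<partial>M)" by (rule ennreal_leI)
  also have "\<dots> = (\<integral>\<^sup>+y. ennreal (max 0 (g y)) \<partial>M)" using gi by (intro nn_integral_eq_integral[symmetric]) auto
  also have "\<dots> \<le> (\<integral>\<^sup>+y\<in>ball x r. ennreal (exp (f y)) \<partial>M)"
  proof (rule nn_integral_mono)
    fix y
    have "exp A * (1 + (f y - A)) \<le> exp A * exp (f y - A)" by (intro mult_left_mono exp_ge_add_one_self) auto
    then have "exp A * (f y - (A - 1)) \<le> exp (f y)" by (simp add: algebra_simps flip: exp_add)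
    then show "ennreal (max 0 (g y)) \<le> ennreal (exp (f y)) * indicator (ball x r) y"
      by (auto simp: g_def indicator_def intro!: ennreal_leI)
  qed
  finally show ?thesis by (simp add: A_def)
qed

lemma exp_oscillation_boundD:
  assumes "exp_oscillation_bound b \<kappa>\<^sub>0 C"
  shows "integrable M b" "b \<in> borel_measurable M"
    "0 < r \<Longrightarrow> \<kappa> \<le> \<kappa>\<^sub>0 \<Longrightarrow> (\<integral>\<^sup>+y\<in>ball x r. ennreal (exp (\<kappa> * \<bar>b y - avg b x r\<bar>)) \<partial>M) \<le> ennreal (C * m (ball x r))"
proof -
  show "integrable M b" "b \<in> borel_measurable M" using assms by (auto simp: exp_oscillation_bound_def)
  assume r: "0 < r" "\<kappa> \<le> \<kappa>\<^sub>0"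
  have "(\<integral>\<^sup>+y\<in>ball x r. ennreal (exp (\<kappa> * \<bar>b y - avg b x r\<bar>)) \<partial>M)
     \<le> (\<integral>\<^sup>+y\<in>ball x r. ennreal (exp (\<kappa>\<^sub>0 * \<bar>b y - avg b x r\<bar>)) \<partial>M)"
    using r by (intro nn_integral_mono mult_right_mono ennreal_leI) (auto intro: mult_right_mono)
  also have "\<dots> \<le> ennreal (C * m (ball x r))" using assms r by (auto simp: exp_oscillation_bound_def)
  finally show "(\<integral>\<^sup>+y\<in>ball x r. ennreal (exp (\<kappa> * \<bar>b y - avg b x r\<bar>)) \<partial>M) \<le> ennreal (C * m (ball x r))" .
qed

text \<open>Jensen's inequality on the smaller ball against exponential integrability on the larger
  one. Averages of b thus drift at most logarithmically in the measure ratio.\<close>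

lemma exp_avg_diff_nested_ball:
  assumes osc: "exp_oscillation_bound b \<kappa>\<^sub>0 C" and C: "0 \<le> C" and \<kappa>: "0 \<le> \<kappa>\<^sub>0"
    and r: "0 < r" "0 < s" and sub: "ball x r \<subseteq> ball y s"
  shows "exp (\<kappa>\<^sub>0 * \<bar>avg b x r - avg b y s\<bar>) * m (ball x r) \<le> C * m (ball y s)"
proof -
  have *: "exp (k * (avg b x r - avg b y s)) * m (ball x r) \<le> C * m (ball y s)" if k: "\<bar>k\<bar> = \<kappa>\<^sub>0" for k
  proof -
    note b = exp_oscillation_boundD(1)[OF osc]
    have "ennreal (exp (k * (avg b x r - avg b y s)) * m (ball x r))
        \<le> (\<integral>\<^sup>+z\<in>ball x r. ennreal (exp (k * (b z - avg b y s))) \<partial>M)"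
      using Jensen_exp[of "\<lambda>z. k * (b z - avg b y s)" r x] b r by (simp add: avg_affine[OF b r(1)])
    also have "\<dots> \<le> (\<integral>\<^sup>+z\<in>ball y s. ennreal (exp (\<kappa>\<^sub>0 * \<bar>b z - avg b y s\<bar>)) \<partial>M)"
    proof (intro nn_integral_mono)
      fix z
      have "k * (b z - avg b y s) \<le> \<bar>k\<bar> * \<bar>b z - avg b y s\<bar>" by (metis abs_ge_self abs_mult)
      then show "ennreal (exp (k * (b z - avg b y s))) * indicator (ball x r) z
         \<le> ennreal (exp (\<kappa>\<^sub>0 * \<bar>b z - avg b y s\<bar>)) * indicator (ball y s) z"
        using k sub by (auto simp: indicator_def intro!: ennreal_leI)
    qed
    also have "\<dots> \<le> ennreal (C * m (ball y s))" using r by (intro exp_oscillation_boundD(3)[OF osc]) auto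
    finally show ?thesis using C by (simp add: ennreal_le_iff)
  qed
  show ?thesis
  proof (cases "avg b y s \<le> avg b x r")
    case True then show ?thesis using *[of \<kappa>\<^sub>0] \<kappa> by simp
  next
    case False
    have "\<kappa>\<^sub>0 * \<bar>avg b x r - avg b y s\<bar> = - \<kappa>\<^sub>0 * (avg b x r - avg b y s)"
      using False by (simp add: abs_if algebra_simps)
    then show ?thesis using *[of "- \<kappa>\<^sub>0"] \<kappa> by (simp only: abs_minus_cancel abs_of_nonneg)
  qed
qed

text \<open>By exponential integrability from above and Jensen's inequality from below, the weight
  of a ball is \<open>exp (\<sigma> * avg b x r) * m (ball x r)\<close> up to a factor between 1 and
  C. In the doubling constant one C is this factor, \<open>C * CM\<close> bounds the change of the
  average, and the last \<open>CM\<close> is the doubling of M.\<close>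

lemma exp_weight_ball_doubling:
  assumes osc: "exp_oscillation_bound b \<kappa>\<^sub>0 C" and C: "1 \<le> C" and CM: "ball_doubling M CM"
    and \<sigma>: "\<bar>\<sigma>\<bar> \<le> \<kappa>\<^sub>0"
  defines "W \<equiv> density M (\<lambda>y. ennreal (exp (\<sigma> * b y)))"
  shows "ball_doubling W ((C * CM)\<^sup>2)"
    and "0 < r \<Longrightarrow> emeasure W (ball x r) \<le> ennreal (C * exp (\<sigma> * avg b x r) * m (ball x r))"
proof -
  note b = exp_oscillation_boundD(1)[OF osc]
  have [measurable]: "b \<in> borel_measurable M" using b by simp
  have sW: "sets W = sets M" by (simp add: W_def)
  have eW: "emeasure W S = (\<integral>\<^sup>+y\<in>S. ennreal (exp (\<sigma> * b y)) \<partial>M)" if "S \<in> sets M" for S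
    unfolding W_def using that by (simp add: emeasure_density)
  show up: "emeasure W (ball x r) \<le> ennreal (C * exp (\<sigma> * avg b x r) * m (ball x r))" if r: "0 < r" for x r
  proof -
    have "emeasure W (ball x r) \<le> (\<integral>\<^sup>+y. ennreal (exp (\<sigma> * avg b x r)) *
        (ennreal (exp (\<bar>\<sigma>\<bar> * \<bar>b y - avg b x r\<bar>)) * indicator (ball x r) y) \<partial>M)"
      unfolding eW[OF ball_sets]
    proof (rule nn_integral_mono)
      fix y
      have "\<sigma> * (b y - avg b x r) \<le> \<bar>\<sigma>\<bar> * \<bar>b y - avg b x r\<bar>" by (metis abs_ge_self abs_mult)
      then have "\<sigma> * b y \<le> \<sigma> * avg b x r + \<bar>\<sigma>\<bar> * \<bar>b y - avg b x r\<bar>" by (simp add: algebra_simps)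
      then show "ennreal (exp (\<sigma> * b y)) * indicator (ball x r) y \<le> ennreal (exp (\<sigma> * avg b x r)) *
        (ennreal (exp (\<bar>\<sigma>\<bar> * \<bar>b y - avg b x r\<bar>)) * indicator (ball x r) y)"
        by (auto simp: indicator_def ennreal_leI simp flip: ennreal_mult exp_add)
    qed
    also have "\<dots> = ennreal (exp (\<sigma> * avg b x r)) * (\<integral>\<^sup>+y\<in>ball x r. ennreal (exp (\<bar>\<sigma>\<bar> * \<bar>b y - avg b x r\<bar>)) \<partial>M)"
      by (rule nn_integral_cmult) measurable
    also have "\<dots> \<le> ennreal (exp (\<sigma> * avg b x r)) * ennreal (C * m (ball x r))"
      using \<sigma> by (intro mult_left_mono exp_oscillation_boundD(3)[OF osc r]) auto
    also have "\<dots> = ennreal (C * exp (\<sigma> * avg b x r) * m (ball x r))"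
      using C by (simp add: mult_ac flip: ennreal_mult)
    finally show ?thesis .
  qed
  have lo: "ennreal (exp (\<sigma> * avg b x r) * m (ball x r)) \<le> emeasure W (ball x r)" if r: "0 < r" for x r
    using Jensen_exp[of "\<lambda>y. \<sigma> * (b y - 0)" r x] b r unfolding eW[OF ball_sets] avg_affine[OF b r] by simp
  have fin: "finite_measure W"
  proof
    have "emeasure W (ball undefined (qdiam d + 1)) < \<infinity>"
      by (rule le_less_trans[OF up]) (use diam_pos in auto)
    then show "emeasure W (space W) \<noteq> \<infinity>" using ball_UNIV[of "qdiam d + 1" undefined] space_UNIV
      by (simp add: W_def)
  qed
  interpret W: finite_measure W by (rule fin)
  show "ball_doubling W ((C * CM)\<^sup>2)"
    unfolding ball_doubling_def
  proof (intro conjI allI impI fin sW)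
    fix x and r :: real assume r: "0 < r"
    have mpos: "0 < m (ball x r)" by (rule measure_ball_pos[OF r])
    have lo': "exp (\<sigma> * avg b x r) * m (ball x r) \<le> measure W (ball x r)"
      using lo[OF r, of x] by (simp add: W.emeasure_eq_measure)
    have "0 < exp (\<sigma> * avg b x r) * m (ball x r)" using mpos by simp
    with lo' show "0 < measure W (ball x r)" by linarith
    define s where "s = 5 * qK ^ 3 * r"
    have "1 \<le> 5 * qK ^ 3" using one_le_power[OF qK_ge_1, of 3] by linarith
    then have "1 * r \<le> 5 * qK ^ 3 * r" using r by (intro mult_right_mono) auto
    then have "r \<le> s" by (simp only: s_def mult_1_left)
    then have s: "0 < s" "r \<le> s" using r by auto
    have CM0: "0 \<le> CM" and mC: "m (ball x s) \<le> CM * m (ball x r)"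
      using ball_doublingD[OF CM r] by (auto simp: s_def)
    have \<kappa>0: "0 \<le> \<kappa>\<^sub>0" using \<sigma> by linarith
    have "exp (\<kappa>\<^sub>0 * \<bar>avg b x r - avg b x s\<bar>) * m (ball x r) \<le> C * m (ball x s)"
      using C r s by (intro exp_avg_diff_nested_ball[OF osc _ \<kappa>0]) (auto intro!: ball_mono)
    also have "\<dots> \<le> C * (CM * m (ball x r))" using C by (intro mult_left_mono mC) auto
    finally have "exp (\<kappa>\<^sub>0 * \<bar>avg b x r - avg b x s\<bar>) \<le> C * CM" using mpos by (simp add: mult.assoc[symmetric])
    moreover have "\<sigma> * (avg b x s - avg b x r) \<le> \<kappa>\<^sub>0 * \<bar>avg b x r - avg b x s\<bar>"
    proof -
      have "\<sigma> * (avg b x s - avg b x r) \<le> \<bar>\<sigma>\<bar> * \<bar>avg b x s - avg b x r\<bar>" by (metis abs_ge_self abs_mult)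
      also have "\<dots> \<le> \<kappa>\<^sub>0 * \<bar>avg b x s - avg b x r\<bar>" using \<sigma> by (rule mult_right_mono) simp
      finally show ?thesis by (simp add: abs_minus_commute)
    qed
    ultimately have e: "exp (\<sigma> * (avg b x s - avg b x r)) \<le> C * CM" by (meson exp_le_cancel_iff order_trans)
    have "measure W (ball x s) \<le> C * exp (\<sigma> * avg b x s) * m (ball x s)"
      using up[OF s(1), of x] C by (simp add: W.emeasure_eq_measure)
    also have "\<dots> = C * exp (\<sigma> * (avg b x s - avg b x r)) * exp (\<sigma> * avg b x r) * m (ball x s)"
      by (simp add: algebra_simps flip: exp_add)
    also have "\<dots> \<le> C * (C * CM) * exp (\<sigma> * avg b x r) * (CM * m (ball x r))"
      using C CM0 e mC by (intro mult_mono mult_nonneg_nonneg) auto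
    also have "\<dots> = (C * CM)\<^sup>2 * (exp (\<sigma> * avg b x r) * m (ball x r))" by (simp add: power2_eq_square)
    also have "\<dots> \<le> (C * CM)\<^sup>2 * measure W (ball x r)" by (intro mult_left_mono lo') auto
    finally show "measure W (ball x (5 * qK ^ 3 * r)) \<le> (C * CM)\<^sup>2 * measure W (ball x r)" by (simp add: s_def)
  qed
qed

text \<open>Comparing \<open>f\<close> with the weight \<open>exp (\<sigma> s b)\<close> turns the exponential factor in front of the averages
  into the density of a doubling measure; Hoelder's inequality with exponent \<open>u\<close> pays for the change
  of measure, because powers of \<open>exp b\<close> are \<open>A\<^sub>p\<close> weights for small exponents.\<close>

lemma weighted_maximal_local:
  assumes osc: "exp_oscillation_bound b \<kappa>\<^sub>0 C" and C: "1 \<le> C" and CM: "ball_doubling M CM"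
    and u: "1 < u" "u < s" "1 / u + 1 / v = 1" and v: "1 < v" and \<sigma>: "\<bar>\<sigma>\<bar> * s \<le> \<kappa>\<^sub>0"
    and \<kappa>: "(\<kappa> + \<bar>\<sigma>\<bar> * (s / u - 1)) * v \<le> \<kappa>\<^sub>0"
    and f[measurable]: "f \<in> borel_measurable M" and f0: "\<And>x. 0 \<le> f x"
    and fin: "(\<integral>\<^sup>+x. ennreal (f x powr s) \<partial>M) < \<infinity>"
  obtains H where "H \<in> borel_measurable M" "\<And>x. 0 \<le> H x"
    "AE x in M. weighted_maximal b \<sigma> \<kappa> R f x \<le> ennreal (H x)"
    "(\<integral>\<^sup>+x. ennreal (H x powr s) \<partial>M) \<le> ennreal (C powr s * (1 + (C * CM)\<^sup>2 * 2 powr (2 * (s / u)) / (1 - 2 powr (1 - s / u)))) *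
        (\<integral>\<^sup>+x. ennreal (f x powr s) \<partial>M)"
proof -
  note b = exp_oscillation_boundD(1)[OF osc]
  have bm[measurable]: "b \<in> borel_measurable M" using b by simp
  have s: "0 < s" "s \<noteq> 0" "1 < s / u" "u \<noteq> 0" using u by auto
  have v0: "v \<noteq> 0" using v by auto
  define W where "W = density M (\<lambda>y. ennreal (exp (\<sigma> * s * b y)))"
  have \<sigma>s: "\<bar>\<sigma> * s\<bar> \<le> \<kappa>\<^sub>0" using \<sigma> s by (simp add: abs_mult)
  have Wd: "ball_doubling W ((C * CM)\<^sup>2)"
    and Wle: "\<And>x r. 0 < r \<Longrightarrow> emeasure W (ball x r) \<le> ennreal (C * exp (\<sigma> * s * avg b x r) * m (ball x r))"
    using exp_weight_ball_doubling[OF osc C CM \<sigma>s] by (auto simp: W_def)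
  \<comment> \<open>The powers are balanced so that \<open>h powr (s / u)\<close> has the same
    integral against W as \<open>f powr s\<close> against M; the maximal theorem is applied to h
    with exponent \<open>s / u > 1\<close>.\<close>
  define F where "F y = f y * exp (- \<sigma> * b y)" for y
  define h where "h y = F y powr u" for y
  have F0: "0 \<le> F y" for y using f0 by (simp add: F_def)
  have mF[measurable]: "F \<in> borel_measurable M" unfolding F_def by measurable
  have mh[measurable]: "h \<in> borel_measurable M" unfolding h_def by measurable
  have hW: "h \<in> borel_measurable W" unfolding W_def by simp
  have hs: "ennreal (h y powr (s / u)) * ennreal (exp (\<sigma> * s * b y)) = ennreal (f y powr s)" for y
  proof -
    have "h y powr (s / u) * exp (\<sigma> * s * b y) = F y powr s * exp (\<sigma> * s * b y)"
      using s by (simp add: h_def powr_powr)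
    also have "\<dots> = f y powr s" by (simp add: F_def powr_mult exp_powr_real mult.assoc mult_ac flip: exp_add)
    finally show ?thesis by (simp flip: ennreal_mult)
  qed
  have hI: "(\<integral>\<^sup>+x. ennreal (h x powr (s / u)) \<partial>W) = (\<integral>\<^sup>+x. ennreal (f x powr s) \<partial>M)"
    unfolding W_def by (subst nn_integral_density) (auto simp: hs mult.commute[of "ennreal (exp _)"])
  obtain G where G: "G \<in> borel_measurable W" "\<And>x. 0 \<le> G x"
    "AE x in W. \<forall>r. 0 < r \<and> r \<le> R \<longrightarrow> (\<integral>\<^sup>+y\<in>ball x r. ennreal (h y) \<partial>W) \<le> ennreal (G x) * emeasure W (ball x r)"
    "(\<integral>\<^sup>+x. ennreal (G x powr (s / u)) \<partial>W)
       \<le> ennreal (1 + (C * CM)\<^sup>2 * 2 powr (2 * (s / u)) / (1 - 2 powr (1 - s / u))) * (\<integral>\<^sup>+x. ennreal (h x powr (s / u)) \<partial>W)"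
    by (rule maximal_strong_type[OF Wd hW _ s(3), of R]) (use hI fin h_def in auto)
  have Gm[measurable]: "G \<in> borel_measurable M" using G(1) by (simp add: W_def)
  define H where "H x = C * (G x powr (1 / u) * exp (\<sigma> * b x))" for x
  show thesis
  proof
    show "H \<in> borel_measurable M" unfolding H_def by measurable
    show "0 \<le> H x" for x using C by (simp add: H_def)
    have "(\<integral>\<^sup>+x. ennreal (H x powr s) \<partial>M) = (\<integral>\<^sup>+x. ennreal (C powr s) * (ennreal (exp (\<sigma> * s * b x)) * ennreal (G x powr (s / u))) \<partial>M)"
      by (intro nn_integral_cong) (simp add: H_def powr_mult powr_powr exp_powr_real mult_ac flip: ennreal_mult)
    also have "\<dots> = ennreal (C powr s) * (\<integral>\<^sup>+x. ennreal (G x powr (s / u)) \<partial>W)"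
      unfolding W_def by (subst nn_integral_density) (auto simp: nn_integral_cmult)
    also have "\<dots> \<le> ennreal (C powr s) * (ennreal (1 + (C * CM)\<^sup>2 * 2 powr (2 * (s / u)) / (1 - 2 powr (1 - s / u))) * (\<integral>\<^sup>+x. ennreal (f x powr s) \<partial>M))"
      using G(4) unfolding hI by (intro mult_left_mono) auto
    also have "\<dots> = ennreal (C powr s * (1 + (C * CM)\<^sup>2 * 2 powr (2 * (s / u)) / (1 - 2 powr (1 - s / u)))) * (\<integral>\<^sup>+x. ennreal (f x powr s) \<partial>M)"
      by (simp add: ennreal_mult' mult.assoc)
    finally show "(\<integral>\<^sup>+x. ennreal (H x powr s) \<partial>M) \<le> ennreal (C powr s * (1 + (C * CM)\<^sup>2 * 2 powr (2 * (s / u)) / (1 - 2 powr (1 - s / u)))) *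
        (\<integral>\<^sup>+x. ennreal (f x powr s) \<partial>M)" .
    have "AE x in M. \<forall>r. 0 < r \<and> r \<le> R \<longrightarrow> (\<integral>\<^sup>+y\<in>ball x r. ennreal (h y) \<partial>W) \<le> ennreal (G x) * emeasure W (ball x r)"
      using G(3) unfolding W_def by (subst (asm) AE_density) auto
    then show "AE x in M. weighted_maximal b \<sigma> \<kappa> R f x \<le> ennreal (H x)"
    proof (eventually_elim, subst weighted_maximal_le_iff, (use C in \<open>simp add: H_def\<close>), intro allI impI)
      fix x r
      assume x: "\<forall>r. 0 < r \<and> r \<le> R \<longrightarrow> (\<integral>\<^sup>+y\<in>ball x r. ennreal (h y) \<partial>W) \<le> ennreal (G x) * emeasure W (ball x r)"
        and rR: "0 < r \<and> r \<le> R"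
      define a where "a = avg b x r"
      \<comment> \<open>The integrand is factored as \<open>X y * Y y\<close>:
        \<open>X powr u\<close> is h times the density of W, and \<open>Y powr v\<close> is a pure
        exponential in b, which the hypothesis on
        \<open>(\<kappa> + \<bar>\<sigma>\<bar> * (s / u - 1)) * v\<close> makes integrable.\<close>
      define X where "X y = F y * exp (\<sigma> * s * b y / u)" for y
      define Y where "Y y = exp (\<kappa> * \<bar>b y - a\<bar> - \<sigma> * (s / u - 1) * b y)" for y
      define P where "P = G x * (C * exp (\<sigma> * s * a) * m (ball x r))"
      define Q where "Q = exp (- \<sigma> * (s / u - 1) * v * a) * (C * m (ball x r))"
      have Xu: "X y powr u = exp (\<sigma> * s * b y) * h y" for y
        using s by (simp add: X_def powr_mult exp_powr_real h_def mult.commute)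
      have XI: "(\<integral>\<^sup>+y\<in>ball x r. ennreal (X y powr u) \<partial>M) \<le> ennreal P"
      proof -
        have "(\<integral>\<^sup>+y\<in>ball x r. ennreal (X y powr u) \<partial>M) = (\<integral>\<^sup>+y\<in>ball x r. ennreal (h y) \<partial>W)"
          unfolding W_def by (subst nn_integral_density) (auto simp: Xu ennreal_mult' mult.assoc)
        also have "\<dots> \<le> ennreal (G x) * emeasure W (ball x r)" using x rR by blast
        also have "\<dots> \<le> ennreal (G x) * ennreal (C * exp (\<sigma> * s * a) * m (ball x r))"
          unfolding a_def using rR by (intro mult_left_mono Wle) auto
        also have "\<dots> = ennreal P" using G(2) C by (simp add: P_def ennreal_mult)
        finally show ?thesis .
      qed
      have YI: "(\<integral>\<^sup>+y\<in>ball x r. ennreal (Y y powr v) \<partial>M) \<le> ennreal Q"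
      proof -
        have "(\<integral>\<^sup>+y\<in>ball x r. ennreal (Y y powr v) \<partial>M)
          \<le> (\<integral>\<^sup>+y. ennreal (exp (- \<sigma> * (s / u - 1) * v * a)) * (ennreal (exp (\<kappa>\<^sub>0 * \<bar>b y - a\<bar>)) * indicator (ball x r) y) \<partial>M)"
        proof (rule nn_integral_mono)
          fix y
          have "- (\<sigma> * (s / u - 1)) * (b y - a) \<le> \<bar>\<sigma> * (s / u - 1)\<bar> * \<bar>b y - a\<bar>"
            by (metis abs_ge_self abs_mult abs_minus_cancel)
          also have "\<bar>\<sigma> * (s / u - 1)\<bar> = \<bar>\<sigma>\<bar> * (s / u - 1)" using s by (simp add: abs_mult)
          moreover have "\<kappa> * \<bar>b y - a\<bar> - \<sigma> * w * b y \<le> (\<kappa> + \<bar>\<sigma>\<bar> * w) * \<bar>b y - a\<bar> - \<sigma> * w * a"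
            if "- (\<sigma> * w) * (b y - a) \<le> \<bar>\<sigma>\<bar> * w * \<bar>b y - a\<bar>" for w
            using that by (simp add: algebra_simps)
          ultimately have "\<kappa> * \<bar>b y - a\<bar> - \<sigma> * (s / u - 1) * b y \<le> (\<kappa> + \<bar>\<sigma>\<bar> * (s / u - 1)) * \<bar>b y - a\<bar> - \<sigma> * (s / u - 1) * a"
            by simp
          then have "(\<kappa> * \<bar>b y - a\<bar> - \<sigma> * (s / u - 1) * b y) * v \<le> ((\<kappa> + \<bar>\<sigma>\<bar> * (s / u - 1)) * \<bar>b y - a\<bar> - \<sigma> * (s / u - 1) * a) * v"
            using v by (intro mult_right_mono) auto
          also have "\<dots> = (\<kappa> + \<bar>\<sigma>\<bar> * (s / u - 1)) * v * \<bar>b y - a\<bar> + - \<sigma> * (s / u - 1) * v * a" by (simp add: algebra_simps)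
          also have "\<dots> \<le> \<kappa>\<^sub>0 * \<bar>b y - a\<bar> + - \<sigma> * (s / u - 1) * v * a" by (intro add_right_mono mult_right_mono \<kappa>) simp
          finally have "Y y powr v \<le> exp (- \<sigma> * (s / u - 1) * v * a) * exp (\<kappa>\<^sub>0 * \<bar>b y - a\<bar>)"
            by (simp add: Y_def exp_powr_real add.commute flip: exp_add)
          then have "ennreal (Y y powr v) \<le> ennreal (exp (- \<sigma> * (s / u - 1) * v * a)) * ennreal (exp (\<kappa>\<^sub>0 * \<bar>b y - a\<bar>))"
            by (subst ennreal_mult[symmetric]) (auto intro: ennreal_leI)
          then show "ennreal (Y y powr v) * indicator (ball x r) y
            \<le> ennreal (exp (- \<sigma> * (s / u - 1) * v * a)) * (ennreal (exp (\<kappa>\<^sub>0 * \<bar>b y - a\<bar>)) * indicator (ball x r) y)"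
            by (simp add: indicator_def)
        qed
        also have "\<dots> = ennreal (exp (- \<sigma> * (s / u - 1) * v * a)) * (\<integral>\<^sup>+y\<in>ball x r. ennreal (exp (\<kappa>\<^sub>0 * \<bar>b y - a\<bar>)) \<partial>M)"
          by (rule nn_integral_cmult) measurable
        also have "\<dots> \<le> ennreal (exp (- \<sigma> * (s / u - 1) * v * a)) * ennreal (C * m (ball x r))"
          unfolding a_def using rR by (intro mult_left_mono exp_oscillation_boundD(3)[OF osc]) auto
        also have "\<dots> = ennreal Q" unfolding Q_def using C by (intro ennreal_mult[symmetric]) auto
        finally show ?thesis .
      qed
      have PQ0: "0 \<le> P" "0 \<le> Q" using G(2) C by (auto simp: P_def Q_def)
      have XY: "X y * Y y = exp (\<kappa> * \<bar>b y - a\<bar>) * f y" for y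
      proof -
        have "X y * Y y = f y * exp (- \<sigma> * b y + \<sigma> * s * b y / u + (\<kappa> * \<bar>b y - a\<bar> - \<sigma> * (s / u - 1) * b y))"
          by (simp add: X_def Y_def F_def mult.assoc flip: exp_add)
        also have "- \<sigma> * b y + \<sigma> * s * b y / u + (\<kappa> * \<bar>b y - a\<bar> - \<sigma> * (s / u - 1) * b y) = \<kappa> * \<bar>b y - a\<bar>"
          by (simp add: algebra_simps)
        finally show ?thesis by simp
      qed
      have XY': "ennreal (X y * Y y) = ennreal (exp (\<kappa> * \<bar>b y - a\<bar>)) * ennreal (f y)" for y
        unfolding XY using f0 by (intro ennreal_mult) auto
      have Hold: "(\<integral>\<^sup>+y\<in>ball x r. ennreal (X y * Y y) \<partial>M) \<le> ennreal (P powr (1 / u) * Q powr (1 / v))"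
        by (rule set_nn_integral_Holder[OF _ _ _ _ _ u(1) v u(3) PQ0 XI YI]) (auto simp: X_def Y_def F0)
      \<comment> \<open>The exponentials of multiples of a in P and Q combine to
        \<open>exp (\<sigma> * a)\<close>, which turns \<open>exp (\<sigma> * (b x - a))\<close>
        into \<open>exp (\<sigma> * b x)\<close>; hence H does not depend on r.\<close>
      have PQ: "exp (\<sigma> * (b x - a)) * (P powr (1 / u) * Q powr (1 / v)) = H x * m (ball x r)"
      proof -
        have "P powr (1 / u) * Q powr (1 / v) = (G x powr (1 / u) * (exp (\<sigma> * s * a / u) * exp (- \<sigma> * (s / u - 1) * a))) *
            ((C * m (ball x r)) powr (1 / u) * (C * m (ball x r)) powr (1 / v))"
          using v0 by (simp add: P_def Q_def powr_mult exp_powr_real mult_ac)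
        also have "exp (\<sigma> * s * a / u) * exp (- \<sigma> * (s / u - 1) * a) = exp (\<sigma> * a)"
          by (simp add: algebra_simps flip: exp_add)
        also have "(C * m (ball x r)) powr (1 / u) * (C * m (ball x r)) powr (1 / v) = C * m (ball x r)"
          using C by (simp add: u(3) flip: powr_add)
        finally have "exp (\<sigma> * (b x - a)) * (P powr (1 / u) * Q powr (1 / v))
           = C * (G x powr (1 / u) * (exp (\<sigma> * (b x - a)) * exp (\<sigma> * a))) * m (ball x r)" by (simp add: mult_ac)
        also have "exp (\<sigma> * (b x - a)) * exp (\<sigma> * a) = exp (\<sigma> * b x)" by (simp add: algebra_simps flip: exp_add)
        finally show ?thesis by (simp add: H_def)
      qed
      have "ennreal (exp (\<sigma> * (b x - a))) * (\<integral>\<^sup>+y\<in>ball x r. ennreal (X y * Y y) \<partial>M)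
        \<le> ennreal (exp (\<sigma> * (b x - a))) * ennreal (P powr (1 / u) * Q powr (1 / v))"
        by (intro mult_left_mono Hold) simp
      also have "\<dots> = ennreal (H x * m (ball x r))" by (subst ennreal_mult[symmetric]) (auto simp: PQ)
      finally show "ennreal (exp (\<sigma> * (b x - avg b x r))) * exp_integral b \<kappa> f x r \<le> ennreal (H x * m (ball x r))"
        by (simp add: XY' a_def)
    qed
  qed
qed

end

lemma le_powr_ge_1: "1 \<le> x \<Longrightarrow> 1 \<le> s \<Longrightarrow> x \<le> x powr s" for x s :: real
  using powr_mono[of 1 s x] by simp

lemma add_powr_le:
  fixes x y s :: real
  assumes "0 \<le> x" "0 \<le> y" "0 \<le> s"
  shows "(x + y) powr s \<le> 2 powr s * (x powr s + y powr s)"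
proof -
  have "(x + y) powr s \<le> (2 * max x y) powr s" using assms by (intro powr_mono2) auto
  also have "\<dots> = 2 powr s * max x y powr s" by (simp add: powr_mult)
  also have "\<dots> \<le> 2 powr s * (x powr s + y powr s)" by (intro mult_left_mono) (auto simp: max_def)
  finally show ?thesis .
qed

text \<open>The factor 4 inside the power absorbs both the \<open>2 powr s\<close> of
  \<open>add_powr_le\<close> and the 2 from adding the bounds, so the resulting constant is free of
  s.\<close>

lemma nn_integral_powr_add_le:
  fixes f g :: "'a \<Rightarrow> real"
  assumes [measurable]: "f \<in> borel_measurable N" "g \<in> borel_measurable N" "S \<in> sets N"
    and nn: "\<And>x. 0 \<le> f x" "\<And>x. 0 \<le> g x" and s: "1 \<le> s" and k: "0 \<le> k" "0 \<le> l" "0 \<le> X"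
    and f: "(\<integral>\<^sup>+x\<in>S. ennreal (f x powr s) \<partial>N) \<le> ennreal (k powr s * X)"
    and g: "(\<integral>\<^sup>+x\<in>S. ennreal (g x powr s) \<partial>N) \<le> ennreal (l powr s * X)"
  shows "(\<integral>\<^sup>+x\<in>S. ennreal ((f x + g x) powr s) \<partial>N) \<le> ennreal ((4 * (k + l)) powr s * X)"
proof -
  have "(\<integral>\<^sup>+x\<in>S. ennreal ((f x + g x) powr s) \<partial>N)
     \<le> (\<integral>\<^sup>+x. ennreal (2 powr s) * (ennreal (f x powr s) * indicator S x + ennreal (g x powr s) * indicator S x) \<partial>N)"
    using nn s add_powr_le by (intro nn_integral_mono)
      (auto simp: indicator_def simp flip: ennreal_plus ennreal_mult intro!: ennreal_leI)
  also have "\<dots> = ennreal (2 powr s) * ((\<integral>\<^sup>+x\<in>S. ennreal (f x powr s) \<partial>N) + (\<integral>\<^sup>+x\<in>S. ennreal (g x powr s) \<partial>N))"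
    by (simp add: nn_integral_cmult nn_integral_add)
  also have "\<dots> \<le> ennreal (2 powr s) * (ennreal (k powr s * X) + ennreal (l powr s * X))"
    by (intro mult_left_mono add_mono f g) simp
  also have "\<dots> = ennreal (2 powr s * (k powr s + l powr s) * X)"
    using k by (simp add: distrib_right distrib_left mult.assoc flip: ennreal_plus ennreal_mult)
  also have "\<dots> \<le> ennreal ((4 * (k + l)) powr s * X)"
  proof (intro ennreal_leI mult_right_mono k)
    have "k powr s + l powr s \<le> 2 * (k + l) powr s"
      using powr_mono2[of s k "k + l"] powr_mono2[of s l "k + l"] k s by simp
    also have "\<dots> \<le> 2 powr s * (k + l) powr s" using le_powr_ge_1[of 2 s] s by (intro mult_right_mono) auto
    finally have "2 powr s * (k powr s + l powr s) \<le> 2 powr s * (2 powr s * (k + l) powr s)" by (intro mult_left_mono) auto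
    also have "\<dots> = (4 * (k + l)) powr s" by (simp flip: powr_mult mult.assoc)
    finally show "2 powr s * (k powr s + l powr s) \<le> (4 * (k + l)) powr s" .
  qed
  finally show ?thesis .
qed

section \<open>Morrey bounds for the weighted maximal function\<close>

context nondegenerate_homogeneous_space
begin

text \<open>Hoelder's inequality, with the exponential carried by the conjugate exponent s'. The
  power \<open>- (1 - \<nu>) / s\<close> is the decay of averages of a Morrey function on which the
  treatment of large radii relies.\<close>

lemma morrey_exp_average:
  assumes osc: "exp_oscillation_bound b \<kappa>\<^sub>0 C" and C: "1 \<le> C"
    and s: "1 < s" "1 < s'" "1 / s + 1 / s' = 1" and \<kappa>: "\<kappa> * s' \<le> \<kappa>\<^sub>0" and K: "0 \<le> K"
    and g: "morrey_majorized g s \<nu> K" and r: "0 < r"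
  shows "exp_integral b \<kappa> g x r
    \<le> ennreal (C * K * m (ball x r) powr (- (1 - \<nu>) / s) * m (ball x r))"
proof -
  have [measurable]: "b \<in> borel_measurable M" by (rule exp_oscillation_boundD[OF osc])
  obtain H where H[measurable]: "H \<in> borel_measurable M" and H0: "\<And>y. 0 \<le> H y"
    and gH: "AE y in M. y \<in> ball x r \<longrightarrow> g y \<le> ennreal (H y)"
    and HI: "(\<integral>\<^sup>+y\<in>ball x r. ennreal (H y powr s) \<partial>M) \<le> ennreal (K powr s * m (ball x r) powr \<nu>)"
    by (rule morrey_majorizedE[OF g r, of x]) blast
  define V where "V = m (ball x r)"
  have V: "0 < V" unfolding V_def by (rule measure_ball_pos[OF r])
  define Y where "Y y = exp (\<kappa> * \<bar>b y - avg b x r\<bar>)" for y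
  have YI: "(\<integral>\<^sup>+y\<in>ball x r. ennreal (Y y powr s') \<partial>M) \<le> ennreal (C * V)"
    using exp_oscillation_boundD(3)[OF osc r \<kappa>, of x] by (simp add: Y_def exp_powr_real V_def mult_ac)
  have "exp_integral b \<kappa> g x r \<le> (\<integral>\<^sup>+y\<in>ball x r. ennreal (H y * Y y) \<partial>M)"
    using gH
  proof (intro nn_integral_mono_AE, eventually_elim)
    case (elim y)
    have "ennreal (exp (\<kappa> * \<bar>b y - avg b x r\<bar>)) * g y \<le> ennreal (Y y) * ennreal (H y)" if "y \<in> ball x r"
      using elim that unfolding Y_def by (intro mult_left_mono) auto
    then show ?case using H0 by (auto simp: indicator_def ennreal_mult Y_def mult.commute)
  qed
  also have "\<dots> \<le> ennreal ((K powr s * V powr \<nu>) powr (1 / s) * (C * V) powr (1 / s'))"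
    using HI YI C V H0 by (intro set_nn_integral_Holder[OF _ _ _ _ _ s]) (auto simp: Y_def V_def)
  also have "\<dots> \<le> ennreal (C * K * V powr (- (1 - \<nu>) / s) * V)"
  proof (rule ennreal_leI)
    have "C powr (1 / s') \<le> C powr 1" using C s by (intro powr_mono) auto
    then have C': "C powr (1 / s') \<le> C" using C by simp
    have "V powr (\<nu> / s) * V powr (1 / s') = V powr (\<nu> / s + 1 / s')" by (simp add: powr_add)
    also have "\<nu> / s + 1 / s' = - (1 - \<nu>) / s + 1" using s by (simp add: field_simps)
    also have "V powr (- (1 - \<nu>) / s + 1) = V powr (- (1 - \<nu>) / s) * V" using V by (simp add: powr_add)
    finally have VV: "V powr (\<nu> / s) * V powr (1 / s') = V powr (- (1 - \<nu>) / s) * V" .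
    have "(K powr s * V powr \<nu>) powr (1 / s) * (C * V) powr (1 / s') = C powr (1 / s') * K * (V powr (\<nu> / s) * V powr (1 / s'))"
      using K s by (simp add: powr_mult powr_powr mult_ac)
    also have "\<dots> \<le> C * K * (V powr (\<nu> / s) * V powr (1 / s'))" using C' K by (intro mult_right_mono) auto
    finally show "(K powr s * V powr \<nu>) powr (1 / s) * (C * V) powr (1 / s') \<le> C * K * V powr (- (1 - \<nu>) / s) * V"
      unfolding VV by (simp add: mult.assoc)
  qed
  finally show ?thesis by (simp add: V_def)
qed

text \<open>Neither ball need contain the other, so both averages are compared with the one over the
  dilate \<open>ball x (2 * qK\<^sup>2 * r)\<close>, which contains both.\<close>

lemma exp_avg_diff_center_in:
  assumes osc: "exp_oscillation_bound b \<kappa>\<^sub>0 C" and C: "1 \<le> C" and \<kappa>: "0 \<le> \<kappa>\<^sub>0"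
  obtains Q where "1 \<le> Q" "\<And>x x0 r r0. 0 < r0 \<Longrightarrow> r0 \<le> r \<Longrightarrow> x \<in> ball x0 r0 \<Longrightarrow>
    exp (\<kappa>\<^sub>0 * \<bar>avg b x0 r0 - avg b x r\<bar>) \<le> Q * (m (ball x r) / m (ball x0 r0))"
proof -
  have K: "1 \<le> qK" by (rule qK_ge_1)
  define k where "k = 2 * qK\<^sup>2"
  have k: "1 \<le> k" using one_le_power[OF K, of 2] by (simp add: k_def)
  obtain C3 where C3: "1 \<le> C3" "\<And>x r. 0 < r \<Longrightarrow> m (ball x (k * r)) \<le> C3 * m (ball x r)"
    using dilation_bound[of k] by blast
  have C30: "0 < C * C3" using C C3 by simp
  show thesis
  proof
    have "1 * 1 \<le> (C * C3) * (C * C3)" using C C3 mult_mono[of 1 C 1 C3] by (intro mult_mono) auto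
    then show "1 \<le> (C * C3)\<^sup>2" by (simp add: power2_eq_square)
    fix x x0 r r0 assume r: "0 < r0" "r0 \<le> r" and x: "x \<in> ball x0 r0"
    have "0 < r" using r by linarith
    have kr: "r \<le> k * r" "0 < k * r" "k * r0 \<le> k * r" using k r \<open>0 < r\<close> by (auto simp: mult_le_cancel_right1)
    have pos: "0 < m (ball x r)" "0 < m (ball x0 r0)" using r by (auto intro: measure_ball_pos)
    have sub: "ball x0 r0 \<subseteq> ball x (k * r)"
      using ball_subset_center_in(2)[OF x] ball_mono[OF kr(3), of x] unfolding k_def by blast
    have mk: "C * m (ball x (k * r)) \<le> C * C3 * m (ball x r)" using C3(2)[OF \<open>0 < r\<close>, of x] C by simp
    have "exp (\<kappa>\<^sub>0 * \<bar>avg b x0 r0 - avg b x (k * r)\<bar>) * m (ball x0 r0) \<le> C * m (ball x (k * r))"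
      using C r kr sub by (intro exp_avg_diff_nested_ball[OF osc _ \<kappa>]) auto
    then have "exp (\<kappa>\<^sub>0 * \<bar>avg b x0 r0 - avg b x (k * r)\<bar>) * m (ball x0 r0) \<le> C * C3 * m (ball x r)" using mk by linarith
    then have 1: "exp (\<kappa>\<^sub>0 * \<bar>avg b x0 r0 - avg b x (k * r)\<bar>) \<le> C * C3 * (m (ball x r) / m (ball x0 r0))"
      using pos by (simp add: field_simps)
    have "exp (\<kappa>\<^sub>0 * \<bar>avg b x r - avg b x (k * r)\<bar>) * m (ball x r) \<le> C * m (ball x (k * r))"
      using C r kr ball_mono[OF kr(1), of x] by (intro exp_avg_diff_nested_ball[OF osc _ \<kappa>]) auto
    then have "exp (\<kappa>\<^sub>0 * \<bar>avg b x r - avg b x (k * r)\<bar>) * m (ball x r) \<le> C * C3 * m (ball x r)" using mk by linarith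
    then have 2: "exp (\<kappa>\<^sub>0 * \<bar>avg b x r - avg b x (k * r)\<bar>) \<le> C * C3" using pos by simp
    have "\<bar>avg b x0 r0 - avg b x r\<bar> \<le> \<bar>avg b x0 r0 - avg b x (k * r)\<bar> + \<bar>avg b x r - avg b x (k * r)\<bar>" by linarith
    then have "\<kappa>\<^sub>0 * \<bar>avg b x0 r0 - avg b x r\<bar> \<le> \<kappa>\<^sub>0 * \<bar>avg b x0 r0 - avg b x (k * r)\<bar> + \<kappa>\<^sub>0 * \<bar>avg b x r - avg b x (k * r)\<bar>"
      using \<kappa> by (metis mult_left_mono distrib_left)
    then have "exp (\<kappa>\<^sub>0 * \<bar>avg b x0 r0 - avg b x r\<bar>) \<le> exp (\<kappa>\<^sub>0 * \<bar>avg b x0 r0 - avg b x (k * r)\<bar>) * exp (\<kappa>\<^sub>0 * \<bar>avg b x r - avg b x (k * r)\<bar>)"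
      by (simp flip: exp_add)
    also have "\<dots> \<le> (C * C3 * (m (ball x r) / m (ball x0 r0))) * (C * C3)"
      using 1 2 C30 pos by (intro mult_mono) auto
    finally show "exp (\<kappa>\<^sub>0 * \<bar>avg b x0 r0 - avg b x r\<bar>) \<le> (C * C3)\<^sup>2 * (m (ball x r) / m (ball x0 r0))"
      by (simp add: power2_eq_square mult_ac)
  qed
qed

text \<open>Radii up to \<open>r0\<close> see only the part of g near \<open>ball x0 r0\<close>, to
  which \<open>weighted_maximal_local\<close> applies; larger radii are bounded pointwise by
  \<open>morrey_exp_average\<close>. There the drift of averages costs a power of the measure ratio
  with exponent at most \<open>(1 - \<nu>) / s\<close>, by the hypothesis on
  \<open>\<bar>\<sigma>\<bar> * s\<close>, and the Morrey decay pays for it.\<close>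

lemma weighted_maximal_morrey:
  assumes osc: "exp_oscillation_bound b \<kappa>\<^sub>0 C" and C: "1 \<le> C" and \<kappa>0: "0 < \<kappa>\<^sub>0"
    and u: "1 < u" "1 < v" "1 / u + 1 / v = 1" "u < s0"
  obtains D where "1 \<le> D"
    "\<And>s \<nu> \<kappa> \<sigma> g K x0 r0. s0 \<le> s \<Longrightarrow> s \<le> p \<Longrightarrow> 0 \<le> \<nu> \<Longrightarrow> \<nu> \<le> 1 \<Longrightarrow> \<bar>\<sigma>\<bar> * s \<le> \<kappa>\<^sub>0 * (1 - \<nu>) \<Longrightarrow> 0 \<le> \<kappa> \<Longrightarrow>
      (\<kappa> + \<bar>\<sigma>\<bar> * (s / u - 1)) * v \<le> \<kappa>\<^sub>0 \<Longrightarrow> 0 < K \<Longrightarrow> morrey_majorized g s \<nu> K \<Longrightarrow> 0 < r0 \<Longrightarrow> r0 \<le> R \<Longrightarrow>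
      ball_majorized (weighted_maximal b \<sigma> \<kappa> R g) s \<nu> (D * K) x0 r0"
proof -
  have bm[measurable]: "b \<in> borel_measurable M" by (rule exp_oscillation_boundD[OF osc])
  have K1: "1 \<le> qK" by (rule qK_ge_1)
  obtain CM where CM: "1 \<le> CM" "ball_doubling M CM" by (rule ball_doubling_M)
  obtain C2 where C2: "1 \<le> C2" "\<And>x r. 0 < r \<Longrightarrow> m (ball x (2 * qK * r)) \<le> C2 * m (ball x r)"
    using dilation_bound[of "2 * qK"] by blast
  have \<kappa>0': "0 \<le> \<kappa>\<^sub>0" using \<kappa>0 by simp
  obtain Q where Q: "1 \<le> Q" and Qle: "\<And>x x0 r r0. 0 < r0 \<Longrightarrow> r0 \<le> r \<Longrightarrow> x \<in> ball x0 r0 \<Longrightarrow>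
    exp (\<kappa>\<^sub>0 * \<bar>avg b x0 r0 - avg b x r\<bar>) \<le> Q * (m (ball x r) / m (ball x0 r0))"
    by (rule exp_avg_diff_center_in[OF osc C \<kappa>0']) blast
  \<comment> \<open>S bounds the constant of \<open>weighted_maximal_local\<close> over the whole
    range of s: the numerator is estimated through \<open>s / u \<le> p\<close>, the denominator is
    taken at \<open>s0\<close>.\<close>
  define S where "S = 1 + (C * CM)\<^sup>2 * 2 powr (2 * p) / (1 - 2 powr (1 - s0 / u))"
  have su0: "1 < s0 / u" using u by simp
  then have "(2::real) powr (1 - s0 / u) < 2 powr 0" by (intro powr_less_mono) auto
  then have den0: "(0::real) < 1 - 2 powr (1 - s0 / u)" by simp
  have S: "1 \<le> S" using den0 by (simp add: S_def)
  define c1 where "c1 = C * S * C2"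
  define c2 where "c2 = Q * C * C"
  have c1: "1 \<le> C * S" "1 \<le> c1" using C S C2 mult_mono[of 1 C 1 S] mult_mono[of 1 "C * S" 1 C2] by (auto simp: c1_def)
  have QC: "1 \<le> Q * C" "1 \<le> c2" using Q C mult_mono[of 1 Q 1 C] mult_mono[of 1 "Q * C" 1 C] by (auto simp: c2_def)
  show thesis
  proof
    show "1 \<le> 4 * (c1 + c2)" using c1 QC by simp
    fix s \<nu> \<kappa> \<sigma> K r0 :: real and g x0
    assume s: "s0 \<le> s" "s \<le> p" and \<nu>: "0 \<le> \<nu>" "\<nu> \<le> 1" and \<sigma>: "\<bar>\<sigma>\<bar> * s \<le> \<kappa>\<^sub>0 * (1 - \<nu>)" and \<kappa>: "0 \<le> \<kappa>"
      and \<kappa>\<sigma>: "(\<kappa> + \<bar>\<sigma>\<bar> * (s / u - 1)) * v \<le> \<kappa>\<^sub>0" and K: "0 < K" and g: "morrey_majorized g s \<nu> K"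
      and r0: "0 < r0" "r0 \<le> R"
    have s1: "1 < s" "u < s" "1 < s / u" using s u by auto
    define V0 where "V0 = m (ball x0 r0)"
    have V0: "0 < V0" unfolding V0_def by (rule measure_ball_pos[OF r0(1)])
    have \<sigma>s: "\<bar>\<sigma>\<bar> * s \<le> \<kappa>\<^sub>0"
    proof -
      have "\<kappa>\<^sub>0 * (1 - \<nu>) \<le> \<kappa>\<^sub>0 * 1" using \<nu> \<kappa>0 by (intro mult_left_mono) auto
      then show ?thesis using \<sigma> by simp
    qed
    \<comment> \<open>For x in \<open>ball x0 r0\<close>, all balls of radius up to
      \<open>r0\<close> around x lie in \<open>ball x0 r1\<close>.\<close>
    define r1 where "r1 = 2 * qK * r0"
    have r1: "0 < r1" using r0 K1 by (simp add: r1_def)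
    obtain F where F[measurable]: "F \<in> borel_measurable M" and F0: "\<And>y. 0 \<le> F y"
      and gF: "AE y in M. y \<in> ball x0 r1 \<longrightarrow> g y \<le> ennreal (F y)"
      and FI: "(\<integral>\<^sup>+y\<in>ball x0 r1. ennreal (F y powr s) \<partial>M) \<le> ennreal (K powr s * m (ball x0 r1) powr \<nu>)"
      by (rule morrey_majorizedE[OF g r1, of x0]) blast
    define f where "f y = F y * indicator (ball x0 r1) y" for y
    have fm[measurable]: "f \<in> borel_measurable M" unfolding f_def by measurable
    have f0: "0 \<le> f y" for y using F0 by (simp add: f_def)
    have "(\<integral>\<^sup>+y. ennreal (f y powr s) \<partial>M) = (\<integral>\<^sup>+y\<in>ball x0 r1. ennreal (F y powr s) \<partial>M)"
      using s1 by (intro nn_integral_cong) (auto simp: f_def indicator_def)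
    also note FI
    also have "ennreal (K powr s * m (ball x0 r1) powr \<nu>) \<le> ennreal (K powr s * (C2 * V0 powr \<nu>))"
    proof (intro ennreal_leI mult_left_mono)
      have "m (ball x0 r1) powr \<nu> \<le> (C2 * V0) powr \<nu>"
        unfolding r1_def V0_def using \<nu> C2 r0 by (intro powr_mono2) auto
      also have "\<dots> = C2 powr \<nu> * V0 powr \<nu>" by (simp add: powr_mult)
      also have "C2 powr \<nu> \<le> C2 powr 1" using C2 \<nu> by (intro powr_mono) auto
      finally show "m (ball x0 r1) powr \<nu> \<le> C2 * V0 powr \<nu>" using C2(1) by (simp add: mult_right_mono)
    qed simp
    finally have fI: "(\<integral>\<^sup>+y. ennreal (f y powr s) \<partial>M) \<le> ennreal (K powr s * (C2 * V0 powr \<nu>))" .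
    obtain H1 where H1[measurable]: "H1 \<in> borel_measurable M" and H10: "\<And>x. 0 \<le> H1 x"
      and H1AE: "AE x in M. weighted_maximal b \<sigma> \<kappa> R f x \<le> ennreal (H1 x)"
      and H1I: "(\<integral>\<^sup>+x. ennreal (H1 x powr s) \<partial>M) \<le> ennreal (C powr s * (1 + (C * CM)\<^sup>2 * 2 powr (2 * (s / u)) / (1 - 2 powr (1 - s / u)))) *
        (\<integral>\<^sup>+x. ennreal (f x powr s) \<partial>M)"
      by (rule weighted_maximal_local[OF osc C CM(2) u(1) s1(2) u(3,2) \<sigma>s \<kappa>\<sigma> fm f0 le_less_trans[OF fI], of R]) auto
    have H1B: "(\<integral>\<^sup>+x\<in>ball x0 r0. ennreal (H1 x powr s) \<partial>M) \<le> ennreal ((c1 * K) powr s * V0 powr \<nu>)"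
    proof -
      have "(\<integral>\<^sup>+x\<in>ball x0 r0. ennreal (H1 x powr s) \<partial>M) \<le> (\<integral>\<^sup>+x. ennreal (H1 x powr s) \<partial>M)"
        by (intro nn_integral_mono) (auto simp: indicator_def)
      also note H1I
      also have "ennreal (C powr s * (1 + (C * CM)\<^sup>2 * 2 powr (2 * (s / u)) / (1 - 2 powr (1 - s / u)))) * (\<integral>\<^sup>+x. ennreal (f x powr s) \<partial>M)
          \<le> ennreal (C powr s * S) * ennreal (K powr s * (C2 * V0 powr \<nu>))"
      proof (intro mult_mono fI ennreal_leI mult_left_mono)
        have le: "(2::real) powr (1 - s / u) \<le> 2 powr (1 - s0 / u)" using s u by (intro powr_mono) (auto intro: divide_right_mono)
        then have "0 < 1 - (2::real) powr (1 - s / u)" using den0 by linarith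
        then have "0 \<le> (C * CM)\<^sup>2 * 2 powr (2 * (s / u)) / (1 - 2 powr (1 - s / u))"
          by (intro divide_nonneg_pos mult_nonneg_nonneg) simp_all
        then show "0 \<le> 1 + (C * CM)\<^sup>2 * 2 powr (2 * (s / u)) / (1 - 2 powr (1 - s / u))" by linarith
        have "(2::real) powr (2 * (s / u)) \<le> 2 powr (2 * p)"
        proof (rule powr_mono)
          have "s / u \<le> s / 1" using u s1 by (intro divide_left_mono) auto
          then show "2 * (s / u) \<le> 2 * p" using s by simp
        qed simp
        then show "1 + (C * CM)\<^sup>2 * 2 powr (2 * (s / u)) / (1 - 2 powr (1 - s / u)) \<le> S"
          unfolding S_def using den0 le by (intro add_left_mono frac_le mult_left_mono) auto
      qed auto
      also have "\<dots> = ennreal (C powr s * S * (K powr s * (C2 * V0 powr \<nu>)))" using S C2 by (simp flip: ennreal_mult)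
      also have "\<dots> \<le> ennreal ((c1 * K) powr s * V0 powr \<nu>)"
      proof (rule ennreal_leI)
        have "S * C2 \<le> S powr s * C2 powr s" using S C2 s1 by (intro mult_mono le_powr_ge_1) auto
        then have "C powr s * K powr s * V0 powr \<nu> * (S * C2) \<le> C powr s * K powr s * V0 powr \<nu> * (S powr s * C2 powr s)"
          by (intro mult_left_mono) auto
        then show "C powr s * S * (K powr s * (C2 * V0 powr \<nu>)) \<le> (c1 * K) powr s * V0 powr \<nu>"
          by (simp add: c1_def powr_mult mult_ac)
      qed
      finally show ?thesis .
    qed
    \<comment> \<open>The bound for large radii, uniform in r: the powers of
      \<open>m (ball x r)\<close> cancel, and only the deviation of b from its average over the
      fixed ball remains.\<close>
    define H2 where "H2 x = Q * C * K * V0 powr (- (1 - \<nu>) / s) * exp (\<bar>\<sigma>\<bar> * \<bar>b x - avg b x0 r0\<bar>)" for x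
    have H2[measurable]: "H2 \<in> borel_measurable M" unfolding H2_def by measurable
    have H20: "0 \<le> H2 x" for x using Q C K by (simp add: H2_def)
    have H2B: "(\<integral>\<^sup>+x\<in>ball x0 r0. ennreal (H2 x powr s) \<partial>M) \<le> ennreal ((c2 * K) powr s * V0 powr \<nu>)"
    proof -
      have "(\<integral>\<^sup>+x\<in>ball x0 r0. ennreal (H2 x powr s) \<partial>M)
          = (\<integral>\<^sup>+x. ennreal ((Q * C * K) powr s * V0 powr (- (1 - \<nu>))) * (ennreal (exp ((\<bar>\<sigma>\<bar> * s) * \<bar>b x - avg b x0 r0\<bar>)) * indicator (ball x0 r0) x) \<partial>M)"
        using s1 by (intro nn_integral_cong)
          (auto simp: H2_def indicator_def powr_mult powr_powr exp_powr_real mult_ac simp flip: ennreal_mult)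
      also have "\<dots> = ennreal ((Q * C * K) powr s * V0 powr (- (1 - \<nu>))) * (\<integral>\<^sup>+x\<in>ball x0 r0. ennreal (exp ((\<bar>\<sigma>\<bar> * s) * \<bar>b x - avg b x0 r0\<bar>)) \<partial>M)"
        by (rule nn_integral_cmult) measurable
      also have "\<dots> \<le> ennreal ((Q * C * K) powr s * V0 powr (- (1 - \<nu>))) * ennreal (C * V0)"
        unfolding V0_def by (intro mult_left_mono exp_oscillation_boundD(3)[OF osc r0(1) \<sigma>s]) auto
      also have "\<dots> = ennreal ((Q * C * K) powr s * C * (V0 powr (- (1 - \<nu>)) * V0))" using C V0 by (simp add: mult_ac flip: ennreal_mult)
      also have "V0 powr (- (1 - \<nu>)) * V0 = V0 powr \<nu>" using V0 powr_mult_base[of V0 "- (1 - \<nu>)"] by (simp add: mult.commute)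
      also have "ennreal ((Q * C * K) powr s * C * V0 powr \<nu>) \<le> ennreal ((c2 * K) powr s * V0 powr \<nu>)"
      proof (intro ennreal_leI mult_right_mono)
        have "(Q * C * K) powr s * C \<le> (Q * C * K) powr s * C powr s" using C s1 by (intro mult_left_mono le_powr_ge_1) auto
        then show "(Q * C * K) powr s * C \<le> (c2 * K) powr s" by (simp add: c2_def powr_mult mult_ac)
      qed simp
      finally show ?thesis .
    qed
    define s' where "s' = s / (s - 1)"
    have s': "1 < s'" "1 / s + 1 / s' = 1" using s1 by (auto simp: s'_def field_simps)
    have "s' \<le> v"
    proof -
      have "1 / s \<le> 1 / u" using s1 u by (intro divide_left_mono) auto
      then have "1 / v \<le> 1 / s'" using s'(2) u(3) by linarith
      then show ?thesis using s' u by (simp add: divide_simps)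
    qed
    have "\<kappa> * s' \<le> \<kappa> * v" using \<kappa> \<open>s' \<le> v\<close> by (rule mult_left_mono[rotated])
    also have "\<dots> \<le> (\<kappa> + \<bar>\<sigma>\<bar> * (s / u - 1)) * v" using s1 u by (intro mult_right_mono) auto
    finally have \<kappa>s': "\<kappa> * s' \<le> \<kappa>\<^sub>0" using \<kappa>\<sigma> by linarith
    have large: "ennreal (exp (\<sigma> * (b x - avg b x r))) *
          exp_integral b \<kappa> g x r \<le> ennreal (H2 x * m (ball x r))"
      if x: "x \<in> ball x0 r0" and r: "r0 \<le> r" for x r
    proof -
      have rpos: "0 < r" using r r0 by linarith
      define V where "V = m (ball x r)"
      have V: "0 < V" unfolding V_def by (rule measure_ball_pos[OF rpos])
      define e where "e = (1 - \<nu>) / s"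
      have e: "0 \<le> e" "e \<le> 1" using \<nu> s1 by (auto simp: e_def)
      have ne: "- (1 - \<nu>) / s = - e" by (simp only: e_def minus_divide_left)
      have \<sigma>e: "\<bar>\<sigma>\<bar> \<le> \<kappa>\<^sub>0 * e" using \<sigma> s1 by (simp add: e_def field_simps)
      have E: "exp (\<kappa>\<^sub>0 * \<bar>avg b x0 r0 - avg b x r\<bar>) \<le> Q * (V / V0)"
        unfolding V_def V0_def by (rule Qle[OF r0(1) r x])
      have "exp (\<bar>\<sigma>\<bar> * \<bar>avg b x0 r0 - avg b x r\<bar>) \<le> exp (\<kappa>\<^sub>0 * \<bar>avg b x0 r0 - avg b x r\<bar>) powr e"
        using mult_right_mono[OF \<sigma>e, of "\<bar>avg b x0 r0 - avg b x r\<bar>"] by (simp add: exp_powr_real mult_ac)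
      also have "\<dots> \<le> (Q * (V / V0)) powr e" using E e by (intro powr_mono2) auto
      also have "\<dots> = Q powr e * (V powr e * V0 powr - e)" by (simp add: powr_mult powr_divide powr_minus_divide)
      also have "\<dots> \<le> Q * (V powr e * V0 powr - e)"
        using powr_mono[of e 1 Q] e Q by (intro mult_right_mono) auto
      finally have E2: "exp (\<bar>\<sigma>\<bar> * \<bar>avg b x0 r0 - avg b x r\<bar>) \<le> Q * (V powr e * V0 powr - e)" .
      have "\<sigma> * (b x - avg b x r) \<le> \<bar>\<sigma>\<bar> * \<bar>b x - avg b x r\<bar>" by (metis abs_ge_self abs_mult)
      also have "\<dots> \<le> \<bar>\<sigma>\<bar> * (\<bar>b x - avg b x0 r0\<bar> + \<bar>avg b x0 r0 - avg b x r\<bar>)" by (intro mult_left_mono) auto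
      finally have "exp (\<sigma> * (b x - avg b x r)) \<le> exp (\<bar>\<sigma>\<bar> * \<bar>b x - avg b x0 r0\<bar>) * exp (\<bar>\<sigma>\<bar> * \<bar>avg b x0 r0 - avg b x r\<bar>)"
        by (simp add: distrib_left flip: exp_add)
      also have "\<dots> \<le> exp (\<bar>\<sigma>\<bar> * \<bar>b x - avg b x0 r0\<bar>) * (Q * (V powr e * V0 powr - e))" by (intro mult_left_mono E2) simp
      finally have E3: "exp (\<sigma> * (b x - avg b x r)) \<le> exp (\<bar>\<sigma>\<bar> * \<bar>b x - avg b x0 r0\<bar>) * (Q * (V powr e * V0 powr - e))" .
      have "exp_integral b \<kappa> g x r \<le> ennreal (C * K * V powr (- (1 - \<nu>) / s) * V)"
        unfolding V_def using K by (intro morrey_exp_average[OF osc C s1(1) s' \<kappa>s' _ g rpos]) auto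
      also have "- (1 - \<nu>) / s = - e" by (rule ne)
      finally have "ennreal (exp (\<sigma> * (b x - avg b x r))) * exp_integral b \<kappa> g x r
         \<le> ennreal (exp (\<bar>\<sigma>\<bar> * \<bar>b x - avg b x0 r0\<bar>) * (Q * (V powr e * V0 powr - e))) * ennreal (C * K * V powr - e * V)"
        using E3 by (intro mult_mono ennreal_leI) auto
      also have "\<dots> = ennreal (exp (\<bar>\<sigma>\<bar> * \<bar>b x - avg b x0 r0\<bar>) * Q * (V powr e * V powr - e) * V0 powr - e * C * K * V)"
        using Q C K V by (simp add: mult_ac flip: ennreal_mult)
      also have "V powr e * V powr - e = 1" using V by (simp flip: powr_add)
      also have "exp (\<bar>\<sigma>\<bar> * \<bar>b x - avg b x0 r0\<bar>) * Q * 1 * V0 powr - e * C * K * V = H2 x * V"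
        unfolding H2_def ne by (simp add: mult_ac)
      finally show ?thesis by (simp add: V_def)
    qed
    show "ball_majorized (weighted_maximal b \<sigma> \<kappa> R g) s \<nu> (4 * (c1 + c2) * K) x0 r0"
      unfolding ball_majorized_def
    proof (intro bexI[of _ "\<lambda>x. H1 x + H2 x"] conjI)
      show "\<forall>x. 0 \<le> H1 x + H2 x" using H10 H20 by (simp add: add_nonneg_nonneg)
      have "(\<integral>\<^sup>+x\<in>ball x0 r0. ennreal ((H1 x + H2 x) powr s) \<partial>M) \<le> ennreal ((4 * (c1 * K + c2 * K)) powr s * V0 powr \<nu>)"
        using s1 c1 QC K by (intro nn_integral_powr_add_le H1B H2B) (auto simp: H10 H20)
      then show "(\<integral>\<^sup>+x\<in>ball x0 r0. ennreal ((H1 x + H2 x) powr s) \<partial>M) \<le> ennreal ((4 * (c1 + c2) * K) powr s * m (ball x0 r0) powr \<nu>)"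
        by (simp add: V0_def algebra_simps)
      show "AE x in M. x \<in> ball x0 r0 \<longrightarrow> weighted_maximal b \<sigma> \<kappa> R g x \<le> ennreal (H1 x + H2 x)"
        using H1AE
      proof (eventually_elim, subst weighted_maximal_le_iff, (use H10 H20 in \<open>simp add: add_nonneg_nonneg\<close>), intro impI allI)
        fix x r
        assume "weighted_maximal b \<sigma> \<kappa> R f x \<le> ennreal (H1 x)" and x: "x \<in> ball x0 r0" and r: "0 < r \<and> r \<le> R"
        then have H: "ennreal (exp (\<sigma> * (b x - avg b x r))) * exp_integral b \<kappa> f x r \<le> ennreal (H1 x * m (ball x r))"
          using H10 by (subst (asm) weighted_maximal_le_iff) auto
        show "ennreal (exp (\<sigma> * (b x - avg b x r))) *
          exp_integral b \<kappa> g x r \<le> ennreal ((H1 x + H2 x) * m (ball x r))"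
        proof (cases "r \<le> r0")
          case True
          have sub: "ball x r \<subseteq> ball x0 r1"
            using ball_subset_center_in(1)[OF x] ball_mono[OF True, of x] unfolding r1_def by blast
          have "exp_integral b \<kappa> g x r
            \<le> exp_integral b \<kappa> f x r"
            using gF
          proof (intro nn_integral_mono_AE, eventually_elim)
            case (elim y)
            have "ennreal (exp (\<kappa> * \<bar>b y - avg b x r\<bar>)) * g y \<le> ennreal (exp (\<kappa> * \<bar>b y - avg b x r\<bar>)) * ennreal (f y)" if "y \<in> ball x r"
              using elim that sub by (intro mult_left_mono) (auto simp: f_def)
            then show ?case by (auto simp: indicator_def)
          qed
          then have "ennreal (exp (\<sigma> * (b x - avg b x r))) * exp_integral b \<kappa> g x r
             \<le> ennreal (exp (\<sigma> * (b x - avg b x r))) * exp_integral b \<kappa> f x r"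
            by (intro mult_left_mono) auto
          also have "\<dots> \<le> ennreal (H1 x * m (ball x r))" by (rule H)
          also have "\<dots> \<le> ennreal ((H1 x + H2 x) * m (ball x r))" using H20 by (intro ennreal_leI mult_right_mono) auto
          finally show ?thesis .
        next
          case False
          have "ennreal (H2 x * m (ball x r)) \<le> ennreal ((H1 x + H2 x) * m (ball x r))" using H10 by (intro ennreal_leI mult_right_mono) auto
          then show ?thesis using large[OF x, of r] False by auto
        qed
      qed
    qed measurable
  qed
qed

end

section \<open>Hedberg's inequality for commutators\<close>

context nondegenerate_homogeneous_space
begin

text \<open>For fixed x this is a monotone function of the radius composed with \<open>d x\<close>,
  whose sublevel sets are balls.\<close>

lemma potential_kernel_measurable [measurable]:
  "(\<lambda>y. measure M (ball x (d x y))) \<in> borel_measurable M"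
proof -
  have "mono (\<lambda>r. m (ball x r))" by (intro monoI finite_measure_mono ball_mono) auto
  then have "(\<lambda>r. m (ball x r)) \<in> borel_measurable borel" by (rule borel_measurable_mono)
  moreover have "(\<lambda>y. d x y) \<in> borel_measurable M"
    unfolding borel_measurable_iff_less
    using ball_sets[of x] by (simp add: space_UNIV qball_def)
  ultimately show ?thesis using measurable_compose by blast
qed

lemma potential_integrand_measurable [measurable]:
  assumes [measurable]: "f \<in> borel_measurable M"
  shows "potential_integrand M d \<alpha> f x \<in> borel_measurable M"
  unfolding potential_integrand_def by measurable

text \<open>The summand 1 makes finiteness at x control the potential of
  \<open>\<bar>f\<bar>\<close> as well, and with it that of \<open>\<bar>b * f\<bar>\<close>; this
  is the source of \<open>commutator_well_defined\<close>.\<close>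

definition commutator_majorant :: "real \<Rightarrow> ('a \<Rightarrow> real) \<Rightarrow> ('a \<Rightarrow> real) \<Rightarrow> 'a \<Rightarrow> ennreal" where
  "commutator_majorant \<alpha> b f x = (\<integral>\<^sup>+y. ennreal ((1 + \<bar>b x - b y\<bar>) * \<bar>potential_integrand M d \<alpha> f x y\<bar>) \<partial>M)"

text \<open>Between two consecutive radii the kernel is constant up to a power of the dilation
  constant, and integrating over the full ball instead of the shell only increases the
  bound.\<close>

lemma kernel_shell_decomposition:
  assumes \<Lambda>: "1 < \<Lambda>" "\<And>r. 0 < r \<Longrightarrow> m (ball x (\<Lambda> * r)) \<le> C * m (ball x r)" "1 \<le> C"
    and \<alpha>: "0 \<le> \<alpha>" "\<alpha> \<le> 1" and h[measurable]: "h \<in> borel_measurable M" and h0: "\<And>y. 0 \<le> h y"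
  shows "(\<integral>\<^sup>+y. ennreal (h y / m (ball x (d x y)) powr (1 - \<alpha>)) \<partial>M)
    \<le> (\<Sum>k. ennreal (C * m (ball x (2 * qdiam d / \<Lambda> ^ k)) powr (\<alpha> - 1)) * (\<integral>\<^sup>+y\<in>ball x (2 * qdiam d / \<Lambda> ^ k). ennreal (h y) \<partial>M))"
proof -
  define \<rho> where "\<rho> k = 2 * qdiam d / \<Lambda> ^ k" for k :: nat
  have \<rho>: "0 < \<rho> k" "\<rho> k = \<Lambda> * \<rho> (Suc k)" for k using \<Lambda> diam_pos by (auto simp: \<rho>_def)
  have "(\<integral>\<^sup>+y. ennreal (h y / m (ball x (d x y)) powr (1 - \<alpha>)) \<partial>M)
    \<le> (\<integral>\<^sup>+y. (\<Sum>k. ennreal (C * m (ball x (\<rho> k)) powr (\<alpha> - 1)) * (ennreal (h y) * indicator (ball x (\<rho> k)) y)) \<partial>M)"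
  proof (rule nn_integral_mono)
    fix y
    show "ennreal (h y / m (ball x (d x y)) powr (1 - \<alpha>))
      \<le> (\<Sum>k. ennreal (C * m (ball x (\<rho> k)) powr (\<alpha> - 1)) * (ennreal (h y) * indicator (ball x (\<rho> k)) y))"
    \<comment> \<open>At y = x the ball in the kernel is empty, and division by 0 makes the
      integrand 0.\<close>
    proof (cases "y = x")
      case True
      have "ball x 0 = {}" by (auto simp: mem_ball dest: le_less_trans[OF d_nonneg])
      then show ?thesis using True by simp
    next
      case False
      then have dpos: "0 < d x y" using d_nonneg[of x y] d_eq_0_iff[of x y] by auto
      define P where "P k \<longleftrightarrow> \<rho> k \<le> d x y" for k
      have "\<exists>k. P k"
      proof -
        obtain k where "2 * qdiam d / d x y < \<Lambda> ^ k" using real_arch_pow[OF \<Lambda>(1)] by blast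
        then show ?thesis using dpos \<Lambda> by (intro exI[of _ k]) (simp add: P_def \<rho>_def field_simps)
      qed
      \<comment> \<open>The radii start at twice the diameter so that every y lies in the ball of
        index 0; k is then the last index whose ball contains y.\<close>
      moreover have "\<not> P 0" using d_le_diam[of x y] diam_pos by (simp add: P_def \<rho>_def)
      ultimately obtain k where k: "\<not> P k" "P (Suc k)" using LeastI_ex[of P] not_less_Least[of _ P]
        by (metis lessI not0_implies_Suc)
      define V where "V = m (ball x (\<rho> k))"
      have V: "0 < V" unfolding V_def by (intro measure_ball_pos \<rho>)
      have "V \<le> C * m (ball x (\<rho> (Suc k)))" unfolding V_def \<rho>(2)[of k] by (intro \<Lambda>(2) \<rho>)
      also have "\<dots> \<le> C * m (ball x (d x y))" using k \<Lambda> by (intro mult_left_mono finite_measure_mono ball_mono) (auto simp: P_def)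
      finally have VC: "V / C \<le> m (ball x (d x y))" using \<Lambda>(3) by (simp add: field_simps)
      have "(V / C) powr (1 - \<alpha>) \<le> m (ball x (d x y)) powr (1 - \<alpha>)" using VC V \<Lambda>(3) \<alpha> by (intro powr_mono2) auto
      then have "h y / m (ball x (d x y)) powr (1 - \<alpha>) \<le> h y / (V / C) powr (1 - \<alpha>)"
        using V \<Lambda>(3) h0 by (intro divide_left_mono mult_pos_pos) (auto intro: less_le_trans)
      also have "\<dots> = C powr (1 - \<alpha>) * V powr (\<alpha> - 1) * h y"
        using powr_minus_divide[of V "1 - \<alpha>"] by (simp add: powr_divide)
      also have "\<dots> \<le> C * V powr (\<alpha> - 1) * h y"
        using powr_mono[of "1 - \<alpha>" 1 C] \<Lambda>(3) \<alpha> h0 by (intro mult_right_mono) auto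
      finally have "ennreal (h y / m (ball x (d x y)) powr (1 - \<alpha>)) \<le> ennreal (C * V powr (\<alpha> - 1) * h y)" by (rule ennreal_leI)
      also have "\<dots> = (\<Sum>j\<in>{k}. ennreal (C * m (ball x (\<rho> j)) powr (\<alpha> - 1)) * (ennreal (h y) * indicator (ball x (\<rho> j)) y))"
        using k(1) \<Lambda>(3) by (simp add: V_def P_def mem_ball not_le indicator_def ennreal_mult')
      also have "\<dots> \<le> (\<Sum>k. ennreal (C * m (ball x (\<rho> k)) powr (\<alpha> - 1)) * (ennreal (h y) * indicator (ball x (\<rho> k)) y))"
        by (intro sum_le_suminf) auto
      finally show ?thesis .
    qed
  qed
  also have "\<dots> = (\<Sum>k. ennreal (C * m (ball x (\<rho> k)) powr (\<alpha> - 1)) * (\<integral>\<^sup>+y\<in>ball x (\<rho> k). ennreal (h y) \<partial>M))"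
    by (simp add: nn_integral_suminf nn_integral_cmult)
  finally show ?thesis by (simp add: \<rho>_def)
qed

lemma one_plus_abs_diff_le_exp:
  fixes x y a \<kappa> :: real
  assumes "0 < \<kappa>" "\<kappa> \<le> 1"
  shows "1 + \<bar>x - y\<bar> \<le> exp (\<kappa> * \<bar>x - a\<bar>) * exp (\<kappa> * \<bar>y - a\<bar>) / \<kappa>\<^sup>2"
proof -
  have e: "1 + t \<le> exp (\<kappa> * t) / \<kappa>" if "0 \<le> t" for t
  proof -
    have "\<kappa> * (1 + t) \<le> 1 + \<kappa> * t" using assms by (simp add: distrib_left)
    also have "\<dots> \<le> exp (\<kappa> * t)" by (rule exp_ge_add_one_self)
    finally show ?thesis using assms by (simp add: field_simps)
  qed
  have "\<bar>x - y\<bar> \<le> \<bar>x - a\<bar> + \<bar>y - a\<bar>" by linarith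
  moreover have "0 \<le> \<bar>x - a\<bar> * \<bar>y - a\<bar>" by simp
  ultimately have "1 + \<bar>x - y\<bar> \<le> (1 + \<bar>x - a\<bar>) * (1 + \<bar>y - a\<bar>)" unfolding distrib_left distrib_right by linarith
  also have "\<dots> \<le> (exp (\<kappa> * \<bar>x - a\<bar>) / \<kappa>) * (exp (\<kappa> * \<bar>y - a\<bar>) / \<kappa>)" using assms by (intro mult_mono e) auto
  finally show ?thesis by (simp add: power2_eq_square)
qed

text \<open>Hedberg's argument with the weight \<open>exp (\<kappa> |b x - b\<^sub>B|)\<close> carried along: it varies slowly from scale to
  scale, so it does not destroy the geometric decay.\<close>

lemma Hedberg_pointwise:
  assumes osc: "exp_oscillation_bound b \<kappa>\<^sub>0 C" and C: "1 \<le> C" and \<kappa>0: "0 < \<kappa>\<^sub>0"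
    and \<Lambda>: "1 < \<Lambda>" "1 \<le> C\<Lambda>" "\<And>r. 0 < r \<Longrightarrow> m (ball x (\<Lambda> * r)) \<le> C\<Lambda> * m (ball x r)"
    and \<eta>: "0 < \<eta>" "\<eta> < 1" "\<And>r. 0 < r \<Longrightarrow> r \<le> 2 * qdiam d \<Longrightarrow> m (ball x (r / \<Lambda>)) \<le> (1 - \<eta>) * m (ball x r)"
    and \<kappa>: "0 < \<kappa>" "\<kappa> \<le> 1" and c1: "1 < c1" "(C * C\<Lambda>) powr (\<kappa> / \<kappa>\<^sub>0) \<le> c1" "c1 * c1 \<le> (1 / (1 - \<eta>)) powr ((1 - \<nu>) / t)"
    and \<nu>: "\<nu> < 1" and st: "0 < s" "s < t" "1 / s - 1 / t = \<alpha> / (1 - \<nu>)" and \<alpha>: "0 \<le> \<alpha>" "\<alpha> \<le> 1"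
    and \<omega>\<^sub>0: "0 < \<omega>\<^sub>0" "\<omega>\<^sub>0 \<le> t / s - 1"
    and f[measurable]: "f \<in> borel_measurable M" and K: "0 < K" and H: "0 \<le> H"
    and max: "\<And>r. 0 < r \<Longrightarrow> r \<le> 2 * qdiam d \<Longrightarrow> ennreal (exp (\<kappa> * (t / s) * \<bar>b x - avg b x r\<bar>)) *
       exp_integral b \<kappa> (\<lambda>y. ennreal \<bar>f y\<bar>) x r \<le> ennreal (H * m (ball x r))"
    and morrey: "\<And>r. 0 < r \<Longrightarrow> exp_integral b \<kappa> (\<lambda>y. ennreal \<bar>f y\<bar>) x r
       \<le> ennreal (K * m (ball x r) powr (- (1 - \<nu>) / s) * m (ball x r))"
  shows "commutator_majorant \<alpha> b f x
    \<le> ennreal (C\<Lambda> / \<kappa>\<^sup>2 * (1 / (1 - 1 / c1) + 1 / (1 - c1 powr - \<omega>\<^sub>0)) * (H powr (s / t) * K powr (1 - s / t)))"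
proof -
  have bm[measurable]: "b \<in> borel_measurable M" by (rule exp_oscillation_boundD[OF osc])
  define \<rho> where "\<rho> k = 2 * qdiam d / \<Lambda> ^ k" for k :: nat
  have \<rho>: "0 < \<rho> k" "\<rho> k = \<Lambda> * \<rho> (Suc k)" "\<rho> (Suc k) = \<rho> k / \<Lambda>" for k using \<Lambda> diam_pos by (auto simp: \<rho>_def)
  have \<rho>le: "\<rho> k \<le> 2 * qdiam d" for k
    using \<Lambda>(1) diam_pos one_le_power[of \<Lambda> k] by (simp add: \<rho>_def divide_le_eq mult_le_cancel_left1)
  define V where "V k = m (ball x (\<rho> k))" for k
  have V: "0 < V k" for k unfolding V_def by (intro measure_ball_pos \<rho>)
  define a where "a k = avg b x (\<rho> k)" for k
  define \<beta> where "\<beta> k = \<kappa> * \<bar>b x - a k\<bar>" for k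
  define I where "I k = (\<integral>\<^sup>+y\<in>ball x (\<rho> k). ennreal (exp (\<kappa> * \<bar>b y - a k\<bar>)) * ennreal \<bar>f y\<bar> \<partial>M)" for k
  define i where "i k = enn2real (I k)" for k
  have Imor: "I k \<le> ennreal (K * V k powr (- (1 - \<nu>) / s) * V k)" for k
    unfolding I_def a_def V_def by (intro morrey \<rho>)
  have Ii: "I k = ennreal (i k)" for k
    unfolding i_def using le_less_trans[OF Imor[of k]] by simp
  have i0: "0 \<le> i k" for k by (simp add: i_def)
  have i1: "i k \<le> K * V k powr (- (1 - \<nu>) / s) * V k" for k
    using Imor[of k] K V[of k] unfolding Ii by (simp add: ennreal_le_iff)
  have i2: "exp (t / s * \<beta> k) * i k \<le> H * V k" for k
  proof -
    have "ennreal (exp (\<kappa> * (t / s) * \<bar>b x - a k\<bar>)) * I k \<le> ennreal (H * V k)"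
      unfolding I_def a_def V_def by (intro max \<rho> \<rho>le)
    then have "exp (\<kappa> * (t / s) * \<bar>b x - a k\<bar>) * i k \<le> H * V k"
      using H V[of k] i0[of k] unfolding Ii by (simp add: ennreal_le_iff flip: ennreal_mult)
    then show ?thesis by (simp add: \<beta>_def mult_ac)
  qed
  define \<omega> where "\<omega> = t / s - 1"
  \<comment> \<open>In terms of D the two bounds on T take the form required by
    \<open>Hedberg_sum\<close>: the maximal bound becomes \<open>D k powr - \<omega> * H\<close> and
    the Morrey bound \<open>D k * K\<close>.\<close>
  define D where "D k = exp (\<beta> k) * V k powr (- (1 - \<nu>) / t)" for k
  define T where "T k = exp (\<beta> k) * V k powr (\<alpha> - 1) * i k" for k
  have t: "0 < t" using st by linarith
  have st1: "1 / (1 + \<omega>) = s / t" "\<omega> / (1 + \<omega>) = 1 - s / t" using st t by (auto simp: \<omega>_def field_simps)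
  have D0: "0 < D k" for k using V[of k] by (simp add: D_def)
  \<comment> \<open>From one scale to the next the weight can lose a factor \<open>c1\<close> by the
    drift of averages, while reverse doubling gains \<open>c1 * c1\<close> through the measure; D
    still grows by \<open>c1\<close>.\<close>
  have step: "c1 * D k \<le> D (Suc k)" for k
  proof -
    have sub: "ball x (\<rho> (Suc k)) \<subseteq> ball x (\<rho> k)"
      using \<Lambda>(1) \<rho>(1)[of "Suc k"] by (intro ball_mono) (simp add: \<rho>(2)[of k])
    have "exp (\<kappa>\<^sub>0 * \<bar>a (Suc k) - a k\<bar>) * V (Suc k) \<le> C * V k"
      unfolding a_def V_def using C \<kappa>0 by (intro exp_avg_diff_nested_ball[OF osc] \<rho> sub) auto
    also have "\<dots> \<le> C * (C\<Lambda> * V (Suc k))" unfolding V_def \<rho>(2)[of k] using C by (intro mult_left_mono \<Lambda>(3) \<rho>) auto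
    finally have "exp (\<kappa>\<^sub>0 * \<bar>a (Suc k) - a k\<bar>) \<le> C * C\<Lambda>" using V[of "Suc k"] by (simp add: mult.assoc[symmetric])
    then have "exp (\<kappa>\<^sub>0 * \<bar>a (Suc k) - a k\<bar>) powr (\<kappa> / \<kappa>\<^sub>0) \<le> (C * C\<Lambda>) powr (\<kappa> / \<kappa>\<^sub>0)" using \<kappa> \<kappa>0 by (intro powr_mono2) auto
    also have "\<dots> \<le> c1" by (rule c1)
    finally have ec: "exp (\<kappa> * \<bar>a (Suc k) - a k\<bar>) \<le> c1" using \<kappa>0 by (simp add: exp_powr_real mult.commute)
    have "\<bar>b x - a k\<bar> \<le> \<bar>b x - a (Suc k)\<bar> + \<bar>a (Suc k) - a k\<bar>" by linarith
    then have "\<beta> k \<le> \<beta> (Suc k) + \<kappa> * \<bar>a (Suc k) - a k\<bar>"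
      unfolding \<beta>_def using \<kappa> by (metis distrib_left less_imp_le mult_left_mono)
    then have "exp (\<beta> k) \<le> exp (\<beta> (Suc k)) * exp (\<kappa> * \<bar>a (Suc k) - a k\<bar>)" by (simp flip: exp_add)
    also have "\<dots> \<le> exp (\<beta> (Suc k)) * c1" by (intro mult_left_mono ec) simp
    finally have E: "exp (\<beta> k) \<le> exp (\<beta> (Suc k)) * c1" .
    define e where "e = (1 - \<nu>) / t"
    have e: "0 \<le> e" using \<nu> t by (simp add: e_def)
    have ne: "- (1 - \<nu>) / t = - e" by (simp only: e_def minus_divide_left)
    have "V (Suc k) \<le> (1 - \<eta>) * V k" unfolding V_def \<rho>(3)[of k] by (intro \<eta>(3) \<rho> \<rho>le)
    then have "1 / (1 - \<eta>) \<le> V k / V (Suc k)" using V[of "Suc k"] \<eta> by (simp add: field_simps)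
    then have "(1 / (1 - \<eta>)) powr e \<le> (V k / V (Suc k)) powr e" using e \<eta> by (intro powr_mono2) auto
    then have cV: "c1 * c1 \<le> V k powr e / V (Suc k) powr e" using c1(3) by (simp add: e_def powr_divide)
    have "c1 * D k = c1 * exp (\<beta> k) * V k powr - e" unfolding D_def ne by simp
    also have "\<dots> \<le> c1 * (exp (\<beta> (Suc k)) * c1) * V k powr - e" using c1 by (intro mult_right_mono mult_left_mono E) auto
    also have "\<dots> = exp (\<beta> (Suc k)) * V k powr - e * (c1 * c1)" by (simp add: mult_ac)
    also have "\<dots> \<le> exp (\<beta> (Suc k)) * V k powr - e * (V k powr e / V (Suc k) powr e)" by (intro mult_left_mono cV) auto
    also have "\<dots> = exp (\<beta> (Suc k)) * (V k powr - e * V k powr e) / V (Suc k) powr e" by simp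
    also have "V k powr - e * V k powr e = 1" using V[of k] by (simp flip: powr_add)
    also have "exp (\<beta> (Suc k)) * 1 / V (Suc k) powr e = D (Suc k)" unfolding D_def ne by (simp add: powr_minus_divide)
    finally show ?thesis .
  qed
  have VV: "V k powr (\<alpha> - 1) * V k = V k powr \<alpha>" for k
    using V[of k] powr_mult_base[of "V k" "\<alpha> - 1"] by (simp add: mult.commute)
  \<comment> \<open>The relation between s, t, \<open>\<alpha>\<close> and \<open>\<nu>\<close>, in
    the two forms in which the exponents of V are matched below.\<close>
  have \<alpha>e: "(1 - \<nu>) / t * \<omega> = \<alpha>" "\<alpha> + - (1 - \<nu>) / s = - (1 - \<nu>) / t"
  proof -
    have "(1 - \<nu>) / t * \<omega> = (1 - \<nu>) * (1 / s - 1 / t)" using st t by (simp add: \<omega>_def field_simps)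
    then show "(1 - \<nu>) / t * \<omega> = \<alpha>" using st(3) \<nu> by simp
    have "\<alpha> = (1 - \<nu>) * (1 / s - 1 / t)" using st(3) \<nu> by simp
    also have "\<dots> = (1 - \<nu>) / s - (1 - \<nu>) / t" by (simp add: right_diff_distrib)
    finally show "\<alpha> + - (1 - \<nu>) / s = - (1 - \<nu>) / t" by (simp only: minus_divide_left[symmetric])
  qed
  have T1: "T k \<le> D k powr - \<omega> * H" for k
  proof -
    have "T k = exp (\<beta> k - t / s * \<beta> k) * V k powr (\<alpha> - 1) * (exp (t / s * \<beta> k) * i k)"
      by (simp add: T_def exp_diff)
    also have "\<dots> \<le> exp (\<beta> k - t / s * \<beta> k) * V k powr (\<alpha> - 1) * (H * V k)" by (intro mult_left_mono i2) auto
    also have "\<dots> = exp (\<beta> k - t / s * \<beta> k) * (V k powr (\<alpha> - 1) * V k) * H" by (simp add: mult_ac)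
    also have "exp (\<beta> k - t / s * \<beta> k) = exp (\<beta> k) powr - \<omega>" by (simp add: exp_powr_real \<omega>_def algebra_simps)
    also have "V k powr (\<alpha> - 1) * V k = (V k powr (- (1 - \<nu>) / t)) powr - \<omega>"
    proof -
      have "- (1 - \<nu>) / t * - \<omega> = \<alpha>"
        by (simp only: minus_divide_left[symmetric] minus_mult_minus \<alpha>e(1))
      then show ?thesis by (simp only: VV powr_powr)
    qed
    also have "exp (\<beta> k) powr - \<omega> * (V k powr (- (1 - \<nu>) / t)) powr - \<omega> = D k powr - \<omega>" by (simp only: D_def powr_mult)
    finally show ?thesis .
  qed
  have T2: "T k \<le> D k * K" for k
  proof -
    have "T k \<le> exp (\<beta> k) * V k powr (\<alpha> - 1) * (K * V k powr (- (1 - \<nu>) / s) * V k)"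
      unfolding T_def by (intro mult_left_mono i1) auto
    also have "\<dots> = exp (\<beta> k) * ((V k powr (\<alpha> - 1) * V k) * V k powr (- (1 - \<nu>) / s)) * K" by (simp add: mult_ac)
    also have "(V k powr (\<alpha> - 1) * V k) * V k powr (- (1 - \<nu>) / s) = V k powr (- (1 - \<nu>) / t)"
      by (simp only: VV powr_add[symmetric] \<alpha>e(2))
    finally show ?thesis by (simp add: D_def)
  qed
  define c where "c = 1 / (1 - 1 / c1) + 1 / (1 - c1 powr - \<omega>\<^sub>0)"
  have sumT: "(\<Sum>k<N. T k) \<le> c * (H powr (s / t) * K powr (1 - s / t))" for N
    unfolding c_def st1(2)[symmetric] unfolding st1(1)[symmetric] using \<omega>\<^sub>0 H K D0 step T1 T2 c1(1)
    by (intro Hedberg_sum[where D = D]) (auto simp: \<omega>_def)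
  define h where "h y = (1 + \<bar>b x - b y\<bar>) * \<bar>f y\<bar>" for y
  have hm[measurable]: "h \<in> borel_measurable M" unfolding h_def by measurable
  have C\<Lambda>0: "0 \<le> C\<Lambda> / \<kappa>\<^sup>2" using \<Lambda> by simp
  have "commutator_majorant \<alpha> b f x
      = (\<integral>\<^sup>+y. ennreal (h y / m (ball x (d x y)) powr (1 - \<alpha>)) \<partial>M)"
    unfolding commutator_majorant_def by (intro nn_integral_cong) (simp add: h_def potential_integrand_def)
  also have "\<dots> \<le> (\<Sum>k. ennreal (C\<Lambda> * V k powr (\<alpha> - 1)) * (\<integral>\<^sup>+y\<in>ball x (\<rho> k). ennreal (h y) \<partial>M))"
    unfolding V_def \<rho>_def by (rule kernel_shell_decomposition[OF \<Lambda>(1,3,2) \<alpha>]) (auto simp: h_def)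
  also have "\<dots> \<le> (\<Sum>k. ennreal (C\<Lambda> / \<kappa>\<^sup>2 * T k))"
  proof (intro suminf_le)
    fix k
    have "(\<integral>\<^sup>+y\<in>ball x (\<rho> k). ennreal (h y) \<partial>M)
       \<le> (\<integral>\<^sup>+y. ennreal (exp (\<beta> k) / \<kappa>\<^sup>2) * (ennreal (exp (\<kappa> * \<bar>b y - a k\<bar>)) * ennreal \<bar>f y\<bar> * indicator (ball x (\<rho> k)) y) \<partial>M)"
    proof (rule nn_integral_mono)
      fix y
      have "h y \<le> exp (\<beta> k) * exp (\<kappa> * \<bar>b y - a k\<bar>) / \<kappa>\<^sup>2 * \<bar>f y\<bar>"
        unfolding h_def \<beta>_def by (intro mult_right_mono one_plus_abs_diff_le_exp \<kappa>) simp
      then have "ennreal (h y) \<le> ennreal ((exp (\<beta> k) / \<kappa>\<^sup>2) * (exp (\<kappa> * \<bar>b y - a k\<bar>) * \<bar>f y\<bar>))"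
        by (intro ennreal_leI) simp
      also have "\<dots> = ennreal (exp (\<beta> k) / \<kappa>\<^sup>2) * ennreal (exp (\<kappa> * \<bar>b y - a k\<bar>) * \<bar>f y\<bar>)"
        by (rule ennreal_mult) auto
      also have "ennreal (exp (\<kappa> * \<bar>b y - a k\<bar>) * \<bar>f y\<bar>) = ennreal (exp (\<kappa> * \<bar>b y - a k\<bar>)) * ennreal \<bar>f y\<bar>"
        by (rule ennreal_mult) auto
      finally have "ennreal (h y) \<le> ennreal (exp (\<beta> k) / \<kappa>\<^sup>2) * (ennreal (exp (\<kappa> * \<bar>b y - a k\<bar>)) * ennreal \<bar>f y\<bar>)" .
      then show "ennreal (h y) * indicator (ball x (\<rho> k)) y
         \<le> ennreal (exp (\<beta> k) / \<kappa>\<^sup>2) * (ennreal (exp (\<kappa> * \<bar>b y - a k\<bar>)) * ennreal \<bar>f y\<bar> * indicator (ball x (\<rho> k)) y)"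
        by (auto simp: indicator_def)
    qed
    also have "\<dots> = ennreal (exp (\<beta> k) / \<kappa>\<^sup>2) * I k" unfolding I_def by (rule nn_integral_cmult) measurable
    finally have "ennreal (C\<Lambda> * V k powr (\<alpha> - 1)) * (\<integral>\<^sup>+y\<in>ball x (\<rho> k). ennreal (h y) \<partial>M)
       \<le> ennreal (C\<Lambda> * V k powr (\<alpha> - 1)) * (ennreal (exp (\<beta> k) / \<kappa>\<^sup>2) * ennreal (i k))"
      unfolding Ii by (intro mult_left_mono) auto
    also have "\<dots> = ennreal (C\<Lambda> / \<kappa>\<^sup>2 * T k)" using \<Lambda>(2) i0[of k] by (simp add: T_def mult_ac flip: ennreal_mult)
    finally show "ennreal (C\<Lambda> * V k powr (\<alpha> - 1)) * (\<integral>\<^sup>+y\<in>ball x (\<rho> k). ennreal (h y) \<partial>M) \<le> ennreal (C\<Lambda> / \<kappa>\<^sup>2 * T k)" .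
  qed auto
  also have "\<dots> \<le> ennreal (C\<Lambda> / \<kappa>\<^sup>2 * (c * (H powr (s / t) * K powr (1 - s / t))))"
    unfolding suminf_eq_SUP
  proof (rule SUP_least)
    fix N
    have "(\<Sum>k<N. ennreal (C\<Lambda> / \<kappa>\<^sup>2 * T k)) = ennreal (\<Sum>k<N. C\<Lambda> / \<kappa>\<^sup>2 * T k)"
      using i0 by (intro sum_ennreal mult_nonneg_nonneg C\<Lambda>0) (simp add: T_def)
    also have "(\<Sum>k<N. C\<Lambda> / \<kappa>\<^sup>2 * T k) = C\<Lambda> / \<kappa>\<^sup>2 * (\<Sum>k<N. T k)" by (simp only: sum_distrib_left)
    also have "ennreal \<dots> \<le> ennreal (C\<Lambda> / \<kappa>\<^sup>2 * (c * (H powr (s / t) * K powr (1 - s / t))))"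
      by (intro ennreal_leI mult_left_mono sumT C\<Lambda>0)
    finally show "(\<Sum>k<N. ennreal (C\<Lambda> / \<kappa>\<^sup>2 * T k)) \<le> ennreal (C\<Lambda> / \<kappa>\<^sup>2 * (c * (H powr (s / t) * K powr (1 - s / t))))" .
  qed
  finally show ?thesis by (simp add: c_def mult.assoc)
qed

end

section \<open>Maximal commutators on Morrey spaces\<close>

lemma ennpowr_ennreal: "0 \<le> x \<Longrightarrow> ennpowr (ennreal x) s = ennreal (x powr s)"
  by (simp add: ennpowr_def)

lemma ennpowr_mono: "x \<le> y \<Longrightarrow> 0 \<le> s \<Longrightarrow> ennpowr x s \<le> ennpowr y s"
  by (auto simp: ennpowr_def top_unique less_top enn2real_mono intro!: ennreal_leI powr_mono2)

section \<open>Morrey norms versus majorants, and the operator bounds\<close>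

context nondegenerate_homogeneous_space
begin

lemma measure_UNIV_pos: "0 < m UNIV"
  using measure_ball_pos[of "qdiam d + 1" undefined] diam_pos by (simp add: ball_UNIV)

lemma measure_UNIV_le:
  assumes "qdiam d \<le> r"
  shows "m UNIV \<le> C\<^sub>d * m (ball x r)"
proof -
  have "m UNIV = m (ball x (2 * qdiam d))" using diam_pos by (simp add: ball_UNIV)
  also have "\<dots> \<le> C\<^sub>d * m (ball x (qdiam d))" by (rule doubling_all[OF diam_pos])
  also have "\<dots> \<le> C\<^sub>d * m (ball x r)" using assms Cd_gt_1 by (intro mult_left_mono finite_measure_mono ball_mono) auto
  finally show ?thesis .
qed

text \<open>\<open>morrey_norm\<close> sees only radii below the diameter, so control on the whole
  space must come from finitely many admissible balls. By doubling, balls of one fixed radius have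
  measure bounded below, which makes the disjoint Vitali family finite.\<close>

lemma finite_cover_half_diam:
  obtains G where "finite G" "(\<Union>y\<in>G. ball y (qdiam d / 2)) = UNIV"
proof -
  define k where "k = 5 * qK ^ 3"
  have k: "1 \<le> k" using one_le_power[OF qK_ge_1, of 3] by (simp add: k_def)
  define \<rho> where "\<rho> = qdiam d / (2 * k)"
  have \<rho>: "0 < \<rho>" "k * \<rho> = qdiam d / 2" using k diam_pos by (auto simp: \<rho>_def)
  obtain G where G: "G \<subseteq> UNIV" "disjoint_family_on (\<lambda>x. ball x \<rho>) G"
    "\<And>x. x \<in> UNIV \<Longrightarrow> \<exists>y\<in>G. ball x \<rho> \<inter> ball y \<rho> \<noteq> {} \<and> \<rho> \<le> 2 * \<rho>"
    by (rule vitali_covering[of UNIV "\<lambda>_. \<rho>" \<rho>]) (use \<rho> in auto)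
  obtain C where C: "1 \<le> C" "\<And>x r. 0 < r \<Longrightarrow> m (ball x (4 * k * r)) \<le> C * m (ball x r)"
    using dilation_bound[of "4 * k"] by blast
  have lower: "m UNIV / C \<le> m (ball y \<rho>)" for y
  proof -
    have k\<rho>: "4 * k * \<rho> = 2 * qdiam d" using \<rho>(2) by (simp add: mult_ac)
    have "m UNIV = m (ball y (4 * k * \<rho>))" unfolding k\<rho> using diam_pos by (simp add: ball_UNIV)
    then show ?thesis using C(2)[OF \<rho>(1), of y] C(1) by (simp add: field_simps)
  qed
  have fG: "finite G"
    using measure_UNIV_pos C(1) lower
    by (intro finite_disjoint_family_measure_ge[OF G(2), of "m UNIV / C"]) auto
  have r: "5 * qK ^ 3 * \<rho> = qdiam d / 2" using \<rho>(2) by (simp add: k_def)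
  have "x \<in> (\<Union>y\<in>G. ball y (qdiam d / 2))" for x
  proof -
    obtain y where y: "y \<in> G" "ball x \<rho> \<inter> ball y \<rho> \<noteq> {}" using G(3)[of x] by blast
    have "ball x \<rho> \<subseteq> ball y (qdiam d / 2)" using y(2) \<rho> unfolding r[symmetric] by (intro ball_engulf) auto
    moreover have "x \<in> ball x \<rho>" using \<rho> by (simp add: mem_ball)
    ultimately show ?thesis using y(1) by blast
  qed
  then have "(\<Union>y\<in>G. ball y (qdiam d / 2)) = UNIV" by blast
  with fG show thesis by (rule that)
qed

text \<open>N pays for radii from the diameter on: such a ball is covered by finitely many balls of
  half the diameter, and its measure is comparable with that of the whole space.\<close>

lemma morrey_majorized_if_norm_le:
  obtains N where "1 \<le> N"
    "\<And>s \<nu> (f :: 'a \<Rightarrow> real) K. 1 \<le> s \<Longrightarrow> 0 \<le> \<nu> \<Longrightarrow> \<nu> \<le> 1 \<Longrightarrow> f \<in> borel_measurable M \<Longrightarrow> 0 < K \<Longrightarrow>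
      morrey_norm M d s \<nu> (\<lambda>x. ennreal \<bar>f x\<bar>) \<le> ennreal K \<Longrightarrow> morrey_majorized (\<lambda>x. ennreal \<bar>f x\<bar>) s \<nu> (N * K)"
proof -
  obtain G where G: "finite G" "(\<Union>y\<in>G. ball y (qdiam d / 2)) = UNIV" by (rule finite_cover_half_diam)
  define N where "N = max 1 (real (card G) * C\<^sub>d)"
  show thesis
  proof
    show "1 \<le> N" by (simp add: N_def)
    fix s \<nu> K :: real and f :: "'a \<Rightarrow> real"
    assume s: "1 \<le> s" and \<nu>: "0 \<le> \<nu>" "\<nu> \<le> 1" and f[measurable]: "f \<in> borel_measurable M" and K: "0 < K"
      and norm: "morrey_norm M d s \<nu> (\<lambda>x. ennreal \<bar>f x\<bar>) \<le> ennreal K"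
    have KN: "K \<le> N * K" using K by (simp add: N_def mult_le_cancel_right1)
    have small: "(\<integral>\<^sup>+y\<in>ball x r. ennreal (\<bar>f y\<bar> powr s) \<partial>M) \<le> ennreal (K powr s * m (ball x r) powr \<nu>)"
      if r: "0 < r" "r < qdiam d" for x r
    proof -
      define V where "V = m (ball x r) powr \<nu>"
      have V: "0 < V" using measure_ball_pos[OF r(1), of x] by (simp add: V_def)
      define J where "J = (\<integral>\<^sup>+y\<in>ball x r. ennpowr (ennreal \<bar>f y\<bar>) s \<partial>M) / ennreal V"
      have "ennpowr J (1 / s) \<le> morrey_norm M d s \<nu> (\<lambda>x. ennreal \<bar>f x\<bar>)"
        unfolding morrey_norm_def J_def V_def using r by (intro SUP_upper2[of x] SUP_upper2[of r]) auto
      then have le: "ennpowr J (1 / s) \<le> ennreal K" using norm by (rule order_trans)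
      have "J \<noteq> \<infinity>" using le by (auto simp: ennpowr_def top_unique)
      then have "enn2real J powr (1 / s) \<le> K" using le K by (simp add: ennpowr_def)
      then have "(enn2real J powr (1 / s)) powr s \<le> K powr s" using s by (intro powr_mono2) auto
      then have "enn2real J \<le> K powr s" using s by (simp add: powr_powr)
      then have "J \<le> ennreal (K powr s)" using \<open>J \<noteq> \<infinity>\<close> by (metis ennreal_enn2real_if ennreal_leI infinity_ennreal_def)
      then have "(\<integral>\<^sup>+y\<in>ball x r. ennpowr (ennreal \<bar>f y\<bar>) s \<partial>M) \<le> ennreal (K powr s) * ennreal V"
        unfolding J_def using V by (intro ennreal_le_times_if_divide_le) auto
      then show ?thesis by (simp add: ennpowr_ennreal V_def ennreal_mult)
    qed
    have large: "(\<integral>\<^sup>+y\<in>ball x r. ennreal (\<bar>f y\<bar> powr s) \<partial>M) \<le> ennreal ((N * K) powr s * m (ball x r) powr \<nu>)"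
      if r: "qdiam d \<le> r" for x r
    proof -
      have V: "0 < m (ball x r)" using r diam_pos by (intro measure_ball_pos) auto
      have "(\<integral>\<^sup>+y\<in>ball x r. ennreal (\<bar>f y\<bar> powr s) \<partial>M)
        \<le> (\<integral>\<^sup>+y. (\<Sum>z\<in>G. ennreal (\<bar>f y\<bar> powr s) * indicator (ball z (qdiam d / 2)) y) \<partial>M)"
      proof (rule nn_integral_mono)
        fix y
        obtain z where z: "z \<in> G" "y \<in> ball z (qdiam d / 2)" using G(2) by blast
        have "ennreal (\<bar>f y\<bar> powr s) * indicator (ball x r) y \<le> (\<Sum>z\<in>{z}. ennreal (\<bar>f y\<bar> powr s) * indicator (ball z (qdiam d / 2)) y)"
          using z by (simp add: indicator_def)
        also have "\<dots> \<le> (\<Sum>z\<in>G. ennreal (\<bar>f y\<bar> powr s) * indicator (ball z (qdiam d / 2)) y)"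
          using z G(1) by (intro sum_mono2) auto
        finally show "ennreal (\<bar>f y\<bar> powr s) * indicator (ball x r) y \<le> (\<Sum>z\<in>G. ennreal (\<bar>f y\<bar> powr s) * indicator (ball z (qdiam d / 2)) y)" .
      qed
      also have "\<dots> = (\<Sum>z\<in>G. (\<integral>\<^sup>+y\<in>ball z (qdiam d / 2). ennreal (\<bar>f y\<bar> powr s) \<partial>M))" by (simp add: nn_integral_sum)
      also have "\<dots> \<le> (\<Sum>z\<in>G. ennreal (K powr s * m UNIV powr \<nu>))"
      proof (rule sum_mono)
        fix z
        have "(\<integral>\<^sup>+y\<in>ball z (qdiam d / 2). ennreal (\<bar>f y\<bar> powr s) \<partial>M) \<le> ennreal (K powr s * m (ball z (qdiam d / 2)) powr \<nu>)"
          using diam_pos by (intro small) auto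
        also have "\<dots> \<le> ennreal (K powr s * m UNIV powr \<nu>)"
          using \<nu> by (intro ennreal_leI mult_left_mono powr_mono2 finite_measure_mono) auto
        finally show "(\<integral>\<^sup>+y\<in>ball z (qdiam d / 2). ennreal (\<bar>f y\<bar> powr s) \<partial>M) \<le> ennreal (K powr s * m UNIV powr \<nu>)" .
      qed
      also have "\<dots> = ennreal (real (card G) * (K powr s * m UNIV powr \<nu>))" by (simp add: ennreal_mult ennreal_of_nat_eq_real_of_nat)
      also have "\<dots> \<le> ennreal ((N * K) powr s * m (ball x r) powr \<nu>)"
      proof (rule ennreal_leI)
        have "m UNIV powr \<nu> \<le> (C\<^sub>d * m (ball x r)) powr \<nu>" using \<nu> measure_UNIV_le[OF r, of x] by (intro powr_mono2) auto
        also have "\<dots> = C\<^sub>d powr \<nu> * m (ball x r) powr \<nu>" by (simp add: powr_mult)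
        also have "\<dots> \<le> C\<^sub>d * m (ball x r) powr \<nu>" using powr_mono[of \<nu> 1 C\<^sub>d] \<nu> Cd_gt_1 by (intro mult_right_mono) auto
        finally have "real (card G) * (K powr s * m UNIV powr \<nu>) \<le> real (card G) * (K powr s * (C\<^sub>d * m (ball x r) powr \<nu>))"
          by (intro mult_left_mono) auto
        also have "\<dots> = (real (card G) * C\<^sub>d) * (K powr s * m (ball x r) powr \<nu>)" by (simp add: mult_ac)
        also have "\<dots> \<le> N powr s * (K powr s * m (ball x r) powr \<nu>)"
        proof (rule mult_right_mono)
          have "real (card G) * C\<^sub>d \<le> N" by (simp add: N_def)
          also have "\<dots> \<le> N powr s" using s by (intro le_powr_ge_1) (auto simp: N_def)
          finally show "real (card G) * C\<^sub>d \<le> N powr s" .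
        qed simp
        finally show "real (card G) * (K powr s * m UNIV powr \<nu>) \<le> (N * K) powr s * m (ball x r) powr \<nu>"
          by (simp add: powr_mult mult_ac)
      qed
      finally show ?thesis .
    qed
    show "morrey_majorized (\<lambda>x. ennreal \<bar>f x\<bar>) s \<nu> (N * K)"
      unfolding morrey_majorized_def ball_majorized_def
    proof (intro allI impI bexI[of _ "\<lambda>x. \<bar>f x\<bar>"] conjI)
      fix x r assume r: "(0::real) < r"
      show "(\<integral>\<^sup>+y\<in>ball x r. ennreal (\<bar>f y\<bar> powr s) \<partial>M) \<le> ennreal ((N * K) powr s * m (ball x r) powr \<nu>)"
      proof (cases "r < qdiam d")
        case True
        have "K powr s \<le> (N * K) powr s" using K KN s by (intro powr_mono2) auto
        then have "ennreal (K powr s * m (ball x r) powr \<nu>) \<le> ennreal ((N * K) powr s * m (ball x r) powr \<nu>)"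
          by (intro ennreal_leI mult_right_mono) auto
        then show ?thesis using small[OF r True, of x] by (rule order_trans[rotated])
      qed (use large in auto)
    qed auto
  qed
qed

text \<open>\<open>nn_integral\<close> is monotone under comparison almost everywhere for arbitrary
  functions, so measurable majorants bound the norm even if g is not measurable.\<close>

lemma morrey_norm_le_if_majorized:
  assumes g: "morrey_majorized g s \<nu> K" and s: "0 < s" and K: "0 \<le> K"
  shows "morrey_norm M d s \<nu> g \<le> ennreal K"
  unfolding morrey_norm_def
proof (intro SUP_least)
  fix x r assume "r \<in> {0<..<qdiam d}"
  then have r: "0 < r" by simp
  define V where "V = m (ball x r) powr \<nu>"
  have V: "0 < V" using measure_ball_pos[OF r, of x] by (simp add: V_def)
  obtain H where H: "H \<in> borel_measurable M" "\<And>y. 0 \<le> H y"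
    and gH: "AE y in M. y \<in> ball x r \<longrightarrow> g y \<le> ennreal (H y)"
    and HI: "(\<integral>\<^sup>+y\<in>ball x r. ennreal (H y powr s) \<partial>M) \<le> ennreal (K powr s * m (ball x r) powr \<nu>)"
    by (rule morrey_majorizedE[OF g r, of x]) blast
  have "(\<integral>\<^sup>+y\<in>ball x r. ennpowr (g y) s \<partial>M) \<le> (\<integral>\<^sup>+y\<in>ball x r. ennreal (H y powr s) \<partial>M)"
    using gH
  proof (intro nn_integral_mono_AE, eventually_elim)
    case (elim y)
    have "ennpowr (g y) s \<le> ennreal (H y powr s)" if "y \<in> ball x r"
      using ennpowr_mono[of "g y" "ennreal (H y)" s] elim that s H(2) by (simp add: ennpowr_ennreal)
    then show ?case by (auto simp: indicator_def)
  qed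
  also note HI
  finally have "(\<integral>\<^sup>+y\<in>ball x r. ennpowr (g y) s \<partial>M) / ennreal V \<le> ennreal (K powr s)"
    using V by (intro divide_le_posI_ennreal) (auto simp: V_def mult.commute simp flip: ennreal_mult)
  then have "ennpowr ((\<integral>\<^sup>+y\<in>ball x r. ennpowr (g y) s \<partial>M) / ennreal V) (1 / s) \<le> ennpowr (ennreal (K powr s)) (1 / s)"
    using s by (intro ennpowr_mono) auto
  also have "\<dots> = ennreal K" using s K by (simp add: ennpowr_ennreal powr_powr)
  finally show "ennpowr ((\<integral>\<^sup>+y\<in>ball x r. ennpowr (g y) s \<partial>M) / ennreal (m (ball x r) powr \<nu>)) (1 / s) \<le> ennreal K"
    by (simp add: V_def)
qed

lemma morrey_majorized_if_bounded_radius: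
  assumes R: "qdiam d < R" and small: "\<And>x r. 0 < r \<Longrightarrow> r \<le> R \<Longrightarrow> ball_majorized g s \<nu> K x r"
  shows "morrey_majorized g s \<nu> K"
  unfolding morrey_majorized_def
proof (intro allI impI)
  fix x and r :: real assume r: "0 < r"
  have "0 < R" using R diam_pos by linarith
  then have "ball_majorized g s \<nu> K x (min r R)" using r by (intro small) auto
  moreover have "ball x r = ball x (min r R)" using R by (auto simp: min_def ball_UNIV)
  ultimately show "ball_majorized g s \<nu> K x r" by (simp add: ball_majorized_def)
qed

text \<open>Hoelder's inequality on each ball. The comparison of \<open>(1 - \<nu>) / t\<close> with
  \<open>(1 - \<nu>') / t'\<close> says that the surplus power e of the ball measure is
  non-negative, so that it can be bounded by the total measure; \<open>e \<le> t'\<close> puts this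
  constant inside the power.\<close>

lemma morrey_majorized_lower_exponent:
  assumes g: "morrey_majorized g t \<nu> K" and t: "1 \<le> t'" "t' < t" and le: "(1 - \<nu>) / t \<le> (1 - \<nu>') / t'" and \<nu>: "\<nu> \<le> 1" "0 \<le> \<nu>'"
    and K: "0 < K"
  shows "morrey_majorized g t' \<nu>' (max 1 (m UNIV) * K)"
  unfolding morrey_majorized_def
proof (intro allI impI)
  fix x and r :: real assume r: "0 < r"
  obtain H where H[measurable]: "H \<in> borel_measurable M" and H0: "\<And>y. 0 \<le> H y"
    and gH: "AE y in M. y \<in> ball x r \<longrightarrow> g y \<le> ennreal (H y)"
    and HI: "(\<integral>\<^sup>+y\<in>ball x r. ennreal (H y powr t) \<partial>M) \<le> ennreal (K powr t * m (ball x r) powr \<nu>)"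
    by (rule morrey_majorizedE[OF g r, of x]) blast
  define V where "V = m (ball x r)"
  have V: "0 < V" unfolding V_def by (rule measure_ball_pos[OF r])
  define a where "a = t / t'"
  define a' where "a' = t / (t - t')"
  have aa: "1 < a" "1 < a'" "1 / a + 1 / a' = 1" using t by (auto simp: a_def a'_def field_simps)
  have "(\<integral>\<^sup>+y\<in>ball x r. ennreal (H y powr t' * 1) \<partial>M) \<le> ennreal ((K powr t * V powr \<nu>) powr (1 / a) * V powr (1 / a'))"
  proof (rule set_nn_integral_Holder[OF _ _ _ _ _ aa])
    have "(H y powr t') powr a = H y powr t" for y using t by (simp add: powr_powr a_def)
    then show "(\<integral>\<^sup>+y\<in>ball x r. ennreal ((H y powr t') powr a) \<partial>M) \<le> ennreal (K powr t * V powr \<nu>)"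
      using HI by (simp add: V_def)
    show "(\<integral>\<^sup>+y\<in>ball x r. ennreal (1 powr a') \<partial>M) \<le> ennreal V" by (simp add: V_def emeasure_eq_measure)
  qed (use V K in auto)
  also have "(K powr t * V powr \<nu>) powr (1 / a) * V powr (1 / a') = K powr t' * V powr (\<nu> / a + 1 / a')"
    using t by (simp add: powr_mult powr_powr a_def powr_add)
  also have "\<nu> / a + 1 / a' = \<nu>' + ((1 - \<nu>') - (1 - \<nu>) * t' / t)" using t by (simp add: a_def a'_def field_simps)
  also have "V powr (\<nu>' + ((1 - \<nu>') - (1 - \<nu>) * t' / t)) = V powr \<nu>' * V powr ((1 - \<nu>') - (1 - \<nu>) * t' / t)" by (rule powr_add)
  also have "ennreal (K powr t' * (V powr \<nu>' * V powr ((1 - \<nu>') - (1 - \<nu>) * t' / t))) \<le> ennreal ((max 1 (m UNIV) * K) powr t' * V powr \<nu>')"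
  proof (rule ennreal_leI)
    define e where "e = (1 - \<nu>') - (1 - \<nu>) * t' / t"
    have "(1 - \<nu>) / t * t' \<le> (1 - \<nu>') / t' * t'" using le t by (intro mult_right_mono) auto
    then have "0 \<le> e" using t by (simp add: e_def)
    have "0 \<le> (1 - \<nu>) * t' / t" using \<nu> t by simp
    then have "e \<le> t'" unfolding e_def using \<nu> t by linarith
    have "V powr e \<le> max 1 (m UNIV) powr e"
      unfolding V_def using \<open>0 \<le> e\<close> finite_measure_mono[of "ball x r" UNIV] by (intro powr_mono2) (auto simp: max_def)
    also have "\<dots> \<le> max 1 (m UNIV) powr t'" using \<open>e \<le> t'\<close> by (intro powr_mono) auto
    finally have "K powr t' * V powr \<nu>' * V powr e \<le> K powr t' * V powr \<nu>' * max 1 (m UNIV) powr t'" by (intro mult_left_mono) auto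
    then show "K powr t' * (V powr \<nu>' * V powr ((1 - \<nu>') - (1 - \<nu>) * t' / t)) \<le> (max 1 (m UNIV) * K) powr t' * V powr \<nu>'"
      by (simp add: e_def powr_mult mult_ac)
  qed
  finally have "(\<integral>\<^sup>+y\<in>ball x r. ennreal (H y powr t') \<partial>M) \<le> ennreal ((max 1 (m UNIV) * K) powr t' * m (ball x r) powr \<nu>')"
    by (simp add: V_def)
  then show "ball_majorized g t' \<nu>' (max 1 (m UNIV) * K) x r"
    using H H0 gH unfolding ball_majorized_def by blast
qed

text \<open>This is \<open>weighted_maximal_morrey\<close> for b = 0 and
  \<open>\<sigma> = \<kappa> = 0\<close>, with \<open>\<kappa>\<^sub>0 = C = 1\<close>; radii up to
  twice the diameter include those of \<open>maximal_operator\<close>.\<close>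

lemma maximal_operator_majorized:
  assumes u: "1 < s0"
  obtains D where "1 \<le> D"
    "\<And>t \<nu> (h :: 'a \<Rightarrow> real) K. s0 \<le> t \<Longrightarrow> t \<le> q \<Longrightarrow> 0 \<le> \<nu> \<Longrightarrow> \<nu> \<le> 1 \<Longrightarrow> 0 < K \<Longrightarrow>
      morrey_majorized (\<lambda>x. ennreal \<bar>h x\<bar>) t \<nu> K \<Longrightarrow> morrey_majorized (maximal_operator M d h) t \<nu> (D * K)"
proof -
  define u where "u = (1 + s0) / 2"
  define v where "v = u / (u - 1)"
  have uv: "1 < u" "u < s0" using u by (auto simp: u_def)
  then have uv': "1 < v" "1 / u + 1 / v = 1" by (auto simp: v_def field_simps)
  define R where "R = 2 * qdiam d"
  have osc0: "exp_oscillation_bound (\<lambda>_. 0) 1 1"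
    by (simp add: exp_oscillation_bound_def emeasure_eq_measure ball_average_def set_lebesgue_integral_def)
  obtain D where D: "1 \<le> D"
    "\<And>s \<nu> \<kappa> \<sigma> g K x0 r0. s0 \<le> s \<Longrightarrow> s \<le> q \<Longrightarrow> 0 \<le> \<nu> \<Longrightarrow> \<nu> \<le> 1 \<Longrightarrow> \<bar>\<sigma>\<bar> * s \<le> 1 * (1 - \<nu>) \<Longrightarrow> 0 \<le> \<kappa> \<Longrightarrow>
      (\<kappa> + \<bar>\<sigma>\<bar> * (s / u - 1)) * v \<le> 1 \<Longrightarrow> 0 < K \<Longrightarrow> morrey_majorized g s \<nu> K \<Longrightarrow> 0 < r0 \<Longrightarrow> r0 \<le> R \<Longrightarrow>
      ball_majorized (weighted_maximal (\<lambda>_. 0) \<sigma> \<kappa> R g) s \<nu> (D * K) x0 r0"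
    by (rule weighted_maximal_morrey[OF osc0 order_refl zero_less_one uv(1) uv' uv(2), of q R]) blast
  have le: "maximal_operator M d h x \<le> weighted_maximal (\<lambda>_. 0) 0 0 R (\<lambda>y. ennreal \<bar>h y\<bar>) x" for h x
    unfolding maximal_operator_def weighted_maximal_def using diam_pos
    by (intro SUP_subset_mono) (auto simp: R_def emeasure_eq_measure)
  show thesis
  proof
    show "1 \<le> D" by (rule D(1))
    fix t \<nu> K :: real and h :: "'a \<Rightarrow> real"
    assume t: "s0 \<le> t" "t \<le> q" and \<nu>: "0 \<le> \<nu>" "\<nu> \<le> 1" and K: "0 < K"
      and h: "morrey_majorized (\<lambda>x. ennreal \<bar>h x\<bar>) t \<nu> K"
    show "morrey_majorized (maximal_operator M d h) t \<nu> (D * K)"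
    proof (rule morrey_majorized_if_bounded_radius[of R])
      show "qdiam d < R" using diam_pos by (simp add: R_def)
      show "ball_majorized (maximal_operator M d h) t \<nu> (D * K) x0 r0" if r0: "0 < r0" "r0 \<le> R" for x0 r0
        using \<nu> by (intro ball_majorized_mono[OF _ le] D(2) t K h r0) auto
    qed
  qed
qed

text \<open>Finiteness of T gives absolute convergence of both integrals, hence the commutator as a
  single integral with factor \<open>b x - b y\<close>. Where T is infinite the pointwise bound is
  trivial, so it holds at every x.\<close>

lemma potential_commutator_dominated:
  fixes \<alpha> :: real
  assumes [measurable]: "b \<in> borel_measurable M" "f \<in> borel_measurable M"
  defines "T \<equiv> commutator_majorant \<alpha> b f"
  shows "T x < \<infinity> \<Longrightarrow> integrable M (potential_integrand M d \<alpha> f x)"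
    and "T x < \<infinity> \<Longrightarrow> integrable M (potential_integrand M d \<alpha> (\<lambda>y. b y * f y) x)"
    and "ennreal \<bar>potential_commutator M d \<alpha> b f x\<bar> \<le> T x"
proof -
  have bf: "potential_integrand M d \<alpha> (\<lambda>y. b y * f y) x y = b y * potential_integrand M d \<alpha> f x y" for y
    by (simp add: potential_integrand_def)
  have [measurable]: "(\<lambda>y. b y * f y) \<in> borel_measurable M" by measurable
  show 1: "integrable M (potential_integrand M d \<alpha> f x)" if "T x < \<infinity>"
  proof (rule integrableI_bounded)
    have "(\<integral>\<^sup>+y. ennreal (norm (potential_integrand M d \<alpha> f x y)) \<partial>M) \<le> T x"
      unfolding T_def commutator_majorant_def by (intro nn_integral_mono ennreal_leI) (simp add: mult_le_cancel_right1)
    then show "(\<integral>\<^sup>+y. ennreal (norm (potential_integrand M d \<alpha> f x y)) \<partial>M) < \<infinity>" using that by (rule le_less_trans)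
  qed measurable
  show 2: "integrable M (potential_integrand M d \<alpha> (\<lambda>y. b y * f y) x)" if "T x < \<infinity>"
  proof (rule integrableI_bounded)
    have "(\<integral>\<^sup>+y. ennreal (norm (potential_integrand M d \<alpha> (\<lambda>y. b y * f y) x y)) \<partial>M)
       \<le> (\<integral>\<^sup>+y. ennreal (1 + \<bar>b x\<bar>) * ennreal ((1 + \<bar>b x - b y\<bar>) * \<bar>potential_integrand M d \<alpha> f x y\<bar>) \<partial>M)"
    proof (rule nn_integral_mono)
      fix y
      have nn: "0 \<le> \<bar>b x\<bar> * \<bar>b x - b y\<bar>" by simp
      have mult: "(1 + X) * (1 + Y) = 1 + X + Y + X * Y" for X Y :: real by (simp add: algebra_simps)
      have "\<bar>b y\<bar> \<le> (1 + \<bar>b x\<bar>) * (1 + \<bar>b x - b y\<bar>)" unfolding mult using nn by linarith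
      then have "\<bar>b y\<bar> * \<bar>potential_integrand M d \<alpha> f x y\<bar> \<le> (1 + \<bar>b x\<bar>) * (1 + \<bar>b x - b y\<bar>) * \<bar>potential_integrand M d \<alpha> f x y\<bar>"
        by (intro mult_right_mono) auto
      then show "ennreal (norm (potential_integrand M d \<alpha> (\<lambda>y. b y * f y) x y))
        \<le> ennreal (1 + \<bar>b x\<bar>) * ennreal ((1 + \<bar>b x - b y\<bar>) * \<bar>potential_integrand M d \<alpha> f x y\<bar>)"
        by (subst ennreal_mult[symmetric]) (auto simp: bf abs_mult mult.assoc intro!: ennreal_leI)
    qed
    also have "\<dots> = ennreal (1 + \<bar>b x\<bar>) * T x" unfolding T_def commutator_majorant_def by (rule nn_integral_cmult) measurable
    also have "\<dots> < \<infinity>" using that by (simp add: ennreal_mult_less_top)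
    finally show "(\<integral>\<^sup>+y. ennreal (norm (potential_integrand M d \<alpha> (\<lambda>y. b y * f y) x y)) \<partial>M) < \<infinity>" .
  qed measurable
  show "ennreal \<bar>potential_commutator M d \<alpha> b f x\<bar> \<le> T x"
  proof (cases "T x < \<infinity>")
    case True
    have "potential_commutator M d \<alpha> b f x
      = (\<integral>y. b x * potential_integrand M d \<alpha> f x y - potential_integrand M d \<alpha> (\<lambda>y. b y * f y) x y \<partial>M)"
      unfolding potential_commutator_def potential_def using 1[OF True] 2[OF True] by simp
    also have "\<dots> = (\<integral>y. (b x - b y) * potential_integrand M d \<alpha> f x y \<partial>M)" by (simp add: bf left_diff_distrib)
    finally have eq: "potential_commutator M d \<alpha> b f x = (\<integral>y. (b x - b y) * potential_integrand M d \<alpha> f x y \<partial>M)" .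
    have "integrable M (\<lambda>y. b x * potential_integrand M d \<alpha> f x y - potential_integrand M d \<alpha> (\<lambda>y. b y * f y) x y)"
      using 1[OF True] 2[OF True] by simp
    then have "integrable M (\<lambda>y. (b x - b y) * potential_integrand M d \<alpha> f x y)" by (simp add: bf left_diff_distrib)
    then have "ennreal \<bar>potential_commutator M d \<alpha> b f x\<bar>
        \<le> (\<integral>\<^sup>+y. ennreal (norm ((b x - b y) * potential_integrand M d \<alpha> f x y)) \<partial>M)"
      unfolding eq real_norm_def[symmetric] by (rule integral_norm_bound_ennreal)
    also have "\<dots> \<le> T x"
      unfolding T_def commutator_majorant_def by (intro nn_integral_mono ennreal_leI) (auto simp: abs_mult intro!: mult_right_mono)
    finally show ?thesis .
  qed (auto simp: less_top[symmetric])
qed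

text \<open>Hedberg's bound is a multiple of \<open>H powr (s / t)\<close> with H a sum of two
  weighted maximal functions, so its t-th power integrates like the s-th power of H, with the same
  \<open>\<nu>\<close>. All parameters are fixed before s, t and \<open>\<nu>\<close> to obtain a
  uniform D.\<close>

lemma potential_majorized:
  assumes b: "b \<in> BMO M d" and s0: "1 < s0" and lam: "0 \<le> lam" "lam < 1" and \<alpha>: "0 < \<alpha>" "\<alpha> \<le> 1"
  obtains D where "0 < D"
    "\<And>s t \<nu> (f :: 'a \<Rightarrow> real) K. s0 \<le> s \<Longrightarrow> 0 < t \<Longrightarrow> t \<le> q \<Longrightarrow> 0 \<le> \<nu> \<Longrightarrow> \<nu> \<le> lam \<Longrightarrow> 1 / s - 1 / t = \<alpha> / (1 - \<nu>) \<Longrightarrow>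
      0 < K \<Longrightarrow> f \<in> borel_measurable M \<Longrightarrow> morrey_majorized (\<lambda>x. ennreal \<bar>f x\<bar>) s \<nu> K \<Longrightarrow>
      morrey_majorized (commutator_majorant \<alpha> b f) t \<nu> (D * K)"
proof (cases "1 < q")
  case False
  \<comment> \<open>The exponent relation forces \<open>1 < s0 \<le> s < t \<le> q\<close>, so the
    claim is vacuous for \<open>q \<le> 1\<close>.\<close>
  have "\<not> (0 < t \<and> t \<le> q \<and> s0 \<le> s \<and> \<nu> \<le> lam \<and> 1 / s - 1 / t = \<alpha> / (1 - \<nu>))" for s t \<nu>
  proof
    assume *: "0 < t \<and> t \<le> q \<and> s0 \<le> s \<and> \<nu> \<le> lam \<and> 1 / s - 1 / t = \<alpha> / (1 - \<nu>)"
    then have "0 < \<alpha> / (1 - \<nu>)" using \<alpha> lam by auto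
    then have "1 / t < 1 / s" using * by linarith
    then have "s < t" using * s0 by (simp add: divide_simps split: if_splits)
    then show False using * s0 False by linarith
  qed
  then show thesis using that[of 1] by (metis zero_less_one)
next
  case q: True
  define u where "u = (1 + s0) / 2"
  define v where "v = u / (u - 1)"
  have uv: "1 < u" "u < s0" using s0 by (auto simp: u_def)
  then have uv': "1 < v" "1 / u + 1 / v = 1" by (auto simp: v_def field_simps)
  define R where "R = 2 * qdiam d"
  obtain \<kappa>\<^sub>0 C where \<kappa>0: "0 < \<kappa>\<^sub>0" and C: "1 \<le> C" and osc: "exp_oscillation_bound b \<kappa>\<^sub>0 C" by (rule John_Nirenberg[OF b])
  have bm[measurable]: "b \<in> borel_measurable M" by (rule exp_oscillation_boundD[OF osc])
  obtain \<Lambda> \<eta> where \<Lambda>: "1 < \<Lambda>" and \<eta>: "0 < \<eta>" "\<eta> < 1"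
    "\<And>x r. 0 < r \<Longrightarrow> r \<le> 2 * qdiam d \<Longrightarrow> m (ball x (r / \<Lambda>)) \<le> (1 - \<eta>) * m (ball x r)"
    by (rule reverse_doubling) blast
  obtain C\<Lambda> where C\<Lambda>: "1 \<le> C\<Lambda>" "\<And>x r. 0 < r \<Longrightarrow> m (ball x (\<Lambda> * r)) \<le> C\<Lambda> * m (ball x r)"
    using dilation_bound[of \<Lambda>] by blast
  obtain D1 where D1: "1 \<le> D1"
    "\<And>s \<nu> \<kappa> \<sigma> g K x0 r0. s0 \<le> s \<Longrightarrow> s \<le> q \<Longrightarrow> 0 \<le> \<nu> \<Longrightarrow> \<nu> \<le> 1 \<Longrightarrow> \<bar>\<sigma>\<bar> * s \<le> \<kappa>\<^sub>0 * (1 - \<nu>) \<Longrightarrow> 0 \<le> \<kappa> \<Longrightarrow>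
      (\<kappa> + \<bar>\<sigma>\<bar> * (s / u - 1)) * v \<le> \<kappa>\<^sub>0 \<Longrightarrow> 0 < K \<Longrightarrow> morrey_majorized g s \<nu> K \<Longrightarrow> 0 < r0 \<Longrightarrow> r0 \<le> R \<Longrightarrow>
      ball_majorized (weighted_maximal b \<sigma> \<kappa> R g) s \<nu> (D1 * K) x0 r0"
    by (rule weighted_maximal_morrey[OF osc C \<kappa>0 uv(1) uv' uv(2), of q R]) blast
  define E where "E = C * C\<Lambda> + 1"
  have E: "1 < E" using C C\<Lambda> mult_mono[of 1 C 1 C\<Lambda>] by (simp add: E_def)
  \<comment> \<open>Half of the exponent \<open>(1 - lam) / q\<close> guaranteed for all t and
    \<open>\<nu>\<close>, so that reverse doubling still provides \<open>c1 * c1\<close>.\<close>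
  define c1 where "c1 = (1 / (1 - \<eta>)) powr ((1 - lam) / (2 * q))"
  have c1: "1 < c1" unfolding c1_def using \<eta> lam q by (intro gr_one_powr) auto
  \<comment> \<open>The four bounds serve, in this order, \<open>one_plus_abs_diff_le_exp\<close>,
    the condition \<open>\<sigma> * s \<le> \<kappa>\<^sub>0 * (1 - \<nu>)\<close>, the Hoelder
    condition with exponent v, and
    \<open>(C * C\<Lambda>) powr (\<kappa> / \<kappa>\<^sub>0) \<le> c1\<close>. The summand 1 in E
    keeps \<open>ln E\<close> positive.\<close>
  define \<kappa> where "\<kappa> = min (min 1 (\<kappa>\<^sub>0 * (1 - lam) / q)) (min (\<kappa>\<^sub>0 / ((1 + q) * v)) (\<kappa>\<^sub>0 * (ln c1 / ln E)))"
  have "0 < \<kappa>" unfolding \<kappa>_def using \<kappa>0 lam q uv' c1 E by (simp add: ln_gt_zero)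
  moreover have "\<kappa> \<le> 1" "\<kappa> \<le> \<kappa>\<^sub>0 * (1 - lam) / q" "\<kappa> \<le> \<kappa>\<^sub>0 / ((1 + q) * v)" "\<kappa> \<le> \<kappa>\<^sub>0 * (ln c1 / ln E)" by (auto simp: \<kappa>_def)
  ultimately have \<kappa>: "0 < \<kappa>" "\<kappa> \<le> 1" "\<kappa> * q \<le> \<kappa>\<^sub>0 * (1 - lam)" "\<kappa> * ((1 + q) * v) \<le> \<kappa>\<^sub>0" "\<kappa> / \<kappa>\<^sub>0 \<le> ln c1 / ln E"
    using q uv' \<kappa>0 by (auto simp: pos_le_divide_eq pos_divide_le_eq mult.commute)
  have c1E: "(C * C\<Lambda>) powr (\<kappa> / \<kappa>\<^sub>0) \<le> c1"
  proof -
    have "0 \<le> C * C\<Lambda>" using C C\<Lambda> by simp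
    then have "(C * C\<Lambda>) powr (\<kappa> / \<kappa>\<^sub>0) \<le> E powr (\<kappa> / \<kappa>\<^sub>0)" using \<kappa> \<kappa>0 by (intro powr_mono2) (auto simp: E_def)
    also have "\<dots> \<le> E powr (ln c1 / ln E)" using \<kappa> E by (intro powr_mono) auto
    also have "\<dots> = c1" using E c1 by (simp add: powr_def)
    finally show ?thesis .
  qed
  define Cs where "Cs = C\<Lambda> / \<kappa>\<^sup>2 * (1 / (1 - 1 / c1) + 1 / (1 - c1 powr - \<alpha>))"
  have c1\<alpha>: "c1 powr - \<alpha> < 1"
  proof -
    have "c1 powr - \<alpha> < c1 powr 0" using c1 \<alpha> by (intro powr_less_mono) auto
    then show ?thesis using c1 by simp
  qed
  have Cs: "0 < Cs" unfolding Cs_def using C\<Lambda> \<kappa> c1 c1\<alpha> by (intro mult_pos_pos divide_pos_pos add_pos_pos) auto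
  show thesis
  proof
    show "0 < Cs * C * (8 * D1)" using Cs C D1 by simp
    fix s t \<nu> K :: real and f :: "'a \<Rightarrow> real"
    assume s: "s0 \<le> s" and t: "0 < t" "t \<le> q" and \<nu>: "0 \<le> \<nu>" "\<nu> \<le> lam" and st: "1 / s - 1 / t = \<alpha> / (1 - \<nu>)"
      and K: "0 < K" and f[measurable]: "f \<in> borel_measurable M" and fK: "morrey_majorized (\<lambda>x. ennreal \<bar>f x\<bar>) s \<nu> K"
    have \<nu>1: "\<nu> < 1" using \<nu> lam by linarith
    have s1: "1 < s" using s s0 by linarith
    have "0 < \<alpha> / (1 - \<nu>)" using \<alpha> \<nu>1 by simp
    then have "1 / t < 1 / s" using st by linarith
    then have slt: "s < t" using s1 t by (simp add: divide_simps split: if_splits)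
    \<comment> \<open>The relation gives \<open>t / s - 1 = t * \<alpha> / (1 - \<nu>)\<close>,
      which is at least \<open>\<alpha>\<close> as t > 1. Thus \<open>\<alpha>\<close> serves as the
      uniform lower bound \<open>\<omega>\<^sub>0\<close> of Hedberg's sum.\<close>
    have \<omega>: "\<alpha> \<le> t / s - 1"
    proof -
      have "t / s - 1 = t * (1 / s - 1 / t)" using t by (simp add: right_diff_distrib)
      also have "\<dots> = t * \<alpha> / (1 - \<nu>)" by (simp add: st)
      also have "\<dots> \<ge> \<alpha>"
      proof -
        have "\<alpha> * (1 - \<nu>) \<le> \<alpha> * 1" using \<alpha> \<nu> by (intro mult_left_mono) auto
        also have "\<dots> \<le> \<alpha> * t" using \<alpha> slt s1 by (intro mult_left_mono) auto
        finally show ?thesis using \<nu>1 by (simp add: field_simps)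
      qed
      finally show ?thesis .
    qed
    have c1c1: "c1 * c1 \<le> (1 / (1 - \<eta>)) powr ((1 - \<nu>) / t)"
    proof -
      have "c1 * c1 = (1 / (1 - \<eta>)) powr ((1 - lam) / q)" unfolding c1_def by (simp flip: powr_add)
      also have "\<dots> \<le> (1 / (1 - \<eta>)) powr ((1 - \<nu>) / t)" using \<eta> \<nu> t lam by (intro powr_mono frac_le) auto
      finally show ?thesis .
    qed
    define s' where "s' = s / (s - 1)"
    have s': "1 < s'" "1 / s + 1 / s' = 1" using s1 by (auto simp: s'_def field_simps)
    have "s' \<le> v"
    proof -
      have "1 / s \<le> 1 / u" using s uv by (intro divide_left_mono) auto
      then have "1 / v \<le> 1 / s'" using s'(2) uv'(2) by linarith
      then show ?thesis using s' uv' by (simp add: divide_simps)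
    qed
    have "1 * v \<le> (1 + q) * v" using q uv' by (intro mult_right_mono) auto
    then have "s' \<le> (1 + q) * v" using \<open>s' \<le> v\<close> by simp
    then have "\<kappa> * s' \<le> \<kappa> * ((1 + q) * v)" using \<kappa>(1) by (intro mult_left_mono) auto
    then have \<kappa>s': "\<kappa> * s' \<le> \<kappa>\<^sub>0" using \<kappa>(4) by linarith
    \<comment> \<open>Hedberg's argument takes the power s/t of the maximal bound, so the weight
      there must have exponent \<open>\<kappa> * (t / s)\<close> in order to come back as
      \<open>\<kappa>\<close>.\<close>
    define \<sigma> where "\<sigma> = \<kappa> * (t / s)"
    have \<sigma>: "0 < \<sigma>" "\<sigma> * s = \<kappa> * t" using \<kappa> t s1 by (auto simp: \<sigma>_def)
    have "\<kappa> * t \<le> \<kappa> * q" using \<kappa> t by (intro mult_left_mono) auto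
    have \<sigma>1: "\<sigma> * s \<le> \<kappa>\<^sub>0 * (1 - \<nu>)"
    proof -
      have "\<kappa>\<^sub>0 * (1 - lam) \<le> \<kappa>\<^sub>0 * (1 - \<nu>)" using \<nu> \<kappa>0 by (intro mult_left_mono) auto
      then show ?thesis using \<sigma>(2) \<open>\<kappa> * t \<le> \<kappa> * q\<close> \<kappa>(3) by linarith
    qed
    have \<sigma>2: "(\<kappa> + \<sigma> * (s / u - 1)) * v \<le> \<kappa>\<^sub>0"
    proof -
      have "s / u \<le> s / 1" using uv s1 by (intro divide_left_mono) auto
      then have "\<sigma> * (s / u - 1) \<le> \<sigma> * s" using \<sigma> by (intro mult_left_mono) auto
      then have "\<kappa> + \<sigma> * (s / u - 1) \<le> \<kappa> * (1 + q)"
        using \<sigma>(2) \<open>\<kappa> * t \<le> \<kappa> * q\<close> unfolding distrib_left by linarith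
      then have "(\<kappa> + \<sigma> * (s / u - 1)) * v \<le> \<kappa> * (1 + q) * v" using uv' by (intro mult_right_mono) auto
      then show ?thesis using \<kappa>(4) by (simp add: mult.assoc)
    qed
    show "morrey_majorized (commutator_majorant \<alpha> b f) t \<nu> (Cs * C * (8 * D1) * K)"
    proof (rule morrey_majorized_if_bounded_radius[of R])
      show "qdiam d < R" using diam_pos by (simp add: R_def)
      fix x0 r0 assume r0: "0 < r0" "r0 \<le> R"
      have ex: "ball_majorized (weighted_maximal b \<tau> \<kappa> R (\<lambda>y. ennreal \<bar>f y\<bar>)) s \<nu> (D1 * K) x0 r0"
        if "\<bar>\<tau>\<bar> = \<sigma>" for \<tau>
        using \<nu> \<nu>1 \<kappa>(1) slt t \<sigma>1 \<sigma>2 that by (intro D1(2) s K fK r0) auto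
      obtain H1 where H1[measurable]: "H1 \<in> borel_measurable M" and H10: "\<And>x. 0 \<le> H1 x"
        and H1AE: "AE x in M. x \<in> ball x0 r0 \<longrightarrow> weighted_maximal b (\<sigma>) \<kappa> R (\<lambda>y. ennreal \<bar>f y\<bar>) x \<le> ennreal (H1 x)"
        and H1I: "(\<integral>\<^sup>+x\<in>ball x0 r0. ennreal (H1 x powr s) \<partial>M) \<le> ennreal ((D1 * K) powr s * m (ball x0 r0) powr \<nu>)"
        by (rule ball_majorizedE[OF ex[of \<sigma>]]) (use \<sigma>(1) in auto)
      obtain H2 where H2[measurable]: "H2 \<in> borel_measurable M" and H20: "\<And>x. 0 \<le> H2 x"
        and H2AE: "AE x in M. x \<in> ball x0 r0 \<longrightarrow> weighted_maximal b (- \<sigma>) \<kappa> R (\<lambda>y. ennreal \<bar>f y\<bar>) x \<le> ennreal (H2 x)"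
        and H2I: "(\<integral>\<^sup>+x\<in>ball x0 r0. ennreal (H2 x powr s) \<partial>M) \<le> ennreal ((D1 * K) powr s * m (ball x0 r0) powr \<nu>)"
        by (rule ball_majorizedE[OF ex[of "- \<sigma>"]]) (use \<sigma>(1) in auto)
      \<comment> \<open>The maximal functions for \<open>\<sigma>\<close> and
        \<open>- \<sigma>\<close> together control the weight with the absolute value.\<close>
      define H where "H x = H1 x + H2 x" for x
      have Hm[measurable]: "H \<in> borel_measurable M" unfolding H_def by measurable
      have H0: "0 \<le> H x" for x using H10 H20 by (simp add: H_def add_nonneg_nonneg)
      have "(\<integral>\<^sup>+x\<in>ball x0 r0. ennreal ((H1 x + H2 x) powr s) \<partial>M) \<le> ennreal ((4 * (D1 * K + D1 * K)) powr s * m (ball x0 r0) powr \<nu>)"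
        using s1 D1(1) K by (intro nn_integral_powr_add_le H1I H2I) (auto simp: H10 H20)
      then have HI: "(\<integral>\<^sup>+x\<in>ball x0 r0. ennreal (H x powr s) \<partial>M) \<le> ennreal ((8 * D1 * K) powr s * m (ball x0 r0) powr \<nu>)"
        by (simp add: H_def algebra_simps)
      define G where "G x = Cs * (H x powr (s / t) * (C * K) powr (1 - s / t))" for x
      have Gm: "G \<in> borel_measurable M" unfolding G_def by measurable
      have G0: "0 \<le> G x" for x using Cs by (simp add: G_def)
      have dom: "AE x in M. x \<in> ball x0 r0 \<longrightarrow>
        commutator_majorant \<alpha> b f x \<le> ennreal (G x)"
        using H1AE H2AE
      proof (eventually_elim, intro impI)
        fix x
        assume wm: "x \<in> ball x0 r0 \<longrightarrow> weighted_maximal b \<sigma> \<kappa> R (\<lambda>y. ennreal \<bar>f y\<bar>) x \<le> ennreal (H1 x)"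
          "x \<in> ball x0 r0 \<longrightarrow> weighted_maximal b (- \<sigma>) \<kappa> R (\<lambda>y. ennreal \<bar>f y\<bar>) x \<le> ennreal (H2 x)" and x: "x \<in> ball x0 r0"
        note wm' = weighted_maximal_le_iff[OF H10[of x], THEN iffD1, OF mp[OF wm(1) x]]
          weighted_maximal_le_iff[OF H20[of x], THEN iffD1, OF mp[OF wm(2) x]]
        have x1: "ennreal (exp (\<sigma> * (b x - avg b x r))) * exp_integral b \<kappa> (\<lambda>y. ennreal \<bar>f y\<bar>) x r \<le> ennreal (H1 x * m (ball x r))"
          and x2: "ennreal (exp (- \<sigma> * (b x - avg b x r))) * exp_integral b \<kappa> (\<lambda>y. ennreal \<bar>f y\<bar>) x r \<le> ennreal (H2 x * m (ball x r))"
          if "0 < r" "r \<le> R" for r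
          by (rule wm'(1)[rule_format], use that in simp) (rule wm'(2)[rule_format], use that in simp)
        show "commutator_majorant \<alpha> b f x \<le> ennreal (G x)"
          unfolding G_def Cs_def
        proof (rule Hedberg_pointwise[OF osc C \<kappa>0 \<Lambda> C\<Lambda>(1) C\<Lambda>(2) \<eta>(1,2) \<eta>(3) \<kappa>(1,2) c1 c1E c1c1 \<nu>1 _ slt st _ \<alpha>(2) \<alpha>(1) \<omega> f])
          show "0 < s" "0 \<le> \<alpha>" "0 < C * K" "0 \<le> H x" using s1 \<alpha> C K H0 by auto
        next
          fix r assume r: "0 < r" "r \<le> 2 * qdiam d"
          have "ennreal (exp (\<sigma> * \<bar>b x - avg b x r\<bar>)) * exp_integral b \<kappa> (\<lambda>y. ennreal \<bar>f y\<bar>) x r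
             \<le> ennreal (max (H1 x) (H2 x) * m (ball x r))"
          proof (cases "avg b x r \<le> b x")
            case True
            have "ennreal (exp (\<sigma> * \<bar>b x - avg b x r\<bar>)) * exp_integral b \<kappa> (\<lambda>y. ennreal \<bar>f y\<bar>) x r
             \<le> ennreal (H1 x * m (ball x r))" using x1[of r] r True by (simp add: R_def)
            also have "\<dots> \<le> ennreal (max (H1 x) (H2 x) * m (ball x r))" by (intro ennreal_leI mult_right_mono) auto
            finally show ?thesis .
          next
            case False
            then have e: "\<sigma> * \<bar>b x - avg b x r\<bar> = - \<sigma> * (b x - avg b x r)" by (simp add: abs_if algebra_simps)
            have "ennreal (exp (\<sigma> * \<bar>b x - avg b x r\<bar>)) * exp_integral b \<kappa> (\<lambda>y. ennreal \<bar>f y\<bar>) x r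
             \<le> ennreal (H2 x * m (ball x r))" unfolding e using r by (intro x2) (auto simp: R_def)
            also have "\<dots> \<le> ennreal (max (H1 x) (H2 x) * m (ball x r))" by (intro ennreal_leI mult_right_mono) auto
            finally show ?thesis .
          qed
          also have "\<dots> \<le> ennreal (H x * m (ball x r))" using H10[of x] H20[of x]
            by (intro ennreal_leI mult_right_mono) (auto simp: H_def)
          finally show "ennreal (exp (\<kappa> * (t / s) * \<bar>b x - avg b x r\<bar>)) *
             exp_integral b \<kappa> (\<lambda>y. ennreal \<bar>f y\<bar>) x r \<le> ennreal (H x * m (ball x r))"
            by (simp only: \<sigma>_def)
        next
          fix r :: real assume r: "0 < r"
          show "exp_integral b \<kappa> (\<lambda>y. ennreal \<bar>f y\<bar>) x r
             \<le> ennreal (C * K * m (ball x r) powr (- (1 - \<nu>) / s) * m (ball x r))"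
            using K by (intro morrey_exp_average[OF osc C s1 s' \<kappa>s' _ fK r]) auto
        qed
      qed
      have "(\<integral>\<^sup>+x\<in>ball x0 r0. ennreal (G x powr t) \<partial>M)
         = (\<integral>\<^sup>+x. ennreal (Cs powr t * (C * K) powr (t - s)) * (ennreal (H x powr s) * indicator (ball x0 r0) x) \<partial>M)"
      proof (intro nn_integral_cong)
        fix x
        have "(1 - s / t) * t = t - s" using t by (simp add: left_diff_distrib)
        then have "G x powr t = Cs powr t * (C * K) powr (t - s) * H x powr s"
          using t by (simp add: G_def powr_mult[of Cs] powr_mult[of "H x powr (s / t)"] powr_powr mult_ac)
        then show "ennreal (G x powr t) * indicator (ball x0 r0) x
          = ennreal (Cs powr t * (C * K) powr (t - s)) * (ennreal (H x powr s) * indicator (ball x0 r0) x)"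
          by (simp add: ennreal_mult' mult.assoc)
      qed
      also have "\<dots> = ennreal (Cs powr t * (C * K) powr (t - s)) * (\<integral>\<^sup>+x\<in>ball x0 r0. ennreal (H x powr s) \<partial>M)"
        by (rule nn_integral_cmult) measurable
      also have "\<dots> \<le> ennreal (Cs powr t * (C * K) powr (t - s)) * ennreal ((8 * D1 * K) powr s * m (ball x0 r0) powr \<nu>)"
        by (intro mult_left_mono HI) simp
      also have "\<dots> = ennreal (Cs powr t * (C * K) powr (t - s) * ((8 * D1 * K) powr s * m (ball x0 r0) powr \<nu>))"
        by (rule ennreal_mult[symmetric]) auto
      also have "\<dots> \<le> ennreal ((Cs * C * (8 * D1) * K) powr t * m (ball x0 r0) powr \<nu>)"
      proof (rule ennreal_leI)
        have KK: "K powr t = K powr (t - s) * K powr s" by (simp flip: powr_add)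
        have e1: "(C * K) powr (t - s) = C powr (t - s) * K powr (t - s)" by (rule powr_mult)
        have e2: "(8 * D1 * K) powr s = (8 * D1) powr s * K powr s" by (rule powr_mult)
        have "Cs powr t * (C * K) powr (t - s) * ((8 * D1 * K) powr s * m (ball x0 r0) powr \<nu>)
          = (Cs powr t * K powr t * m (ball x0 r0) powr \<nu>) * (C powr (t - s) * (8 * D1) powr s)"
          unfolding e1 e2 KK by (simp only: mult_ac)
        also have "\<dots> \<le> (Cs powr t * K powr t * m (ball x0 r0) powr \<nu>) * (C powr t * (8 * D1) powr t)"
          using C D1(1) slt s1 by (intro mult_left_mono mult_mono powr_mono) auto
        also have "\<dots> = (Cs * C * (8 * D1) * K) powr t * m (ball x0 r0) powr \<nu>"
          by (simp add: powr_mult mult_ac)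
        finally show "Cs powr t * (C * K) powr (t - s) * ((8 * D1 * K) powr s * m (ball x0 r0) powr \<nu>)
          \<le> (Cs * C * (8 * D1) * K) powr t * m (ball x0 r0) powr \<nu>" .
      qed
      finally have GI: "(\<integral>\<^sup>+x\<in>ball x0 r0. ennreal (G x powr t) \<partial>M) \<le> ennreal ((Cs * C * (8 * D1) * K) powr t * m (ball x0 r0) powr \<nu>)" .
      show "ball_majorized (commutator_majorant \<alpha> b f) t \<nu> (Cs * C * (8 * D1) * K) x0 r0"
        unfolding ball_majorized_def using Gm G0 dom GI by blast
    qed
  qed
qed

lemma maximal_commutator_majorized:
  assumes b: "b \<in> BMO M d" and s0: "1 < s0" and lam: "0 \<le> lam" "lam < 1" and \<alpha>: "0 < \<alpha>" "\<alpha> \<le> 1"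
  obtains D where "0 < D"
    "\<And>s t \<nu> (f :: 'a \<Rightarrow> real) K. s0 \<le> s \<Longrightarrow> s < t \<Longrightarrow> t \<le> q \<Longrightarrow> 0 \<le> \<nu> \<Longrightarrow> \<nu> \<le> lam \<Longrightarrow> 1 / s - 1 / t = \<alpha> / (1 - \<nu>) \<Longrightarrow>
      0 < K \<Longrightarrow> f \<in> borel_measurable M \<Longrightarrow> morrey_norm M d s \<nu> (\<lambda>x. ennreal \<bar>f x\<bar>) \<le> ennreal K \<Longrightarrow>
      commutator_well_defined M d \<alpha> b f \<and> morrey_majorized (maximal_operator M d (potential_commutator M d \<alpha> b f)) t \<nu> (D * K)"
proof -
  have bm: "b \<in> borel_measurable M" using b by (simp add: BMO_def)
  obtain N where N: "1 \<le> N"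
    "\<And>s \<nu> (f :: 'a \<Rightarrow> real) K. 1 \<le> s \<Longrightarrow> 0 \<le> \<nu> \<Longrightarrow> \<nu> \<le> 1 \<Longrightarrow> f \<in> borel_measurable M \<Longrightarrow> 0 < K \<Longrightarrow>
      morrey_norm M d s \<nu> (\<lambda>x. ennreal \<bar>f x\<bar>) \<le> ennreal K \<Longrightarrow> morrey_majorized (\<lambda>x. ennreal \<bar>f x\<bar>) s \<nu> (N * K)"
    by (rule morrey_majorized_if_norm_le) blast
  obtain D1 where D1: "1 \<le> D1"
    "\<And>t \<nu> (h :: 'a \<Rightarrow> real) K. s0 \<le> t \<Longrightarrow> t \<le> q \<Longrightarrow> 0 \<le> \<nu> \<Longrightarrow> \<nu> \<le> 1 \<Longrightarrow> 0 < K \<Longrightarrow>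
      morrey_majorized (\<lambda>x. ennreal \<bar>h x\<bar>) t \<nu> K \<Longrightarrow> morrey_majorized (maximal_operator M d h) t \<nu> (D1 * K)"
    by (rule maximal_operator_majorized[OF s0, of q]) blast
  obtain D2 where D2: "0 < D2"
    "\<And>s t \<nu> (f :: 'a \<Rightarrow> real) K. s0 \<le> s \<Longrightarrow> 0 < t \<Longrightarrow> t \<le> q \<Longrightarrow> 0 \<le> \<nu> \<Longrightarrow> \<nu> \<le> lam \<Longrightarrow> 1 / s - 1 / t = \<alpha> / (1 - \<nu>) \<Longrightarrow>
      0 < K \<Longrightarrow> f \<in> borel_measurable M \<Longrightarrow> morrey_majorized (\<lambda>x. ennreal \<bar>f x\<bar>) s \<nu> K \<Longrightarrow>
      morrey_majorized (commutator_majorant \<alpha> b f) t \<nu> (D2 * K)"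
    by (rule potential_majorized[OF b s0 lam \<alpha>, of q]) blast
  show thesis
  proof
    show "0 < D1 * D2 * N" using D1(1) D2(1) N(1) by simp
    fix s t \<nu> K :: real and f :: "'a \<Rightarrow> real"
    assume s: "s0 \<le> s" and t: "s < t" "t \<le> q" and \<nu>: "0 \<le> \<nu>" "\<nu> \<le> lam" and st: "1 / s - 1 / t = \<alpha> / (1 - \<nu>)"
      and K: "0 < K" and f: "f \<in> borel_measurable M" and norm: "morrey_norm M d s \<nu> (\<lambda>x. ennreal \<bar>f x\<bar>) \<le> ennreal K"
    have "morrey_majorized (\<lambda>x. ennreal \<bar>f x\<bar>) s \<nu> (N * K)"
      using s s0 \<nu> lam by (intro N(2) f K norm) auto
    then have T: "morrey_majorized (commutator_majorant \<alpha> b f) t \<nu> (D2 * (N * K))"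
      using s s0 t K N(1) by (intro D2(2)[OF s _ t(2) \<nu> st _ f]) auto
    \<comment> \<open>A ball of radius beyond the diameter is the whole space, so a single majorant
      gives convergence almost everywhere.\<close>
    have "0 < qdiam d + 1" using diam_pos by simp
    obtain H where H: "AE x in M. x \<in> ball undefined (qdiam d + 1) \<longrightarrow>
        commutator_majorant \<alpha> b f x \<le> ennreal (H x)"
      by (rule morrey_majorizedE[OF T \<open>0 < qdiam d + 1\<close>, of undefined]) blast
    have "commutator_well_defined M d \<alpha> b f"
      unfolding commutator_well_defined_def using H
    proof eventually_elim
      case (elim x)
      then have "commutator_majorant \<alpha> b f x \<le> ennreal (H x)"
        by (simp add: ball_UNIV)
      then have "commutator_majorant \<alpha> b f x < \<infinity>"
        by (rule le_less_trans) simp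
      then show ?case using potential_commutator_dominated(1,2)[OF bm f] by blast
    qed
    moreover have "morrey_majorized (\<lambda>x. ennreal \<bar>potential_commutator M d \<alpha> b f x\<bar>) t \<nu> (D2 * (N * K))"
      using T potential_commutator_dominated(3)[OF bm f] unfolding morrey_majorized_def by (blast intro: ball_majorized_mono)
    then have "morrey_majorized (maximal_operator M d (potential_commutator M d \<alpha> b f)) t \<nu> (D1 * (D2 * (N * K)))"
      using s t \<nu> lam D2(1) N(1) K by (intro D1(2)) auto
    ultimately show "commutator_well_defined M d \<alpha> b f \<and>
        morrey_majorized (maximal_operator M d (potential_commutator M d \<alpha> b f)) t \<nu> (D1 * D2 * N * K)"
      by (simp add: mult.assoc)
  qed
qed

end

section \<open>Grand Morrey spaces\<close>

lemma less_s_max: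
  assumes "0 < x" "x \<le> p - 1" "A x \<le> lam" "y < x"
  shows "y < s_max p lam A"
proof -
  have "x \<le> Sup {x. 0 < x \<and> x \<le> p - 1 \<and> A x \<le> lam}"
    using assms by (intro cSup_upper bdd_aboveI[of _ "p - 1"]) auto
  then show ?thesis using assms by (simp add: s_max_def)
qed

lemma less_s_maxD:
  assumes A: "mono_on {0<..p - 1} A" and x: "0 < x" "x \<le> p - 1" "A x \<le> lam" and y: "0 < y" "y < s_max p lam A"
  shows "y < p - 1" "A y \<le> lam"
proof -
  show "y < p - 1" using y by (simp add: s_max_def)
  have "y < Sup {x. 0 < x \<and> x \<le> p - 1 \<and> A x \<le> lam}" using y by (simp add: s_max_def)
  moreover have "{x. 0 < x \<and> x \<le> p - 1 \<and> A x \<le> lam} \<noteq> {}" using x by blast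
  ultimately obtain z where "z \<in> {x. 0 < x \<and> x \<le> p - 1 \<and> A x \<le> lam}" "y < z" by (rule less_cSupE)
  then show "A y \<le> lam" using mono_onD[OF A, of y z] y by auto
qed

text \<open>In reciprocals the fraction defining \<open>phi_bar\<close> splits into a sum, which is
  the Sobolev relation at parameter x.\<close>

lemma p_minus_phi_bar:
  assumes "x < q" "0 < 1 - lam + A x" "0 < \<alpha>"
  shows "1 / (p - phi_bar p q lam \<alpha> A x) = 1 / (q - x) + \<alpha> / (1 - lam + A x)"
    and "0 < p - phi_bar p q lam \<alpha> A x"
proof -
  define L where "L = 1 - lam + A x"
  define y where "y = q - x"
  have pos: "0 < L" "0 < y" using assms by (auto simp: L_def y_def)
  have "phi_bar p q lam \<alpha> A x = p + (- y) * L / (L - \<alpha> * (- y))" by (simp add: phi_bar_def L_def y_def)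
  then have E: "p - phi_bar p q lam \<alpha> A x = y * L / (L + \<alpha> * y)" by simp
  have "0 < L + \<alpha> * y" using pos assms(3) by (simp add: add_pos_pos)
  then show "0 < p - phi_bar p q lam \<alpha> A x" unfolding E using pos by simp
  have "1 / (y * L / (L + \<alpha> * y)) = 1 / y + \<alpha> / L" using pos by (simp add: field_simps)
  then show "1 / (p - phi_bar p q lam \<alpha> A x) = 1 / (q - x) + \<alpha> / (1 - lam + A x)"
    unfolding E by (simp only: L_def y_def)
qed

text \<open>A is controlled only to the right of 0, so the mean value theorem is applied between y
  and x, and then y is sent to 0, where A has limit 0.\<close>

lemma linear_bound_at_0:
  fixes A A' :: "real \<Rightarrow> real"
  assumes \<delta>: "0 < \<delta>" and der: "\<forall>x\<in>{0<..\<delta>}. (A has_real_derivative A' x) (at x within {0<..\<delta>})"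
    and A0: "(A \<longlongrightarrow> 0) (at_right 0)" and A'0: "(A' \<longlongrightarrow> B) (at_right 0)" and B: "B < B'" "0 \<le> B'"
  obtains \<sigma> where "0 < \<sigma>" "\<And>x. 0 < x \<Longrightarrow> x < \<sigma> \<Longrightarrow> A x \<le> B' * x"
proof -
  have "eventually (\<lambda>x. A' x < B') (at_right 0)" using A'0 B(1) by (rule order_tendstoD)
  then obtain \<sigma>1 where \<sigma>1: "0 < \<sigma>1" "\<And>x. 0 < x \<Longrightarrow> x < \<sigma>1 \<Longrightarrow> A' x < B'" by (auto simp: eventually_at_right_field)
  define \<sigma> where "\<sigma> = min \<sigma>1 \<delta>"
  have \<sigma>: "0 < \<sigma>" "\<sigma> \<le> \<sigma>1" "\<sigma> \<le> \<delta>" using \<sigma>1 \<delta> by (auto simp: \<sigma>_def)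
  have D: "(A has_real_derivative A' x) (at x)" if "0 < x" "x < \<sigma>" for x
  proof -
    have "(A has_real_derivative A' x) (at x within {0<..\<delta>})" using der that \<sigma> by auto
    then have "(A has_real_derivative A' x) (at x within {0<..<\<delta>})" by (rule DERIV_subset) auto
    then show ?thesis using that \<sigma> by (simp add: at_within_open[of x "{0<..<\<delta>}"])
  qed
  show thesis
  proof
    show "0 < \<sigma>" by (rule \<sigma>)
    fix x assume x: "0 < x" "x < \<sigma>"
    have "A x \<le> A y + B' * x" if y: "0 < y" "y < x" for y
    proof -
      have "\<exists>z. y < z \<and> z < x \<and> A x - A y = (x - y) * A' z"
        using y x by (intro MVT2 D) auto
      then obtain z where z: "y < z" "z < x" "A x - A y = (x - y) * A' z" by blast
      have "A' z < B'" using z y x \<sigma> by (intro \<sigma>1) auto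
      then have "(x - y) * A' z \<le> (x - y) * B'" using y by (intro mult_left_mono) auto
      also have "\<dots> \<le> x * B'" using y B(2) by (intro mult_right_mono) auto
      finally show ?thesis using z by (simp add: mult.commute)
    qed
    then have "eventually (\<lambda>y. A x - B' * x \<le> A y) (at_right 0)"
      using x by (auto simp: eventually_at_right_field algebra_simps intro!: exI[of _ x])
    then have "A x - B' * x \<le> 0" by (intro tendsto_lowerbound[OF A0]) auto
    then show "A x \<le> B' * x" by simp
  qed
qed

text \<open>The bound on B is what gives \<open>k * x \<le> \<phi> x\<close>: near 0,
  \<open>1 / (q - x)\<close> grows with slope \<open>1 / q\<^sup>2\<close> while
  \<open>\<alpha> / (1 - lam + A\<^sub>2 x)\<close> falls with slope
  \<open>\<alpha> * B / (1 - lam)\<^sup>2\<close>, and the bound makes the first slope the larger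
  one.\<close>

lemma exponent_correspondence:
  fixes p q lam \<alpha> B \<delta> \<delta>' \<rho> :: real and A\<^sub>1 A\<^sub>2 A\<^sub>2' :: "real \<Rightarrow> real"
  assumes p: "1 < p"
    and lam: "0 < lam" "lam < 1"
    and \<alpha>: "0 < \<alpha>" "\<alpha> < (1 - lam) / p"
    and q: "1 / p - 1 / q = \<alpha> / (1 - lam)"
    and A\<^sub>2: "\<forall>x\<in>{0<..q - 1}. 0 \<le> A\<^sub>2 x"
    and i: "0 < \<delta>" "\<delta> \<le> q - 1"
      "\<forall>x\<in>{0<..\<delta>}. (A\<^sub>2 has_real_derivative A\<^sub>2' x) (at x within {0<..\<delta>})"
    and ii: "(A\<^sub>2 \<longlongrightarrow> 0) (at_right 0)"
    and iii: "(A\<^sub>2' \<longlongrightarrow> B) (at_right 0)" "0 \<le> B" "B < (1 - lam)\<^sup>2 / (\<alpha> * q\<^sup>2)"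
    and iv: "0 < \<delta>'" "\<delta>' \<le> p - 1" "0 < \<rho>" "\<rho> \<le> q - 1"
      "bij_betw (phi_bar p q lam \<alpha> A\<^sub>2) {0<..\<rho>} {0<..\<delta>'}"
      "\<forall>\<eta>\<in>{0<..\<delta>'}. A\<^sub>1 \<eta> = A\<^sub>2 (inv_into {0<..\<rho>} (phi_bar p q lam \<alpha> A\<^sub>2) \<eta>)"
  defines "\<phi> \<equiv> phi_bar p q lam \<alpha> A\<^sub>2"
  obtains k \<sigma> where "0 < k" "0 < \<sigma>" "\<sigma> < q - 1" "p < q"
    "\<And>x. 0 < x \<Longrightarrow> x \<le> \<sigma> \<Longrightarrow> x \<le> 1 \<and> A\<^sub>2 x \<le> lam \<and> 0 < \<phi> x \<and> \<phi> x < (p - 1) / 2 \<and> \<phi> x < s_max p lam A\<^sub>1 \<and>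
      k * x \<le> \<phi> x \<and> A\<^sub>1 (\<phi> x) = A\<^sub>2 x \<and> 1 / (p - \<phi> x) - 1 / (q - x) = \<alpha> / (1 - (lam - A\<^sub>2 x))"
proof -
  have \<alpha>l: "0 < \<alpha> / (1 - lam)" using \<alpha> lam by simp
  have qpos: "1 < q" using i by linarith
  have "1 / q < 1 / p" using q \<alpha>l by linarith
  then have pq: "p < q" using p qpos by (simp add: divide_simps split: if_splits)
  have A2nn: "0 \<le> A\<^sub>2 x" if "0 < x" "x \<le> \<rho>" for x using A\<^sub>2 iv that by auto
  have \<phi>in: "0 < \<phi> x" "\<phi> x \<le> p - 1" "\<phi> x \<le> \<delta>'" if "0 < x" "x \<le> \<rho>" for x
  proof -
    have "\<phi> x \<in> {0<..\<delta>'}" unfolding \<phi>_def using bij_betwE[OF iv(5)] that by auto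
    then show "0 < \<phi> x" "\<phi> x \<le> p - 1" "\<phi> x \<le> \<delta>'" using iv by auto
  qed
  have A1\<phi>: "A\<^sub>1 (\<phi> x) = A\<^sub>2 x" if "0 < x" "x \<le> \<rho>" for x
  proof -
    have "inv_into {0<..\<rho>} \<phi> (\<phi> x) = x" unfolding \<phi>_def using that iv(5)
      by (intro inv_into_f_f) (auto simp: bij_betw_def)
    then show ?thesis using iv(6) \<phi>in(1,3)[OF that] by (simp add: \<phi>_def)
  qed
  have recip: "1 / (p - \<phi> x) = 1 / (q - x) + \<alpha> / (1 - lam + A\<^sub>2 x)" if "0 < x" "x \<le> \<rho>" for x
    unfolding \<phi>_def using that A2nn[OF that] iv lam \<alpha> by (intro p_minus_phi_bar) auto
  define B1 where "B1 = (1 - lam)\<^sup>2 / (\<alpha> * q\<^sup>2)"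
  \<comment> \<open>B' lies strictly between B and the critical value, which leaves room for the
    linear bound on \<open>A\<^sub>2\<close> near 0 and keeps k positive.\<close>
  define B' where "B' = (B + B1) / 2"
  have "B < B1" using iii(3) by (simp only: B1_def)
  then have B': "B < B'" "B' < B1" "0 \<le> B'" using iii(2) by (auto simp: B'_def)
  obtain \<sigma>1 where \<sigma>1: "0 < \<sigma>1" "\<And>x. 0 < x \<Longrightarrow> x < \<sigma>1 \<Longrightarrow> A\<^sub>2 x \<le> B' * x"
    by (rule linear_bound_at_0[OF i(1,3) ii iii(1) B'(1,3)]) blast
  define k where "k = 1 / q\<^sup>2 - \<alpha> * B' / (1 - lam)\<^sup>2"
  have k: "0 < k"
  proof -
    have "\<alpha> * B' < \<alpha> * B1" using B' \<alpha> by (intro mult_strict_left_mono) auto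
    also have "\<dots> = (1 - lam)\<^sup>2 / q\<^sup>2" using \<alpha> by (simp add: B1_def)
    finally have "\<alpha> * B' / (1 - lam)\<^sup>2 < (1 - lam)\<^sup>2 / q\<^sup>2 / (1 - lam)\<^sup>2" using lam by (intro divide_strict_right_mono) auto
    then show ?thesis using lam by (simp add: k_def)
  qed
  have lower: "k * x \<le> \<phi> x" if x: "0 < x" "x \<le> \<rho>" "x < \<sigma>1" for x
  proof -
    have xq: "x < q" using x iv by linarith
    define a where "a = A\<^sub>2 x"
    have a: "0 \<le> a" "a \<le> B' * x" using A2nn x \<sigma>1 by (auto simp: a_def)
    have r1: "1 / (q - x) - 1 / q \<ge> x / q\<^sup>2"
    proof -
      have "1 / (q - x) - 1 / q = x / (q * (q - x))" using xq qpos by (simp add: field_simps)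
      also have "\<dots> \<ge> x / (q * q)" using xq qpos x by (intro divide_left_mono mult_left_mono mult_pos_pos) auto
      finally show ?thesis by (simp add: power2_eq_square)
    qed
    have r2: "\<alpha> / (1 - lam) - \<alpha> / (1 - lam + a) \<le> \<alpha> * B' / (1 - lam)\<^sup>2 * x"
    proof -
      have "\<alpha> / (1 - lam) - \<alpha> / (1 - lam + a) = \<alpha> * a / ((1 - lam) * (1 - lam + a))" using lam a by (simp add: divide_simps algebra_simps)
      also have "\<dots> \<le> \<alpha> * a / ((1 - lam) * (1 - lam))" using lam a \<alpha> by (intro divide_left_mono mult_left_mono mult_pos_pos) auto
      also have "\<dots> \<le> \<alpha> * (B' * x) / ((1 - lam) * (1 - lam))" using lam a \<alpha> by (intro divide_right_mono mult_left_mono) auto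
      finally show ?thesis by (simp add: power2_eq_square mult_ac)
    qed
    have "k * x = x / q\<^sup>2 - \<alpha> * B' / (1 - lam)\<^sup>2 * x" by (simp add: k_def left_diff_distrib)
    \<comment> \<open>The hypothesis relating p and q is the same relation with x and
      \<open>A\<^sub>2 x\<close> replaced by 0; subtracting it from the one at x leaves the two
      differences just estimated.\<close>
    then have "k * x \<le> 1 / (p - \<phi> x) - 1 / p"
      using r1 r2 recip[OF x(1,2)] q unfolding a_def by linarith
    also have "\<dots> = \<phi> x / (p * (p - \<phi> x))" using \<phi>in[OF x(1,2)] p by (simp add: field_simps)
    also have "\<dots> \<le> \<phi> x / 1"
    proof (rule divide_left_mono)
      have "1 * 1 \<le> p * (p - \<phi> x)" using \<phi>in[OF x(1,2)] p by (intro mult_mono) auto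
      then show "1 \<le> p * (p - \<phi> x)" by simp
      then show "0 < p * (p - \<phi> x) * 1" by simp
    qed (use \<phi>in[OF x(1,2)] in auto)
    finally show ?thesis by simp
  qed
  have lim: "(\<phi> \<longlongrightarrow> 0) (at_right 0)"
  proof -
    have l: "0 < 1 - lam + \<alpha> * q" using lam \<alpha> qpos by (simp add: add_pos_pos)
    have "((\<lambda>x. p + (x - q) * (1 - lam + A\<^sub>2 x) / (1 - lam + A\<^sub>2 x - \<alpha> * (x - q))) \<longlongrightarrow>
        p + (0 - q) * (1 - lam + 0) / (1 - lam + 0 - \<alpha> * (0 - q))) (at_right 0)"
      using l by (intro tendsto_intros ii) auto
    moreover have "p + (0 - q) * (1 - lam + 0) / (1 - lam + 0 - \<alpha> * (0 - q)) = 0"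
    proof -
      have "(q - p) * (1 - lam) = \<alpha> * p * q" using q p qpos lam by (simp add: field_simps)
      then have "p * (1 - lam + \<alpha> * q) = q * (1 - lam)" by (simp add: algebra_simps)
      then show ?thesis using l by (simp add: field_simps)
    qed
    ultimately show ?thesis by (simp add: \<phi>_def phi_bar_def[abs_def])
  qed
  have "eventually (\<lambda>x. A\<^sub>2 x < lam) (at_right 0)" using ii lam(1) by (rule order_tendstoD)
  then obtain \<sigma>2 where \<sigma>2: "0 < \<sigma>2" "\<And>x. 0 < x \<Longrightarrow> x < \<sigma>2 \<Longrightarrow> A\<^sub>2 x < lam" by (auto simp: eventually_at_right_field)
  \<comment> \<open>\<open>A\<^sub>1\<close> is related to \<open>A\<^sub>2\<close> at values of
    \<open>\<phi>\<close>. Since \<open>A\<^sub>1 (\<phi> x0) \<le> lam\<close>, the point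
    \<open>\<phi> x0\<close> witnesses that every smaller \<open>\<phi> x\<close> lies below
    \<open>s_max p lam A\<^sub>1\<close>.\<close>
  define x0 where "x0 = min (\<sigma>2 / 2) \<rho>"
  have x0: "0 < x0" "x0 < \<sigma>2" "x0 \<le> \<rho>" using \<sigma>2 iv by (auto simp: x0_def)
  define y0 where "y0 = min (\<phi> x0) ((p - 1) / 2)"
  have "0 < y0" using \<phi>in(1)[OF x0(1,3)] p by (simp add: y0_def)
  with lim have "eventually (\<lambda>x. \<phi> x < y0) (at_right 0)" by (rule order_tendstoD)
  then obtain \<sigma>3 where \<sigma>3: "0 < \<sigma>3" "\<And>x. 0 < x \<Longrightarrow> x < \<sigma>3 \<Longrightarrow> \<phi> x < y0" by (auto simp: eventually_at_right_field)
  define \<mu> where "\<mu> = Min {\<sigma>1, \<sigma>2, \<sigma>3, \<rho>, 1, q - 1}"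
  have "0 < \<mu>" using \<sigma>1 \<sigma>2 \<sigma>3 iv qpos by (auto simp: \<mu>_def)
  moreover have "\<mu> \<le> \<sigma>1" "\<mu> \<le> \<sigma>2" "\<mu> \<le> \<sigma>3" "\<mu> \<le> \<rho>" "\<mu> \<le> 1" "\<mu> \<le> q - 1" by (simp_all add: \<mu>_def)
  moreover define \<sigma> where "\<sigma> = \<mu> / 2"
  ultimately have \<sigma>: "0 < \<sigma>" "\<sigma> < \<sigma>1" "\<sigma> < \<sigma>2" "\<sigma> < \<sigma>3" "\<sigma> < \<rho>" "\<sigma> < 1" "\<sigma> < q - 1"
    by simp_all
  show thesis
  proof (rule that[OF k \<sigma>(1,7) pq])
    fix x assume x: "0 < x" "x \<le> \<sigma>"
    have x\<rho>: "x \<le> \<rho>" using x \<sigma> by linarith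
    have "\<phi> x < y0" using x \<sigma> by (intro \<sigma>3) auto
    then have y: "\<phi> x < \<phi> x0" "\<phi> x < (p - 1) / 2" by (auto simp: y0_def)
    have "A\<^sub>1 (\<phi> x0) \<le> lam" using A1\<phi>[OF x0(1,3)] \<sigma>2(2)[OF x0(1,2)] by simp
    then have "\<phi> x < s_max p lam A\<^sub>1" using \<phi>in[OF x0(1,3)] y by (intro less_s_max[of "\<phi> x0"]) auto
    moreover have "A\<^sub>2 x < lam" using x \<sigma> by (intro \<sigma>2) auto
    ultimately show "x \<le> 1 \<and> A\<^sub>2 x \<le> lam \<and> 0 < \<phi> x \<and> \<phi> x < (p - 1) / 2 \<and> \<phi> x < s_max p lam A\<^sub>1 \<and>
      k * x \<le> \<phi> x \<and> A\<^sub>1 (\<phi> x) = A\<^sub>2 x \<and> 1 / (p - \<phi> x) - 1 / (q - x) = \<alpha> / (1 - (lam - A\<^sub>2 x))"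
      using x \<sigma> \<phi>in(1)[OF x(1) x\<rho>] y lower[OF x(1) x\<rho>] A1\<phi>[OF x(1) x\<rho>] recip[OF x(1) x\<rho>] by (auto simp: algebra_simps)
  qed
qed

lemma (in nondegenerate_homogeneous_space) grand_morrey_maximal_commutator:
  fixes p q lam \<alpha> \<theta>\<^sub>1 \<theta>\<^sub>2 k \<sigma> :: real and A\<^sub>1 A\<^sub>2 \<phi> :: "real \<Rightarrow> real"
  assumes b: "b \<in> BMO M d"
    and p: "1 < p" "p < q" and lam: "0 < lam" "lam < 1" and \<alpha>: "0 < \<alpha>" "\<alpha> \<le> 1"
    and \<theta>: "0 < \<theta>\<^sub>1" "\<theta>\<^sub>2 \<ge> \<theta>\<^sub>1 * (1 + \<alpha> * q / (1 - lam))"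
    and A\<^sub>2: "\<forall>x\<in>{0<..q - 1}. 0 \<le> A\<^sub>2 x" "mono_on {0<..q - 1} A\<^sub>2"
    and k: "0 < k" and \<sigma>: "0 < \<sigma>" "\<sigma> < q - 1"
    and \<phi>: "\<And>x. 0 < x \<Longrightarrow> x \<le> \<sigma> \<Longrightarrow> x \<le> 1 \<and> A\<^sub>2 x \<le> lam \<and> 0 < \<phi> x \<and> \<phi> x < (p - 1) / 2 \<and> \<phi> x < s_max p lam A\<^sub>1 \<and>
      k * x \<le> \<phi> x \<and> A\<^sub>1 (\<phi> x) = A\<^sub>2 x \<and> 1 / (p - \<phi> x) - 1 / (q - x) = \<alpha> / (1 - (lam - A\<^sub>2 x))"
  shows "\<exists>C>0. \<forall>f \<in> grand_morrey M d p lam \<theta>\<^sub>1 A\<^sub>1.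
      commutator_well_defined M d \<alpha> b f \<and>
      grand_morrey_norm M d q lam \<theta>\<^sub>2 A\<^sub>2 (maximal_operator M d (potential_commutator M d \<alpha> b f))
        \<le> ennreal C * grand_morrey_norm M d p lam \<theta>\<^sub>1 A\<^sub>1 (\<lambda>x. ennreal \<bar>f x\<bar>)"
proof -
  \<comment> \<open>\<open>\<phi> x < (p - 1) / 2\<close> means
    \<open>p - \<phi> x > (1 + p) / 2\<close>, a common lower bound above 1 for all source
    exponents.\<close>
  define s0 where "s0 = (1 + p) / 2"
  have s0: "1 < s0" using p by (simp add: s0_def)
  have lam0: "0 \<le> lam" using lam by simp
  obtain D where D: "0 < D"
    "\<And>s t \<nu> (f :: 'a \<Rightarrow> real) K. s0 \<le> s \<Longrightarrow> s < t \<Longrightarrow> t \<le> q \<Longrightarrow> 0 \<le> \<nu> \<Longrightarrow> \<nu> \<le> lam \<Longrightarrow> 1 / s - 1 / t = \<alpha> / (1 - \<nu>) \<Longrightarrow>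
      0 < K \<Longrightarrow> f \<in> borel_measurable M \<Longrightarrow> morrey_norm M d s \<nu> (\<lambda>x. ennreal \<bar>f x\<bar>) \<le> ennreal K \<Longrightarrow>
      commutator_well_defined M d \<alpha> b f \<and> morrey_majorized (maximal_operator M d (potential_commutator M d \<alpha> b f)) t \<nu> (D * K)"
    by (rule maximal_commutator_majorized[OF b s0 lam0 lam(2) \<alpha>, of q]) blast
  define E where "E = max 1 (m UNIV)"
  define w where "w x = \<phi> x powr (\<theta>\<^sub>1 / (p - \<phi> x))" for x
  define k1 where "k1 = max 1 (1 / k) powr \<theta>\<^sub>1"
  \<comment> \<open>The first entry is for parameters up to \<open>\<sigma>\<close>, the second for
    larger ones, where \<open>q powr \<theta>\<^sub>2\<close> bounds the weight and E the passage to
    a smaller exponent.\<close>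
  define C where "C = max (D * k1) (q powr \<theta>\<^sub>2 * E * D / w \<sigma>)"
  have C: "0 < C" using D k by (simp add: C_def k1_def less_max_iff_disj)
  have A2nn: "0 \<le> A\<^sub>2 x" if "0 < x" "x \<le> \<sigma>" for x using A\<^sub>2 \<sigma> that by auto
  have \<phi>s: "s0 \<le> p - \<phi> x" "1 \<le> p - \<phi> x" "p - \<phi> x < q - x" "0 < w x" if x: "0 < x" "x \<le> \<sigma>" for x
  proof -
    note * = \<phi>[OF x]
    show "s0 \<le> p - \<phi> x" using * by (simp add: s0_def field_simps)
    then show "1 \<le> p - \<phi> x" using s0 by simp
    then have ppos: "0 < p - \<phi> x" by linarith
    have "0 < \<alpha> / (1 - (lam - A\<^sub>2 x))" using \<alpha> lam A2nn[OF x] by (intro divide_pos_pos) auto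
    then have "1 / (q - x) < 1 / (p - \<phi> x)" using * by linarith
    moreover have "0 < q - x" using x \<sigma> by linarith
    ultimately show "p - \<phi> x < q - x" using ppos by (simp add: divide_simps split: if_splits)
    show "0 < w x" using * by (simp add: w_def)
  qed
  have \<theta>2: "0 < \<theta>\<^sub>2"
  proof -
    have "0 < \<theta>\<^sub>1 * (1 + \<alpha> * q / (1 - lam))" using \<theta> \<alpha> lam p by (intro mult_pos_pos add_pos_pos divide_pos_pos) auto
    then show ?thesis using \<theta> by linarith
  qed
  have weight: "x powr (\<theta>\<^sub>2 / (q - x)) \<le> k1 * w x" if x: "0 < x" "x \<le> \<sigma>" for x
  proof -
    note * = \<phi>[OF x]
    have qx: "0 < q - x" using x \<sigma> by linarith
    define a where "a = \<theta>\<^sub>1 / (p - \<phi> x)"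
    have a: "0 \<le> a" "a \<le> \<theta>\<^sub>1" using \<theta> \<phi>s(2)[OF x] by (auto simp: a_def divide_le_eq mult_le_cancel_left1)
    \<comment> \<open>The condition on \<open>\<theta>\<^sub>2\<close> enters here: by the exponent
      relation, \<open>(q - x) / (p - \<phi> x)\<close> is at most
      \<open>1 + \<alpha> * q / (1 - lam)\<close>. As \<open>x \<le> 1\<close>, the larger exponent
      gives the smaller power.\<close>
    have "a \<le> \<theta>\<^sub>2 / (q - x)"
    proof -
      have r: "1 / (p - \<phi> x) = 1 / (q - x) + \<alpha> / (1 - lam + A\<^sub>2 x)" using * by (simp add: algebra_simps)
      have "\<alpha> / (1 - lam + A\<^sub>2 x) \<le> \<alpha> / (1 - lam)" using \<alpha> lam A2nn[OF x] by (intro divide_left_mono mult_pos_pos) auto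
      also have "\<dots> = \<alpha> * (q - x) / (1 - lam) / (q - x)" using qx by simp
      also have "\<dots> \<le> \<alpha> * q / (1 - lam) / (q - x)" using \<alpha> lam qx x by (intro divide_right_mono mult_left_mono) auto
      finally have "1 / (p - \<phi> x) \<le> (1 + \<alpha> * q / (1 - lam)) / (q - x)" unfolding r by (simp add: add_divide_distrib)
      then have "\<theta>\<^sub>1 * (1 / (p - \<phi> x)) \<le> \<theta>\<^sub>1 * ((1 + \<alpha> * q / (1 - lam)) / (q - x))" using \<theta> by (intro mult_left_mono) auto
      also have "\<dots> \<le> \<theta>\<^sub>2 / (q - x)" using \<theta> qx divide_right_mono[of "\<theta>\<^sub>1 * (1 + \<alpha> * q / (1 - lam))" \<theta>\<^sub>2 "q - x"] by simp
      finally show ?thesis by (simp add: a_def)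
    qed
    then have "x powr (\<theta>\<^sub>2 / (q - x)) \<le> x powr a" using x * by (intro powr_mono') auto
    also have "\<dots> \<le> (1 / k * \<phi> x) powr a" using * k x a by (intro powr_mono2) (auto simp: field_simps)
    also have "\<dots> = (1 / k) powr a * \<phi> x powr a" by (rule powr_mult)
    also have "\<dots> \<le> k1 * \<phi> x powr a"
    proof (rule mult_right_mono)
      have "(1 / k) powr a \<le> max 1 (1 / k) powr a" using k a by (intro powr_mono2) auto
      also have "\<dots> \<le> k1" unfolding k1_def using a by (intro powr_mono) auto
      finally show "(1 / k) powr a \<le> k1" .
    qed simp
    finally show ?thesis by (simp add: w_def a_def)
  qed
  show ?thesis
  proof (intro exI[of _ C] conjI ballI C)
    fix f assume f: "f \<in> grand_morrey M d p lam \<theta>\<^sub>1 A\<^sub>1"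
    have fm: "f \<in> borel_measurable M" using f by (simp add: grand_morrey_def)
    define \<Phi> where "\<Phi> = enn2real (grand_morrey_norm M d p lam \<theta>\<^sub>1 A\<^sub>1 (\<lambda>x. ennreal \<bar>f x\<bar>))"
    have \<Phi>: "grand_morrey_norm M d p lam \<theta>\<^sub>1 A\<^sub>1 (\<lambda>x. ennreal \<bar>f x\<bar>) = ennreal \<Phi>" "0 \<le> \<Phi>"
      using f by (auto simp: \<Phi>_def grand_morrey_def less_top)
    define g where "g = maximal_operator M d (potential_commutator M d \<alpha> b f)"
    \<comment> \<open>The Morrey bound requires a positive constant while the norm
      \<open>\<Phi>\<close> may vanish; e makes up for it and is removed at the end.\<close>
    have core: "commutator_well_defined M d \<alpha> b f \<and> morrey_majorized g (q - x) (lam - A\<^sub>2 x) (D * ((\<Phi> + e) / w x))"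
      if x: "0 < x" "x \<le> \<sigma>" and e: "0 < e" for x e
    proof -
      note * = \<phi>[OF x]
      have "ennreal (w x) * morrey_norm M d (p - \<phi> x) (lam - A\<^sub>1 (\<phi> x)) (\<lambda>x. ennreal \<bar>f x\<bar>)
          \<le> grand_morrey_norm M d p lam \<theta>\<^sub>1 A\<^sub>1 (\<lambda>x. ennreal \<bar>f x\<bar>)"
        unfolding grand_morrey_norm_def w_def using * by (intro SUP_upper2[of "\<phi> x"]) auto
      also have "\<dots> \<le> ennreal (\<Phi> + e)" unfolding \<Phi>(1) using e by (intro ennreal_leI) auto
      also have "\<dots> = ennreal (w x) * ennreal ((\<Phi> + e) / w x)" using \<phi>s(4)[OF x] \<Phi>(2) e by (simp flip: ennreal_mult)
      finally have "morrey_norm M d (p - \<phi> x) (lam - A\<^sub>1 (\<phi> x)) (\<lambda>x. ennreal \<bar>f x\<bar>) \<le> ennreal ((\<Phi> + e) / w x)"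
        by (rule ennreal_mult_le_mult_iff[THEN iffD1, rotated 2]) (use \<phi>s(4)[OF x] in auto)
      then have "morrey_norm M d (p - \<phi> x) (lam - A\<^sub>2 x) (\<lambda>x. ennreal \<bar>f x\<bar>) \<le> ennreal ((\<Phi> + e) / w x)" using * by simp
      then show ?thesis unfolding g_def
        using * \<phi>s[OF x] A2nn[OF x] \<Phi>(2) e x by (intro D(2)[of "p - \<phi> x"] fm) auto
    qed
    show "commutator_well_defined M d \<alpha> b f" using core[of \<sigma> 1] \<sigma> by simp
    have bound: "grand_morrey_norm M d q lam \<theta>\<^sub>2 A\<^sub>2 g \<le> ennreal (C * (\<Phi> + e))" if e: "0 < e" for e
      unfolding grand_morrey_norm_def
    proof (rule SUP_least)
      fix x assume "x \<in> {0<..<s_max q lam A\<^sub>2}"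
      then have x: "0 < x" "x < s_max q lam A\<^sub>2" by auto
      have "x < q - 1" "A\<^sub>2 x \<le> lam" using less_s_maxD[OF A\<^sub>2(2) \<sigma>(1) _ _ x] \<sigma> \<phi>[of \<sigma>] by auto
      show "ennreal (x powr (\<theta>\<^sub>2 / (q - x))) * morrey_norm M d (q - x) (lam - A\<^sub>2 x) g \<le> ennreal (C * (\<Phi> + e))"
      proof (cases "x \<le> \<sigma>")
        case True
        have K: "0 \<le> D * ((\<Phi> + e) / w x)" using D(1) \<Phi>(2) e \<phi>s(4)[OF x(1) True] by simp
        have "morrey_norm M d (q - x) (lam - A\<^sub>2 x) g \<le> ennreal (D * ((\<Phi> + e) / w x))"
          using core[OF x(1) True e] K \<open>x < q - 1\<close> by (intro morrey_norm_le_if_majorized) auto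
        then have "ennreal (x powr (\<theta>\<^sub>2 / (q - x))) * morrey_norm M d (q - x) (lam - A\<^sub>2 x) g
            \<le> ennreal (k1 * w x) * ennreal (D * ((\<Phi> + e) / w x))"
          using weight[OF x(1) True] by (intro mult_mono ennreal_leI) auto
        also have "\<dots> = ennreal (k1 * w x * (D * ((\<Phi> + e) / w x)))"
          using K \<phi>s(4)[OF x(1) True] by (intro ennreal_mult[symmetric]) (auto simp: k1_def)
        also have "k1 * w x * (D * ((\<Phi> + e) / w x)) = (D * k1) * (\<Phi> + e)" using \<phi>s(4)[OF x(1) True] by simp
        also have "ennreal \<dots> \<le> ennreal (C * (\<Phi> + e))" using \<Phi>(2) e by (intro ennreal_leI mult_right_mono) (auto simp: C_def)
        finally show ?thesis .
      next
        case False
        then have \<sigma>x: "\<sigma> < x" by simp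
        define K where "K = D * ((\<Phi> + e) / w \<sigma>)"
        have w\<sigma>: "0 < w \<sigma>" using \<phi>s(4)[of \<sigma>] \<sigma> by simp
        have K: "0 < K" using D(1) \<Phi>(2) e w\<sigma> by (simp add: K_def)
        have A\<sigma>: "0 \<le> A\<^sub>2 \<sigma>" "A\<^sub>2 \<sigma> \<le> A\<^sub>2 x" using A2nn[of \<sigma>] \<sigma> \<sigma>x \<open>x < q - 1\<close> by (auto intro!: mono_onD[OF A\<^sub>2(2)])
        \<comment> \<open>Increasing x raises the numerator, by monotonicity of
          \<open>A\<^sub>2\<close>, and lowers the denominator; this is the condition for passing
          from the exponent \<open>q - \<sigma>\<close> down to \<open>q - x\<close>.\<close>
        have le: "(1 - (lam - A\<^sub>2 \<sigma>)) / (q - \<sigma>) \<le> (1 - (lam - A\<^sub>2 x)) / (q - x)"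
          using A\<sigma> lam \<sigma>x \<open>x < q - 1\<close> by (intro frac_le) auto
        have "morrey_majorized g (q - \<sigma>) (lam - A\<^sub>2 \<sigma>) K" using core[OF \<sigma>(1) order_refl e] by (simp add: K_def)
        then have "morrey_majorized g (q - x) (lam - A\<^sub>2 x) (E * K)"
          unfolding E_def using \<sigma>x \<open>x < q - 1\<close> \<open>A\<^sub>2 x \<le> lam\<close> A\<sigma> lam
          by (intro morrey_majorized_lower_exponent[OF _ _ _ le _ _ K]) auto
        moreover have EK: "0 \<le> E * K" using K by (simp add: E_def)
        ultimately have "morrey_norm M d (q - x) (lam - A\<^sub>2 x) g \<le> ennreal (E * K)"
          using \<open>x < q - 1\<close> by (intro morrey_norm_le_if_majorized) auto
        moreover have "x powr (\<theta>\<^sub>2 / (q - x)) \<le> q powr \<theta>\<^sub>2"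
        proof -
          have "x powr (\<theta>\<^sub>2 / (q - x)) \<le> q powr (\<theta>\<^sub>2 / (q - x))" using x \<open>x < q - 1\<close> \<theta>2 by (intro powr_mono2) auto
          also have "\<dots> \<le> q powr \<theta>\<^sub>2" using p \<theta>2 \<open>x < q - 1\<close>
            by (intro powr_mono) (auto simp: divide_le_eq mult_le_cancel_left1)
          finally show ?thesis .
        qed
        ultimately have "ennreal (x powr (\<theta>\<^sub>2 / (q - x))) * morrey_norm M d (q - x) (lam - A\<^sub>2 x) g
            \<le> ennreal (q powr \<theta>\<^sub>2) * ennreal (E * K)"
          by (intro mult_mono ennreal_leI) auto
        also have "\<dots> = ennreal (q powr \<theta>\<^sub>2 * (E * K))" using EK by (intro ennreal_mult[symmetric]) auto
        also have "q powr \<theta>\<^sub>2 * (E * K) = (q powr \<theta>\<^sub>2 * E * D / w \<sigma>) * (\<Phi> + e)" by (simp add: K_def)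
        also have "ennreal \<dots> \<le> ennreal (C * (\<Phi> + e))" using \<Phi>(2) e by (intro ennreal_leI mult_right_mono) (auto simp: C_def)
        finally show ?thesis .
      qed
    qed
    have "grand_morrey_norm M d q lam \<theta>\<^sub>2 A\<^sub>2 g \<le> ennreal (C * \<Phi>) + ennreal e" if "0 < e" for e
    proof -
      have "C * (\<Phi> + e / C) = C * \<Phi> + e" using C by (simp add: distrib_left)
      then show ?thesis using bound[of "e / C"] that C \<Phi>(2) by (simp add: ennreal_plus)
    qed
    then have "grand_morrey_norm M d q lam \<theta>\<^sub>2 A\<^sub>2 g \<le> ennreal (C * \<Phi>)" by (rule ennreal_le_epsilon)
    also have "\<dots> = ennreal C * ennreal \<Phi>" using C \<Phi>(2) by (intro ennreal_mult) auto
    finally show "grand_morrey_norm M d q lam \<theta>\<^sub>2 A\<^sub>2 (maximal_operator M d (potential_commutator M d \<alpha> b f))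
        \<le> ennreal C * grand_morrey_norm M d p lam \<theta>\<^sub>1 A\<^sub>1 (\<lambda>x. ennreal \<bar>f x\<bar>)"
      by (simp only: g_def \<Phi>(1))
  qed
qed

section \<open>One-point spaces\<close>

lemma grand_morrey_norm_zero_diam:
  assumes "qdiam d \<le> 0"
  shows "grand_morrey_norm M d q lam \<theta> A g = 0"
proof -
  \<comment> \<open>The supremum over the empty set of radii is the least element 0.\<close>
  have "morrey_norm M d s \<nu> g = 0" for s \<nu> using assms by (simp add: morrey_norm_def bot_ennreal)
  then have "grand_morrey_norm M d q lam \<theta> A g \<le> 0" unfolding grand_morrey_norm_def by (intro SUP_least) simp
  then show ?thesis by simp
qed

text \<open>All distances vanish, so every ball in the kernel is empty and division by 0 makes the
  integrands 0.\<close>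

lemma (in homogeneous_type_space) commutator_well_defined_zero_diam:
  assumes "qdiam d \<le> 0"
  shows "commutator_well_defined M d \<alpha> b f"
proof -
  have "d x y = 0" for x y using d_le_diam[of x y] d_nonneg[of x y] assms by linarith
  then have "potential_integrand M d \<alpha> h x = (\<lambda>_. 0)" for h x
    by (simp add: potential_integrand_def[abs_def] qball_def)
  then show ?thesis by (simp add: commutator_well_defined_def)
qed

theorem theorem4p6:
  fixes M :: "'a::topological_space measure" and d :: "'a \<Rightarrow> 'a \<Rightarrow> real"
    and C\<^sub>t C\<^sub>s C\<^sub>d \<gamma> c p q lam \<alpha> \<theta>\<^sub>1 \<theta>\<^sub>2 B :: real
    and A\<^sub>1 A\<^sub>2 A\<^sub>2' :: "real \<Rightarrow> real" and b :: "'a \<Rightarrow> real"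
    and \<delta> \<delta>' \<rho> :: real
  assumes space: "homogeneous_type_space M d C\<^sub>t C\<^sub>s C\<^sub>d \<gamma> c"
    and p: "1 < p"
    and lam: "0 < lam" "lam < 1"
    and \<alpha>: "0 < \<alpha>" "\<alpha> < (1 - lam) / p"
    and q: "1 / p - 1 / q = \<alpha> / (1 - lam)"
    and \<theta>\<^sub>1: "0 < \<theta>\<^sub>1"
    and \<theta>\<^sub>2: "\<theta>\<^sub>2 \<ge> \<theta>\<^sub>1 * (1 + \<alpha> * q / (1 - lam))"
    and A\<^sub>1: "continuous_on {0<..p - 1} A\<^sub>1" "\<forall>x\<in>{0<..p - 1}. 0 \<le> A\<^sub>1 x" "mono_on {0<..p - 1} A\<^sub>1"
    and A\<^sub>2: "continuous_on {0<..q - 1} A\<^sub>2" "\<forall>x\<in>{0<..q - 1}. 0 \<le> A\<^sub>2 x" "mono_on {0<..q - 1} A\<^sub>2"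
    and i: "0 < \<delta>" "\<delta> \<le> q - 1"
      "\<forall>x\<in>{0<..\<delta>}. (A\<^sub>2 has_real_derivative A\<^sub>2' x) (at x within {0<..\<delta>})"
      "continuous_on {0<..\<delta>} A\<^sub>2'"
    and ii: "(A\<^sub>2 \<longlongrightarrow> 0) (at_right 0)"
    and iii: "(A\<^sub>2' \<longlongrightarrow> B) (at_right 0)" "0 \<le> B" "B < (1 - lam)\<^sup>2 / (\<alpha> * q\<^sup>2)"
    and iv: "0 < \<delta>'" "\<delta>' \<le> p - 1" "0 < \<rho>" "\<rho> \<le> q - 1"
      "bij_betw (phi_bar p q lam \<alpha> A\<^sub>2) {0<..\<rho>} {0<..\<delta>'}"
      "\<forall>\<eta>\<in>{0<..\<delta>'}. A\<^sub>1 \<eta> = A\<^sub>2 (inv_into {0<..\<rho>} (phi_bar p q lam \<alpha> A\<^sub>2) \<eta>)"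
    and b: "b \<in> BMO M d"
  shows "\<exists>C>0. \<forall>f \<in> grand_morrey M d p lam \<theta>\<^sub>1 A\<^sub>1.
      commutator_well_defined M d \<alpha> b f \<and>
      grand_morrey_norm M d q lam \<theta>\<^sub>2 A\<^sub>2 (maximal_operator M d (potential_commutator M d \<alpha> b f))
        \<le> ennreal C * grand_morrey_norm M d p lam \<theta>\<^sub>1 A\<^sub>1 (\<lambda>x. ennreal \<bar>f x\<bar>)"
proof -
  interpret homogeneous_type_space M d C\<^sub>t C\<^sub>s C\<^sub>d \<gamma> c by (rule space)
  show ?thesis
  proof (cases "0 < qdiam d")
    case False
    then show ?thesis
      by (intro exI[of _ 1]) (simp add: grand_morrey_norm_zero_diam commutator_well_defined_zero_diam)
  next
    case True
    interpret nondegenerate_homogeneous_space M d C\<^sub>t C\<^sub>s C\<^sub>d \<gamma> c by unfold_locales (rule True)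
    have "(1 - lam) / p \<le> 1" using p lam by (simp add: divide_le_eq)
    then have \<alpha>1: "\<alpha> \<le> 1" using \<alpha> by linarith
    obtain k \<sigma> where k: "0 < k" and \<sigma>: "0 < \<sigma>" "\<sigma> < q - 1" and pq: "p < q"
      and \<phi>: "\<And>x. 0 < x \<Longrightarrow> x \<le> \<sigma> \<Longrightarrow> x \<le> 1 \<and> A\<^sub>2 x \<le> lam \<and> 0 < phi_bar p q lam \<alpha> A\<^sub>2 x \<and>
        phi_bar p q lam \<alpha> A\<^sub>2 x < (p - 1) / 2 \<and> phi_bar p q lam \<alpha> A\<^sub>2 x < s_max p lam A\<^sub>1 \<and>
        k * x \<le> phi_bar p q lam \<alpha> A\<^sub>2 x \<and> A\<^sub>1 (phi_bar p q lam \<alpha> A\<^sub>2 x) = A\<^sub>2 x \<and>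
        1 / (p - phi_bar p q lam \<alpha> A\<^sub>2 x) - 1 / (q - x) = \<alpha> / (1 - (lam - A\<^sub>2 x))"
      by (rule exponent_correspondence[OF p lam \<alpha> q A\<^sub>2(2) i(1-3) ii iii iv]) blast
    show ?thesis
      by (rule grand_morrey_maximal_commutator[OF b p pq lam \<alpha>(1) \<alpha>1 \<theta>\<^sub>1 \<theta>\<^sub>2 A\<^sub>2(2,3) k \<sigma> \<phi>])
  qed
qed

end
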